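(* There is an absolute constant $C>0$ such that the following holds. Let $p$ be an odd prime, $F=\mathbb{F}_p$, $t\in F$ with $t\neq 0$, and let $A\subseteq \mathcal S^2_t$ be a set with at most $k_0$ points on any isotropic line. Then $$\mathsf E(A)\ \le\ C\left(|A|k_0^2+|A|^{37/15}\right)\qquad\text{if } |A|<p^{15/11},$$ and (with no restriction on $|A|$) $$\mathsf E(A)\ \le\ C\left(|A|k_0^2+\frac{|A|^3}{p}+|A|^2\sqrt p\right).$$
   Context: For $t\ne0$, $\mathcal S^2_t=\{x\in F^3:\ x_1^2+x_2^2+x_3^2=t\}$. The additive energy of a finite set $A\subset F^3$ is $\mathsf E(A)=|\{(x,y,z,u)\in A^4:\ x+y=z+u\}|$. A nonzero vector $s\in F^3$ is isotropic if $s\cdot s=0$ for the standard dot product; an isotropic line is an affine line in $F^3$ whose direction vector is isotropic. *)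

theory Defs
  imports Complex_Main "HOL-Number_Theory.Residues"
begin

text \<open>
  Since the constant in the theorem is to be independent of the prime, the field is a value of the
  logic, \<open>residue_ring (int p)\<close>, rather than a type. The definitions make sense
  for any ring structure \<open>R\<close>; vectors are triples of elements of \<open>carrier R\<close>.
\<close>

definition space3 :: "('a, 'b) ring_scheme \<Rightarrow> ('a \<times> 'a \<times> 'a) set" where
  "space3 R = carrier R \<times> carrier R \<times> carrier R"

fun add3 :: "('a, 'b) ring_scheme \<Rightarrow> 'a \<times> 'a \<times> 'a \<Rightarrow> 'a \<times> 'a \<times> 'a \<Rightarrow> 'a \<times> 'a \<times> 'a" where
  "add3 R (x1, x2, x3) (y1, y2, y3) = (x1 \<oplus>\<^bsub>R\<^esub> y1, x2 \<oplus>\<^bsub>R\<^esub> y2, x3 \<oplus>\<^bsub>R\<^esub> y3)"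

fun scale3 :: "('a, 'b) ring_scheme \<Rightarrow> 'a \<Rightarrow> 'a \<times> 'a \<times> 'a \<Rightarrow> 'a \<times> 'a \<times> 'a" where
  "scale3 R c (x1, x2, x3) = (c \<otimes>\<^bsub>R\<^esub> x1, c \<otimes>\<^bsub>R\<^esub> x2, c \<otimes>\<^bsub>R\<^esub> x3)"

fun dot3 :: "('a, 'b) ring_scheme \<Rightarrow> 'a \<times> 'a \<times> 'a \<Rightarrow> 'a \<times> 'a \<times> 'a \<Rightarrow> 'a" where
  "dot3 R (x1, x2, x3) (y1, y2, y3) = x1 \<otimes>\<^bsub>R\<^esub> y1 \<oplus>\<^bsub>R\<^esub> x2 \<otimes>\<^bsub>R\<^esub> y2 \<oplus>\<^bsub>R\<^esub> x3 \<otimes>\<^bsub>R\<^esub> y3"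

definition sphere2 :: "('a, 'b) ring_scheme \<Rightarrow> 'a \<Rightarrow> ('a \<times> 'a \<times> 'a) set" where
  "sphere2 R t = {(x1, x2, x3) \<in> space3 R.
     x1 [^]\<^bsub>R\<^esub> (2::nat) \<oplus>\<^bsub>R\<^esub> x2 [^]\<^bsub>R\<^esub> (2::nat) \<oplus>\<^bsub>R\<^esub> x3 [^]\<^bsub>R\<^esub> (2::nat) = t}"

definition isotropic :: "('a, 'b) ring_scheme \<Rightarrow> 'a \<times> 'a \<times> 'a \<Rightarrow> bool" where
  "isotropic R s \<longleftrightarrow>
     s \<in> space3 R \<and> s \<noteq> (\<zero>\<^bsub>R\<^esub>, \<zero>\<^bsub>R\<^esub>, \<zero>\<^bsub>R\<^esub>) \<and> dot3 R s s = \<zero>\<^bsub>R\<^esub>"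

definition affine_line :: "('a, 'b) ring_scheme \<Rightarrow> 'a \<times> 'a \<times> 'a \<Rightarrow> 'a \<times> 'a \<times> 'a \<Rightarrow> ('a \<times> 'a \<times> 'a) set" where
  "affine_line R a s = {add3 R a (scale3 R c s) | c. c \<in> carrier R}"

definition isotropic_line :: "('a, 'b) ring_scheme \<Rightarrow> ('a \<times> 'a \<times> 'a) set \<Rightarrow> bool" where
  "isotropic_line R L \<longleftrightarrow> (\<exists>a s. a \<in> space3 R \<and> isotropic R s \<and> L = affine_line R a s)"

definition additive_energy :: "('a, 'b) ring_scheme \<Rightarrow> ('a \<times> 'a \<times> 'a) set \<Rightarrow> nat" where
  "additive_energy R A =
     card {(x, y, z, u). x \<in> A \<and> y \<in> A \<and> z \<in> A \<and> u \<in> A \<and> add3 R x y = add3 R z u}"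

end

theory Submission
  imports Defs "HOL-Algebra.Algebraic_Closure_Type" "Berlekamp_Zassenhaus.Finite_Field"
    "Subresultants.Subresultant_Gcd" "HOL-Library.Product_Plus"
begin

text \<open>
  On a sphere \<open>x \<cdot> x = t\<close> the fourth vertex of a parallelogram
  \<open>x + y = z + u\<close> lies on the sphere if and only if the angle at \<open>z\<close> is right, so
  the energy counts triples with \<open>(x - z) \<cdot> (y - z) = 0\<close>
  (\<open>parallelogram_on_sphere\<close>). Fix the vertex \<open>z\<close>. The isotropic chords
  \<open>x - z\<close> lie on at most two lines, and the partners of each of them on at most two parallel
  isotropic lines, which accounts for \<open>8 k0\<^sup>2\<close> pairs. The non-isotropic chords at
  \<open>z\<close> are pairwise non-parallel, because a line through \<open>z\<close> meets the sphere only once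
  more. They are therefore distinct points of a projective plane, and what remains to be counted are incidences of
  these points with the lines orthogonal to them (\<open>energy_on_sphere\<close>).

  The bound for sets of any size uses the second moment of the number of incidences over the whole plane
  (\<open>incidences_by_second_moment\<close>). The bound with the exponent \<open>37/15 = 1 + 22/15\<close>
  needs for \<open>n\<close> points and \<open>n\<close> lines that they have \<open>O(n^(22/15))\<close>
  incidences (\<open>projective_incidences\<close>); here \<open>n\<^sup>4 \<le> p\<^sup>5\<close> may be
  assumed, since for larger \<open>n < p^(15/11)\<close> the second moment already gives this exponent.

  The incidence bound goes from the plane to a grid and from the grid to lines in space. In a subconfiguration
  that is extremal for \<open>I\<^sup>3 / (card P * card L)\<close> the degrees are almost regular, and two
  points \<open>q1, q2\<close> can be chosen such that many points lie on intersections of a line through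
  \<open>q1\<close> with a line through \<open>q2\<close> (\<open>rich_grid\<close>). A projective transformation
  makes these points a part of a Cartesian product (\<open>grid_incidences\<close>). By the Cauchy-Schwarz
  inequality it then suffices to count solutions of \<open>s x + c = s' x' + c'\<close>, that is pairs of
  points \<open>(s, x', c)\<close>, \<open>(s', x, c')\<close> of three-space that are orthogonal for a
  symplectic form (\<open>cartesian_incidences\<close>).

  The lines in space that are isotropic for \<open>u w - v\<^sup>2\<close> are again parametrised by points of
  three-space, and two of them meet if and only if their parameters are orthogonal for the symplectic form. Over
  the algebraic closure, two generic affine maps turn one copy of the points into red lines and another copy into
  blue lines, such that only lines of different colours meet, and exactly when the points are orthogonal
  (\<open>line_form_red_blue\<close>). If each blue line meets many more than \<open>sqrt (card R)\<close> of
  the lines of the red family \<open>R\<close>, then a surface of small degree through a random sample of the red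
  lines contains at least half of the blue lines; if these are not fewer than the red ones
  (\<open>crossing_degree_le\<close>), this exceeds the number of blue lines that such a surface can contain
  (\<open>richly_crossed_lines_card\<close>). The reason for the latter is a dichotomy. At a point where two
  isotropic lines of the surface cross, the surface has contact of order two with both of them. This is a
  condition of degree at most \<open>4 d\<close>, so either it cuts out a curve on the surface, which contains
  few lines, or it holds on the whole surface. In the second case the surface contains with each tangent isotropic
  direction the whole line, it is swept out by the lines that meet any given blue line, and three blue lines then
  force two of them to be met by the same red lines.

  The field of the argument is a type, while in the theorem it is a value. A type with a prime number of elements
  is therefore introduced whose size is a prime that refutes the bounds with the constant \<open>2^27\<close>, if
  there is one; the bounds for this type show that there is none.
\<close>

hide_const (open) Polynomials.degree Polynomials.lead_coeff Divisibility.prime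

section \<open>Common zeros of two coprime bivariate polynomials\<close>

text \<open>The Sylvester matrix of \<open>f\<close> and \<open>g\<close> sends the column of powers of \<open>v\<close> to multiples of
  \<open>f(v)\<close> and \<open>g(v)\<close>, so after substituting a common zero it is singular.\<close>
lemma resultant_at_common_zero:
  fixes f g :: "'r::idom poly poly"
  assumes pos: "degree f + degree g > 0"
    and f0: "poly (poly f [:v:]) u = 0" and g0: "poly (poly g [:v:]) u = 0"
  shows "poly (resultant f g) u = 0"
proof -
  define h where "h = (\<lambda>c::'r poly. poly c u)"
  interpret h: comm_ring_hom h by unfold_locales (auto simp: h_def)
  define m n where "m = degree f" and "n = degree g"
  define S where "S = map_mat h (sylvester_mat f g)"
  have S: "S \<in> carrier_mat (m+n) (m+n)" by (simp add: S_def m_def n_def sylvester_carrier_mat)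
  have ev: "poly (poly q [:v:]) u = (\<Sum>i\<le>degree q. h (coeff q i) * v ^ i)" for q :: "'r poly poly"
    by (simp add: poly_altdef[of q] poly_sum h_def)
  define x where "x = vec (m+n) (\<lambda>j. v ^ (m+n-1-j))"
  have xc: "x \<in> carrier_vec (m+n)" by (simp add: x_def)
  have mn: "m + n > 0" using pos by (simp add: m_def n_def)
  have "x $ (m+n-1) = 1" using mn by (simp add: x_def)
  hence xnz: "x \<noteq> 0\<^sub>v (m+n)" using mn by (metis diff_less index_zero_vec(1) less_one zero_neq_one)
  have row: "(\<Sum>j<m+n. S $$ (i,j) * v ^ (m+n-1-j)) = 0" if i: "i < m+n" for i
  proof (cases "i < n")
    case True
    have "(\<Sum>j<m+n. S $$ (i,j) * v ^ (m+n-1-j)) = (\<Sum>j\<in>{i..m+i}. h (coeff f (m + i - j)) * v ^ (m+n-1-j))"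
    proof (rule sum.mono_neutral_cong_right)
      show "{i..m+i} \<subseteq> {..<m+n}" using True by auto
      show "\<forall>j\<in>{..<m+n} - {i..m+i}. S $$ (i,j) * v ^ (m+n-1-j) = 0"
        using i True by (auto simp: S_def sylvester_mat_def sylvester_mat_sub_index m_def n_def)
      show "S $$ (i,j) * v ^ (m+n-1-j) = h (coeff f (m + i - j)) * v ^ (m+n-1-j)" if "j \<in> {i..m+i}" for j
        using i True that by (auto simp: S_def sylvester_mat_def sylvester_mat_sub_index m_def n_def)
    qed auto
    also have "\<dots> = (\<Sum>k\<le>m. h (coeff f k) * v ^ k * v ^ (n - 1 - i))"
    proof (rule sum.reindex_bij_witness[where i="\<lambda>k. m + i - k" and j="\<lambda>j. m + i - j"])
      fix j assume j: "j \<in> {i..m+i}"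
      have "m+n-1-j = (m+i-j) + (n-1-i)" using j True by auto
      thus "h (coeff f (m+i-j)) * v ^ (m+i-j) * v ^ (n-1-i) = h (coeff f (m + i - j)) * v ^ (m+n-1-j)"
        by (simp add: power_add)
    qed auto
    also have "\<dots> = poly (poly f [:v:]) u * v ^ (n - 1 - i)" by (simp add: ev m_def sum_distrib_right)
    finally show ?thesis using f0 by simp
  next
    case False
    have "(\<Sum>j<m+n. S $$ (i,j) * v ^ (m+n-1-j)) = (\<Sum>j\<in>{i-n..i}. h (coeff g (i - j)) * v ^ (m+n-1-j))"
    proof (rule sum.mono_neutral_cong_right)
      show "{i-n..i} \<subseteq> {..<m+n}" using i by auto
      show "\<forall>j\<in>{..<m+n} - {i-n..i}. S $$ (i,j) * v ^ (m+n-1-j) = 0"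
        using i False by (auto simp: S_def sylvester_mat_def sylvester_mat_sub_index m_def n_def)
      show "S $$ (i,j) * v ^ (m+n-1-j) = h (coeff g (i - j)) * v ^ (m+n-1-j)" if "j \<in> {i-n..i}" for j
        using i False that by (auto simp: S_def sylvester_mat_def sylvester_mat_sub_index m_def n_def)
    qed auto
    also have "\<dots> = (\<Sum>k\<le>n. h (coeff g k) * v ^ k * v ^ (m + n - 1 - i))"
    proof (rule sum.reindex_bij_witness[where i="\<lambda>k. i - k" and j="\<lambda>j. i - j"])
      fix j assume j: "j \<in> {i-n..i}"
      have "m+n-1-j = (i-j) + (m+n-1-i)" using j i by auto
      thus "h (coeff g (i-j)) * v ^ (i-j) * v ^ (m+n-1-i) = h (coeff g (i - j)) * v ^ (m+n-1-j)"
        by (simp add: power_add)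
    qed (use False in auto)
    also have "\<dots> = poly (poly g [:v:]) u * v ^ (m + n - 1 - i)" by (simp add: ev n_def sum_distrib_right)
    finally show ?thesis using g0 by simp
  qed
  have "S *\<^sub>v x = 0\<^sub>v (m+n)"
    using S row by (intro eq_vecI) (auto simp: x_def scalar_prod_def lessThan_atLeast0)
  hence "det S = 0" using det_0_iff_vec_prod_zero[OF S] xc xnz by blast
  thus ?thesis using h.hom_det[of "sylvester_mat f g"] by (simp add: S_def resultant_def h_def)
qed

lemma degree_resultant_le:
  fixes f g :: "'r::idom poly poly"
  assumes "degree f \<le> a" "degree g \<le> b" "\<And>i. degree (coeff f i) \<le> a" "\<And>i. degree (coeff g i) \<le> b"
  shows "degree (resultant f g) \<le> 2 * a * b"
proof -
  define m n where "m = degree f" and "n = degree g"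
  let ?S = "sylvester_mat f g"
  have S: "?S \<in> carrier_mat (m+n) (m+n)" by (simp add: m_def n_def sylvester_carrier_mat)
  have ent: "degree (?S $$ (i,j)) \<le> (if i < n then a else b)" if "i < m+n" "j < m+n" for i j
    using that assms by (auto simp: sylvester_mat_def sylvester_mat_sub_index m_def n_def)
  have "degree (signof p * (\<Prod>i = 0..<m+n. ?S $$ (i, p i))) \<le> 2*a*b" if p: "p permutes {0..<m+n}" for p
  proof -
    have "degree (\<Prod>i = 0..<m+n. ?S $$ (i, p i)) \<le> (\<Sum>i=0..<m+n. degree (?S $$ (i, p i)))"
      using degree_prod_sum_le[of "{0..<m+n}" "\<lambda>i. ?S $$ (i, p i)"] by (simp add: o_def)
    also have "\<dots> \<le> (\<Sum>i=0..<m+n. if i < n then a else b)"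
      using p by (intro sum_mono ent) (auto dest: permutes_in_image)
    also have "\<dots> = (\<Sum>i\<in>{0..<n}. a) + (\<Sum>i\<in>{n..<m+n}. b)"
    proof -
      have "{0..<m+n} = {0..<n} \<union> {n..<m+n}" by auto
      thus ?thesis by (simp add: sum.union_disjoint)
    qed
    also have "\<dots> = n * a + m * b" by simp
    also have "\<dots> \<le> b * a + a * b" using assms by (intro add_mono mult_mono) (auto simp: m_def n_def)
    also have "b * a + a * b = 2*a*b" by simp
    finally have d: "degree (\<Prod>i = 0..<m+n. ?S $$ (i, p i)) \<le> 2*a*b" .
    show ?thesis using d by (cases "evenperm p") (auto simp: sign_def)
  qed
  thus ?thesis unfolding resultant_def det_def'[OF S] by (intro degree_sum_le) (auto simp: finite_permutations)
qed

lemma zero_dvd_const: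
  assumes "poly c u = (0::'r::idom)" shows "[:[:-u,1:]:] dvd [:c:]"
  using assms by (simp add: poly_eq_0_iff_dvd)

text \<open>First coordinates of common zeros are roots of the resultant, which is nonzero by coprimality. Only first
  coordinates are counted because the families of lines below are arranged to be told apart by them.\<close>
lemma coprime_common_zeros_card:
  fixes f g :: "'r::{factorial_ring_gcd,semiring_gcd_mult_normalize,idom} poly poly"
  assumes cop: "coprime f g"
    and bd: "degree f \<le> a" "degree g \<le> b" "\<And>i. degree (coeff f i) \<le> a" "\<And>i. degree (coeff g i) \<le> b"
  shows "finite {u. \<exists>v. poly (poly f [:v:]) u = 0 \<and> poly (poly g [:v:]) u = 0}" (is "finite ?U")
    and "card {u. \<exists>v. poly (poly f [:v:]) u = 0 \<and> poly (poly g [:v:]) u = 0} \<le> 2 * a * b"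
proof -
  have "finite ?U \<and> card ?U \<le> 2*a*b"
  proof (cases "degree f + degree g > 0")
    case True
    let ?R = "resultant f g"
    have "degree (gcd f g) = 0" using cop by (simp add: coprime_iff_gcd_eq_1)
    hence R: "?R \<noteq> 0" using resultant_0_gcd[of f g] by auto
    have sub: "?U \<subseteq> {u. poly ?R u = 0}" using resultant_at_common_zero[OF True] by blast
    have fin: "finite {u. poly ?R u = 0}" using R by (rule poly_roots_finite)
    have "card ?U \<le> card {u. poly ?R u = 0}" using fin sub by (rule card_mono)
    also have "\<dots> \<le> degree ?R" using R by (rule card_poly_roots_bound)
    also have "\<dots> \<le> 2*a*b" using bd by (rule degree_resultant_le)
    finally show ?thesis using sub fin finite_subset by blast
  next
    case False
    then obtain c d where fg: "f = [:c:]" "g = [:d:]" by (metis add_gr_0 degree_eq_zeroE gr0I)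
    have "?U = {}"
    proof (rule ccontr)
      assume "?U \<noteq> {}"
      then obtain u where "poly c u = 0" "poly d u = 0" using fg by auto
      hence "[:[:-u,1:]:] dvd f" "[:[:-u,1:]:] dvd g" using fg zero_dvd_const by auto
      hence "is_unit [:[:-u,1:]:]" using coprime_common_divisor[OF cop] by blast
      thus False by (auto simp: is_unit_const_poly_iff is_unit_poly_iff)
    qed
    thus ?thesis by (metis card.empty finite.emptyI zero_le)
  qed
  thus "finite ?U" "card ?U \<le> 2*a*b" by auto
qed

text \<open>Over each of the finitely many first coordinates \<open>u\<close>, one of \<open>f(u, _)\<close>,
  \<open>g(u, _)\<close> is a nonzero polynomial, since otherwise the linear polynomial with root
  \<open>u\<close> would divide both.\<close>
lemma coprime_common_zeros_finite:
  fixes f g :: "'r::{factorial_ring_gcd,semiring_gcd_mult_normalize,idom} poly poly"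
  assumes cop: "coprime f g"
  shows "finite {(u,v). poly (poly f [:v:]) u = 0 \<and> poly (poly g [:v:]) u = 0}" (is "finite ?Z")
proof -
  define a where "a = Max (insert (degree f) ((\<lambda>i. degree (coeff f i)) ` {..degree f}))"
  define b where "b = Max (insert (degree g) ((\<lambda>i. degree (coeff g i)) ` {..degree g}))"
  have da: "degree (coeff f i) \<le> a" for i
  proof (cases "i \<le> degree f")
    case True thus ?thesis unfolding a_def by (intro Max_ge) auto
  qed (simp add: coeff_eq_0)
  have db: "degree (coeff g i) \<le> b" for i
  proof (cases "i \<le> degree g")
    case True thus ?thesis unfolding b_def by (intro Max_ge) auto
  qed (simp add: coeff_eq_0)
  have ab: "degree f \<le> a" "degree g \<le> b" by (auto simp: a_def b_def)
  let ?U = "{u. \<exists>v. poly (poly f [:v:]) u = 0 \<and> poly (poly g [:v:]) u = 0}"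
  have finU: "finite ?U" by (rule coprime_common_zeros_card(1)[OF cop ab da db])
  define h where "h = (\<lambda>u q. map_poly (\<lambda>c::'r poly. poly c u) q)"
  have hev: "poly (h u q) v = poly (poly q [:v:]) u" for u v q
  proof (induction q)
    case (pCons c q) thus ?case by (simp add: h_def Polynomial.map_poly_pCons)
  qed (simp add: h_def)
  have dvdh: "[:[:-u,1:]:] dvd q" if "h u q = 0" for u q
  proof -
    have "poly (coeff q i) u = 0" for i
      using that coeff_map_poly[of "\<lambda>c::'r poly. poly c u" q i] by (simp add: h_def)
    thus ?thesis by (simp add: const_poly_dvd_iff poly_eq_0_iff_dvd)
  qed
  have finV: "finite {v. poly (poly f [:v:]) u = 0 \<and> poly (poly g [:v:]) u = 0}" (is "finite ?V") for u
  proof (cases "h u f = 0 \<and> h u g = 0")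
    case True
    hence "[:[:-u,1:]:] dvd f" "[:[:-u,1:]:] dvd g" using dvdh by auto
    hence "is_unit [:[:-u,1:]:]" using coprime_common_divisor[OF cop] by blast
    hence False by (auto simp: is_unit_const_poly_iff is_unit_poly_iff)
    thus ?thesis ..
  next
    case False
    have "?V \<subseteq> {v. poly (h u f) v = 0}" "?V \<subseteq> {v. poly (h u g) v = 0}" by (auto simp: hev)
    thus ?thesis using False poly_roots_finite[of "h u f"] poly_roots_finite[of "h u g"] finite_subset by blast
  qed
  have "?Z \<subseteq> (\<Union>u\<in>?U. Pair u ` {v. poly (poly f [:v:]) u = 0 \<and> poly (poly g [:v:]) u = 0})" by auto
  moreover have "finite (\<Union>u\<in>?U. Pair u ` {v. poly (poly f [:v:]) u = 0 \<and> poly (poly g [:v:]) u = 0})"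
    using finU finV by (intro finite_UN_I finite_imageI)
  ultimately show ?thesis by (rule finite_subset)
qed

section \<open>Total degree of polynomials in three variables\<close>

text \<open>The degree of a polynomial over a ring whose elements carry a degree \<open>D\<close> themselves; iterated
  twice, it gives the total degree.\<close>
definition weighted_degree :: "('r::zero \<Rightarrow> nat) \<Rightarrow> 'r poly \<Rightarrow> nat" where
  "weighted_degree D p = (if p = 0 then 0 else Max ((\<lambda>i. D (coeff p i) + i) ` {i. coeff p i \<noteq> 0}))"

lemma finite_support_coeff: "finite {i. coeff p i \<noteq> 0}"
  using MOST_coeff_eq_0[of p] by (simp add: MOST_nat finite_nat_set_iff_bounded_le not_le) (meson not_less)

lemma weighted_degree_le_iff:
  "weighted_degree D p \<le> n \<longleftrightarrow> (\<forall>i. coeff p i \<noteq> 0 \<longrightarrow> D (coeff p i) + i \<le> n)"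
proof (cases "p = 0")
  case False
  hence "{i. coeff p i \<noteq> 0} \<noteq> {}" by (auto simp: poly_eq_iff)
  thus ?thesis using False finite_support_coeff[of p] by (auto simp: weighted_degree_def)
qed (simp add: weighted_degree_def)

lemma weighted_degree_coeff: "coeff p i \<noteq> 0 \<Longrightarrow> D (coeff p i) + i \<le> weighted_degree D p"
  using weighted_degree_le_iff[of D p "weighted_degree D p"] by simp

locale degree_valuation =
  fixes D :: "'r::idom \<Rightarrow> nat"
  assumes D_mult: "a \<noteq> 0 \<Longrightarrow> b \<noteq> 0 \<Longrightarrow> D (a * b) = D a + D b"
    and D_add: "D (a + b) \<le> max (D a) (D b)"
    and D_0: "D 0 = 0"
begin

lemma D_sum: "finite S \<Longrightarrow> (\<And>i. i \<in> S \<Longrightarrow> D (f i) \<le> n) \<Longrightarrow> D (sum f S) \<le> n"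
proof (induction S rule: finite_induct)
  case (insert x F)
  thus ?case using D_add[of "f x" "sum f F"] by (auto intro: order.trans)
qed (simp add: D_0)

lemma D_uminus: "D (- a) = D a"
proof (cases "a = 0")
  case False
  have "D 1 = 0" using D_mult[of 1 1] by simp
  hence "D (-1) = 0" using D_mult[of "-1" "-1"] by simp
  thus ?thesis using D_mult[of "-1" a] False by simp
qed simp

lemma D_mult_le: "D (a * b) \<le> D a + D b"
  by (cases "a = 0 \<or> b = 0") (auto simp: D_mult D_0)

text \<open>A product of two polynomials has exactly the expected weighted degree: in the coefficient
  whose index is the sum of the largest indices attaining the two degrees, one summand dominates.\<close>
lemma weighted_degree_valuation: "degree_valuation (weighted_degree D)"
proof
  let ?W = "weighted_degree D"
  show "?W 0 = 0" by (simp add: weighted_degree_def)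
  show "?W (p + q) \<le> max (?W p) (?W q)" for p q
  proof (subst weighted_degree_le_iff, intro allI impI)
    fix i assume nz: "coeff (p + q) i \<noteq> 0"
    have le: "D (coeff r i) + i \<le> ?W r \<or> coeff r i = 0" for r using weighted_degree_coeff[of r i D] by blast
    have "D (coeff p i + coeff q i) \<le> max (D (coeff p i)) (D (coeff q i))" by (rule D_add)
    thus "D (coeff (p + q) i) + i \<le> max (?W p) (?W q)"
      using le[of p] le[of q] nz D_0 by auto
  qed
  show "?W (p * q) = ?W p + ?W q" if p: "p \<noteq> 0" and q: "q \<noteq> 0" for p q
  proof (rule antisym)
    show "?W (p * q) \<le> ?W p + ?W q"
    proof (subst weighted_degree_le_iff, intro allI impI)
      fix i
      assume nz: "coeff (p * q) i \<noteq> 0"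
      have t: "D (coeff p j * coeff q (i - j)) \<le> ?W p + ?W q - i \<and> (coeff p j * coeff q (i-j) \<noteq> 0 \<longrightarrow> i \<le> ?W p + ?W q)"
        if "j \<le> i" for j
      proof (cases "coeff p j = 0 \<or> coeff q (i - j) = 0")
        case False
        thus ?thesis using weighted_degree_coeff[of p j D] weighted_degree_coeff[of q "i-j" D] that
          by (auto simp: D_mult)
      qed (auto simp: D_0)
      have "D (coeff (p * q) i) \<le> ?W p + ?W q - i" unfolding coeff_mult
        by (rule D_sum) (use t in auto)
      moreover have "i \<le> ?W p + ?W q"
      proof (rule ccontr)
        assume "\<not> ?thesis"
        hence "coeff (p * q) i = 0" unfolding coeff_mult using t by (intro sum.neutral) blast
        thus False using nz by simp
      qed
      ultimately show "D (coeff (p * q) i) + i \<le> ?W p + ?W q" by simp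
    qed
    have ex: "\<exists>i. coeff r i \<noteq> 0 \<and> D (coeff r i) + i = ?W r \<and>
        (\<forall>j>i. coeff r j \<noteq> 0 \<longrightarrow> D (coeff r j) + j < ?W r)" if r: "r \<noteq> 0" for r
    proof -
      let ?I = "{i. coeff r i \<noteq> 0 \<and> D (coeff r i) + i = ?W r}"
      have ne: "{i. coeff r i \<noteq> 0} \<noteq> {}" using r by (auto simp: poly_eq_iff)
      have fin: "finite ?I" using finite_support_coeff[of r] by (rule rev_finite_subset) auto
      have "?W r \<in> (\<lambda>i. D (coeff r i) + i) ` {i. coeff r i \<noteq> 0}"
        using r ne finite_support_coeff[of r] unfolding weighted_degree_def by (simp add: Max_in)
      hence I: "?I \<noteq> {}" by auto
      have M: "Max ?I \<in> ?I" by (rule Max_in[OF fin I])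
      have "D (coeff r j) + j < ?W r" if "j > Max ?I" "coeff r j \<noteq> 0" for j
        using that weighted_degree_coeff[of r j D] Max_ge[OF fin, of j] by force
      thus ?thesis using M by blast
    qed
    obtain i where i: "coeff p i \<noteq> 0" "D (coeff p i) + i = ?W p"
      "\<And>j. j > i \<Longrightarrow> coeff p j \<noteq> 0 \<Longrightarrow> D (coeff p j) + j < ?W p" using ex[OF p] by blast
    obtain k where k: "coeff q k \<noteq> 0" "D (coeff q k) + k = ?W q"
      "\<And>j. j > k \<Longrightarrow> coeff q j \<noteq> 0 \<Longrightarrow> D (coeff q j) + j < ?W q" using ex[OF q] by blast
    let ?n = "i + k"
    let ?rest = "\<Sum>j\<in>{..?n}-{i}. coeff p j * coeff q (?n - j)"
    have split: "coeff (p*q) ?n = coeff p i * coeff q k + ?rest"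
      unfolding coeff_mult by (subst sum.remove[of _ i]) auto
    let ?m = "D (coeff p i) + D (coeff q k)"
    have main: "D (coeff p i * coeff q k) = ?m" using i k by (simp add: D_mult)
    have small: "coeff p j * coeff q (?n - j) = 0 \<or> D (coeff p j * coeff q (?n - j)) < ?m"
      if "j \<in> {..?n}-{i}" for j
    proof (cases "coeff p j = 0 \<or> coeff q (?n - j) = 0")
      case False
      have "D (coeff p j) + j \<le> ?W p" "D (coeff q (?n-j)) + (?n-j) \<le> ?W q"
        using False weighted_degree_coeff[of p j D] weighted_degree_coeff[of q "?n-j" D] by auto
      moreover have "D (coeff p j) + j < ?W p \<or> D (coeff q (?n-j)) + (?n-j) < ?W q"
        using i(3)[of j] k(3)[of "?n - j"] False that by (cases "j > i") auto
      moreover have "j + (?n - j) = i + k" using that by simp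
      ultimately have "D (coeff p j) + D (coeff q (?n-j)) < ?m" using i(2) k(2) by linarith
      thus ?thesis using False by (simp add: D_mult)
    qed auto
    have rest: "?rest = 0 \<or> D ?rest < ?m"
    proof (cases "?m = 0")
      case True
      thus ?thesis using small by (intro disjI1 sum.neutral) auto
    next
      case False
      have "D ?rest \<le> ?m - 1" by (rule D_sum) (use small False D_0 in force)+
      thus ?thesis using False by linarith
    qed
    have nz: "coeff (p*q) ?n \<noteq> 0"
    proof
      assume "coeff (p*q) ?n = 0"
      hence e: "?rest = - (coeff p i * coeff q k)" using split by (simp add: eq_neg_iff_add_eq_0 add.commute)
      hence "D ?rest = ?m" using D_uminus main by simp
      moreover have "?rest \<noteq> 0" using e i k by simp
      ultimately show False using rest by simp
    qed
    have "D (coeff (p*q) ?n) \<ge> ?m"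
    proof (rule ccontr)
      assume lt: "\<not> ?thesis"
      have "coeff p i * coeff q k = coeff (p*q) ?n + (- ?rest)" using split by simp
      hence "?m \<le> max (D (coeff (p*q) ?n)) (D (- ?rest))" using D_add main by metis
      hence "?m \<le> D ?rest" using lt D_uminus by auto
      hence "?rest = 0" using rest by auto
      thus False using split main lt by simp
    qed
    thus "?W p + ?W q \<le> ?W (p * q)" using weighted_degree_coeff[OF nz, of D] i(2) k(2) by simp
  qed
qed

end

lemma degree_valuation_degree: "degree_valuation (degree :: 'k::idom poly \<Rightarrow> nat)"
  by unfold_locales (auto simp: degree_mult_eq degree_add_le_max)

text \<open>A polynomial in \<open>u, v, w\<close> is a polynomial in \<open>v\<close> with coefficients in \<open>K[w][u]\<close>.\<close>
type_synonym 'k poly3 = "'k poly poly poly"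

definition tdeg :: "'k::idom poly3 \<Rightarrow> nat" where
  "tdeg = weighted_degree (weighted_degree degree)"

interpretation deg1: degree_valuation "degree :: 'k::idom poly \<Rightarrow> nat" by (rule degree_valuation_degree)
interpretation deg2: degree_valuation "weighted_degree degree :: 'k::idom poly poly \<Rightarrow> nat"
  by (rule deg1.weighted_degree_valuation)
interpretation tdeg: degree_valuation "tdeg :: 'k::idom poly3 \<Rightarrow> nat"
  unfolding tdeg_def by (rule deg2.weighted_degree_valuation)

lemma tdeg_le_iff: "tdeg f \<le> n \<longleftrightarrow>
  (\<forall>i j k. coeff (coeff (coeff f i) j) k \<noteq> 0 \<longrightarrow> i + j + k \<le> n)" (is "_ \<longleftrightarrow> ?R")
proof
  assume L: "tdeg f \<le> n"
  show ?R
  proof (intro allI impI)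
    fix i j k assume nz: "coeff (coeff (coeff f i) j) k \<noteq> 0"
    hence "coeff (coeff f i) j \<noteq> 0" "coeff f i \<noteq> 0" by auto
    hence "weighted_degree degree (coeff f i) + i \<le> n" "degree (coeff (coeff f i) j) + j \<le> weighted_degree degree (coeff f i)"
      "k \<le> degree (coeff (coeff f i) j)"
      using nz L weighted_degree_le_iff[of "weighted_degree degree" f n] weighted_degree_coeff[of "coeff f i" j degree]
      by (auto simp: tdeg_def le_degree)
    thus "i + j + k \<le> n" by simp
  qed
next
  assume R: ?R
  have 1: "degree (coeff (coeff f i) j) + j + i \<le> n" if "coeff (coeff f i) j \<noteq> 0" for i j
    using R that leading_coeff_neq_0[OF that] by (metis add.assoc add.commute)
  have 2: "weighted_degree degree (coeff f i) \<le> n - i \<and> i \<le> n" if "coeff f i \<noteq> 0" for i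
  proof -
    obtain j where "coeff (coeff f i) j \<noteq> 0" using \<open>coeff f i \<noteq> 0\<close> by (auto simp: poly_eq_iff)
    hence "i \<le> n" using 1 by force
    moreover have "weighted_degree degree (coeff f i) \<le> n - i"
      using 1[of i] by (subst weighted_degree_le_iff) force
    ultimately show ?thesis by simp
  qed
  show "tdeg f \<le> n" unfolding tdeg_def using 2 by (subst weighted_degree_le_iff) force
qed

lemma tdeg_bounds_degree: "degree f \<le> tdeg f" "degree (coeff f i) \<le> tdeg f"
proof -
  have *: "\<And>i j k. coeff (coeff (coeff f i) j) k \<noteq> 0 \<Longrightarrow> i + j + k \<le> tdeg f" using tdeg_le_iff[of f "tdeg f"] by blast
  show "degree (coeff f i) \<le> tdeg f"
  proof (cases "coeff f i = 0")
    case False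
    thus ?thesis using *[of i "degree (coeff f i)" "degree (coeff (coeff f i) (degree (coeff f i)))"]
      by (simp add: leading_coeff_neq_0)
  qed simp
  show "degree f \<le> tdeg f"
  proof (cases "f = 0")
    case False
    let ?c = "coeff f (degree f)"
    have "?c \<noteq> 0" using False by simp
    thus ?thesis using *[of "degree f" "degree ?c" "degree (coeff ?c (degree ?c))"]
      by (simp add: leading_coeff_neq_0)
  qed simp
qed

section \<open>Derivations and restriction to isotropic lines\<close>

definition derivation :: "('r::comm_ring_1 \<Rightarrow> 'r) \<Rightarrow> bool" where
  "derivation \<delta> \<longleftrightarrow> (\<forall>a b. \<delta> (a + b) = \<delta> a + \<delta> b \<and> \<delta> (a * b) = a * \<delta> b + b * \<delta> a)"

lemma derivation_add: "derivation \<delta> \<Longrightarrow> \<delta> (a + b) = \<delta> a + \<delta> b"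
  and derivation_mult: "derivation \<delta> \<Longrightarrow> \<delta> (a * b) = a * \<delta> b + b * \<delta> a"
  by (auto simp: derivation_def)

lemma derivation_0: "derivation \<delta> \<Longrightarrow> \<delta> 0 = 0"
  using derivation_add[of \<delta> 0 0] by simp

lemma derivation_sum: "derivation \<delta> \<Longrightarrow> \<delta> (sum f S) = (\<Sum>i\<in>S. \<delta> (f i))"
  by (induction S rule: infinite_finite_induct) (auto simp: derivation_0 derivation_add)

lemma derivation_pderiv: "derivation (pderiv :: 'r::idom poly \<Rightarrow> _)"
  by (auto simp: derivation_def pderiv_add pderiv_mult)

lemma derivation_map_poly:
  assumes d: "derivation \<delta>"
  shows "derivation (map_poly \<delta>)"
proof -
  have c: "coeff (map_poly \<delta> p) n = \<delta> (coeff p n)" for p n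
    by (rule coeff_map_poly) (rule derivation_0[OF d])
  have m: "map_poly \<delta> (a * b) = a * map_poly \<delta> b + map_poly \<delta> a * b" for a b
    unfolding poly_eq_iff coeff_add coeff_mult c derivation_sum[OF d] derivation_mult[OF d] sum.distrib
    by (simp add: mult.commute)
  show ?thesis unfolding derivation_def
    by (simp add: m mult.commute) (simp add: poly_eq_iff c derivation_add[OF d])
qed

definition du :: "'k::idom poly3 \<Rightarrow> 'k poly3" where "du = map_poly pderiv"
definition dv :: "'k::idom poly3 \<Rightarrow> 'k poly3" where "dv = pderiv"
definition dw :: "'k::idom poly3 \<Rightarrow> 'k poly3" where "dw = map_poly (map_poly pderiv)"

lemma derivation_partials: "derivation du" "derivation dv" "derivation dw"
  unfolding du_def dv_def dw_def by (intro derivation_map_poly derivation_pderiv)+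

lemma coeff_partials:
  "coeff (coeff (coeff (du f) i) j) k = of_nat (Suc j) * coeff (coeff (coeff f i) (Suc j)) k"
  "coeff (coeff (coeff (dv f) i) j) k = of_nat (Suc i) * coeff (coeff (coeff f (Suc i)) j) k"
  "coeff (coeff (coeff (dw f) i) j) k = of_nat (Suc k) * coeff (coeff (coeff f i) j) (Suc k)"
  by (simp_all add: du_def dv_def dw_def coeff_map_poly coeff_pderiv of_nat_poly mult_smult_left
      flip: of_nat_Suc)

lemma tdeg_partial_le:
  "tdeg (du f) \<le> tdeg f - 1" "tdeg (dv f) \<le> tdeg f - 1" "tdeg (dw f) \<le> tdeg f - 1"
proof -
  have *: "\<And>i j k. coeff (coeff (coeff f i) j) k \<noteq> 0 \<Longrightarrow> i + j + k \<le> tdeg f" using tdeg_le_iff[of f "tdeg f"] by blast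
  have a: "i + j + k \<le> tdeg f - 1"
    if "coeff (coeff (coeff f (Suc i)) j) k \<noteq> 0 \<or> coeff (coeff (coeff f i) (Suc j)) k \<noteq> 0 \<or>
      coeff (coeff (coeff f i) j) (Suc k) \<noteq> 0" for i j k
    using that *[of "Suc i" j k] *[of i "Suc j" k] *[of i j "Suc k"] by auto
  show "tdeg (du f) \<le> tdeg f - 1" "tdeg (dv f) \<le> tdeg f - 1" "tdeg (dw f) \<le> tdeg f - 1"
    unfolding tdeg_le_iff coeff_partials using a by (metis mult_zero_right)+
qed

text \<open>The line with parameter \<open>(s, a, c)\<close> is \<open>v = a - s w\<close>,
  \<open>u = - c - s v\<close>; its direction \<open>(s\<^sup>2, -s, 1)\<close> is isotropic for the form
  \<open>u w - v\<^sup>2\<close>. The coordinate \<open>w\<close> serves as the parameter on the line, so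
  \<open>line_u\<close> and \<open>line_v\<close> are polynomials in \<open>w\<close>, and
  \<open>restr l f\<close> is the restriction of \<open>f\<close> to \<open>l\<close>.\<close>
type_synonym 'k line = "'k \<times> 'k \<times> 'k"

fun slope :: "'k line \<Rightarrow> 'k" where "slope (s, a, c) = s"
fun line_u :: "'k::idom line \<Rightarrow> 'k poly" where "line_u (s, a, c) = [:- c - s * a, s ^ 2:]"
fun line_v :: "'k::idom line \<Rightarrow> 'k poly" where "line_v (s, a, c) = [:a, - s:]"

definition restr :: "'k::idom line \<Rightarrow> 'k poly3 \<Rightarrow> 'k poly" where
  "restr l f = poly (poly f [:line_v l:]) (line_u l)"

lemma restr_simps [simp]:
  "restr l 0 = 0" "restr l 1 = 1" "restr l (f + g) = restr l f + restr l g"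
  "restr l (f - g) = restr l f - restr l g" "restr l (- f) = - restr l f"
  "restr l (f * g) = restr l f * restr l g" "restr l (f ^ n) = restr l f ^ n"
  "restr l (numeral k) = numeral k"
  by (simp_all add: restr_def)

lemma restr_dvd: "f dvd g \<Longrightarrow> restr l f = 0 \<Longrightarrow> restr l g = 0"
  by (auto elim!: dvdE)

lemma degree_restr_le: "degree (restr l f) \<le> tdeg f"
proof -
  have dU: "degree (line_u l) \<le> 1" and dV: "degree (line_v l) \<le> 1" by (cases l; simp)+
  have pw: "degree (U ^ j) \<le> j" if "degree U \<le> 1" for U :: "'a poly" and j
    using order.trans[OF degree_power_le[of U j]] that by (metis mult.commute mult_le_mono2 nat_mult_1_right)
  have e: "restr l f = (\<Sum>i\<le>degree f. \<Sum>j\<le>degree (coeff f i). coeff (coeff f i) j * line_u l ^ j * line_v l ^ i)"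
    by (simp add: restr_def poly_altdef[of f] poly_sum poly_altdef[of "coeff f _"] sum_distrib_right)
  have "degree (coeff (coeff f i) j * line_u l ^ j * line_v l ^ i) \<le> tdeg f" for i j
  proof (cases "coeff (coeff f i) j = 0")
    case False
    let ?c = "coeff (coeff f i) j"
    have "degree (?c * line_u l ^ j * line_v l ^ i) \<le> degree ?c + j + i"
      by (intro order.trans[OF degree_mult_le] add_mono pw dU dV order_refl)
    also have "\<dots> = i + j + degree ?c" by simp
    also have "\<dots> \<le> tdeg f" using tdeg_le_iff[of f "tdeg f"] leading_coeff_neq_0[OF False] by blast
    finally show ?thesis .
  qed simp
  thus ?thesis unfolding e by (intro degree_sum_le) auto
qed

text \<open>Chain rule along a line.\<close>
lemma pderiv_restr:
  "pderiv (restr l f) = [:slope l ^ 2:] * restr l (du f) - [:slope l:] * restr l (dv f) + restr l (dw f)"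
proof -
  have dU: "pderiv (line_u l) = [:slope l ^ 2:]" and dV: "pderiv (line_v l) = - [:slope l:]"
    by (cases l; simp add: pderiv_pCons)+
  have 1: "pderiv (poly q U) = pderiv U * poly (pderiv q) U + poly (map_poly pderiv q) U"
    for q :: "'a poly poly" and U
    by (induction q) (simp_all add: pderiv_pCons Polynomial.map_poly_pCons pderiv_add pderiv_mult algebra_simps)
  have "pderiv (restr l f) = pderiv (line_u l) * restr l (du f) + pderiv (line_v l) * restr l (dv f) + restr l (dw f)"
    unfolding restr_def
    by (induction f) (simp_all add: du_def dv_def dw_def pderiv_pCons Polynomial.map_poly_pCons pderiv_add pderiv_mult 1
        algebra_simps)
  thus ?thesis by (simp add: dU dV)
qed

subsection \<open>Differentiation along isotropic directions\<close>

text \<open>The extra variable of a \<open>'k poly3 poly\<close> is a direction parameter \<open>\<tau>\<close>; the derivation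
  differentiates in direction \<open>(\<tau>\<^sup>2, -\<tau>, 1)\<close> and keeps \<open>\<tau>\<close> fixed.\<close>
definition D\<tau> :: "'k::idom poly3 poly \<Rightarrow> 'k poly3 poly" where
  "D\<tau> F = monom 1 2 * map_poly du F - monom 1 1 * map_poly dv F + map_poly dw F"

lemma derivation_D\<tau>: "derivation (D\<tau> :: 'k::idom poly3 poly \<Rightarrow> _)"
proof -
  have d: "derivation (map_poly (du :: 'k poly3 \<Rightarrow> _))" "derivation (map_poly (dv :: 'k poly3 \<Rightarrow> _))"
    "derivation (map_poly (dw :: 'k poly3 \<Rightarrow> _))"
    by (intro derivation_map_poly derivation_partials)+
  show ?thesis unfolding derivation_def D\<tau>_def
    by (simp only: derivation_add[OF d(1)] derivation_add[OF d(2)] derivation_add[OF d(3)]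
      derivation_mult[OF d(1)] derivation_mult[OF d(2)] derivation_mult[OF d(3)]) (simp add: ring_distribs mult.left_commute)
qed

definition eval\<tau> :: "'k::idom line \<Rightarrow> 'k poly3 poly \<Rightarrow> 'k poly" where
  "eval\<tau> l F = poly (map_poly (restr l) F) [:slope l:]"

lemma restr_hom: "comm_ring_hom (restr l)"
  by unfold_locales simp_all

lemma eval\<tau>_pCons: "eval\<tau> l (pCons f F) = restr l f + [:slope l:] * eval\<tau> l F"
  by (simp add: eval\<tau>_def Polynomial.map_poly_pCons)

lemma eval\<tau>_simps [simp]:
  "eval\<tau> l 0 = 0" "eval\<tau> l (F + G) = eval\<tau> l F + eval\<tau> l G" "eval\<tau> l (F - G) = eval\<tau> l F - eval\<tau> l G"
  "eval\<tau> l (F * G) = eval\<tau> l F * eval\<tau> l G" "eval\<tau> l (F ^ n) = eval\<tau> l F ^ n"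
proof -
  interpret h: comm_ring_hom "restr l" by (rule restr_hom)
  interpret m: map_poly_comm_ring_hom "restr l" ..
  show "eval\<tau> l 0 = 0" "eval\<tau> l (F + G) = eval\<tau> l F + eval\<tau> l G" "eval\<tau> l (F - G) = eval\<tau> l F - eval\<tau> l G"
  "eval\<tau> l (F * G) = eval\<tau> l F * eval\<tau> l G" "eval\<tau> l (F ^ n) = eval\<tau> l F ^ n"
    by (simp_all add: eval\<tau>_def hom_distribs)
qed

lemma D\<tau>_const: "D\<tau> [:f:] = [:dw f, - dv f, du f:]"
  by (simp add: D\<tau>_def Polynomial.map_poly_pCons derivation_0 derivation_partials monom_altdef numeral_2_eq_2)

lemma D\<tau>_pCons: "D\<tau> (pCons f F) = D\<tau> [:f:] + pCons 0 (D\<tau> F)"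
proof -
  have m: "map_poly d (pCons f F) = map_poly d [:f:] + pCons 0 (map_poly d F)" if "derivation d" for d :: "'a poly3 \<Rightarrow> _"
    using derivation_0[OF that] by (simp add: Polynomial.map_poly_pCons)
  show ?thesis
    by (simp add: D\<tau>_def m derivation_partials algebra_simps)
qed

text \<open>On a line the derivation \<open>D\<tau>\<close> at \<open>\<tau> = slope l\<close> is the derivative with
  respect to the parameter of the line, so all derivatives of a restriction are restrictions of iterates of
  \<open>D\<tau>\<close>.\<close>
lemma pderiv_eval\<tau>: "pderiv (eval\<tau> l F) = eval\<tau> l (D\<tau> F)"
proof (induction F)
  case (pCons f F)
  have "eval\<tau> l (D\<tau> [:f:]) = pderiv (restr l f)"
    by (simp add: D\<tau>_const eval\<tau>_pCons pderiv_restr power2_eq_square algebra_simps)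
  thus ?case using pCons by (simp add: D\<tau>_pCons[of f F] eval\<tau>_pCons pderiv_add pderiv_smult)
qed (simp add: derivation_0 derivation_D\<tau>)

lemma pderiv_funpow_eval\<tau>: "(pderiv ^^ j) (eval\<tau> l F) = eval\<tau> l ((D\<tau> ^^ j) F)"
  by (induction j) (simp_all add: pderiv_eval\<tau>)

text \<open>In characteristic larger than the degree, the Taylor coefficients at one point determine a
  polynomial.\<close>
lemma poly_eq_0_if_derivatives_vanish:
  fixes h :: "'k::idom poly"
  assumes "\<And>j. poly ((pderiv ^^ j) h) x = 0" and "\<And>n. 0 < n \<Longrightarrow> n \<le> degree h \<Longrightarrow> of_nat n \<noteq> (0::'k)"
  shows "h = 0"
  using assms
proof (induction "degree h" arbitrary: h rule: less_induct)
  case less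
  have pd0: "pderiv h = 0 \<Longrightarrow> degree h = 0"
  proof (rule ccontr)
    assume p0: "pderiv h = 0" and d: "degree h \<noteq> 0"
    have "coeff (pderiv h) (degree h - 1) = of_nat (degree h) * lead_coeff h"
      using d by (simp add: coeff_pderiv flip: of_nat_Suc)
    thus False using p0 d less.prems(2)[of "degree h"] by auto
  qed
  show ?case
  proof (cases "degree h = 0")
    case True
    then obtain c where "h = [:c:]" by (rule degree_eq_zeroE)
    thus ?thesis using less.prems(1)[of 0] by simp
  next
    case False
    have lt: "degree (pderiv h) < degree h"
      using False degree_pderiv_le[of h] by linarith
    have "pderiv h = 0"
    proof (rule less.hyps[OF lt])
      show "poly ((pderiv ^^ j) (pderiv h)) x = 0" for j
        using less.prems(1)[of "Suc j"] by (simp add: funpow_swap1)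
    qed (use less.prems(2) lt in auto)
    thus ?thesis using pd0 False by simp
  qed
qed

section \<open>Isotropic lines on an algebraic surface\<close>

subsection \<open>Lines common to two surfaces\<close>

text \<open>The symplectic form of the vectors \<open>(s, a, c, 1)\<close> and \<open>(s', a', c', 1)\<close>. Lines
  of different slope meet exactly if it vanishes, and \<open>meet_w\<close> is then the parameter of the common
  point.\<close>
fun line_form :: "'k::field line \<Rightarrow> 'k line \<Rightarrow> 'k" where
  "line_form (s, a, c) (s', a', c') = s * a' - a * s' + c - c'"

definition meets :: "'k::field line \<Rightarrow> 'k line \<Rightarrow> bool" where
  "meets l l' \<longleftrightarrow> slope l \<noteq> slope l' \<and> line_form l l' = 0"

fun meet_w :: "'k::field line \<Rightarrow> 'k line \<Rightarrow> 'k" where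
  "meet_w (s, a, c) (s', a', c') = (a - a') / (s - s')"

lemma poly_restr:
  "poly (restr l f) w = poly (poly (poly f [:[:poly (line_v l) w:]:]) [:poly (line_u l) w:]) w"
proof -
  have 1: "poly (poly q U) w = poly (poly q [:poly U w:]) w" for q :: "'a poly poly" and U
    by (induction q) simp_all
  have 2: "poly (poly (poly f [:V:]) U) w = poly (poly (poly f [:[:poly V w:]:]) U) w" for V U :: "'a poly"
    by (induction f) simp_all
  show ?thesis unfolding restr_def using 1 2 by metis
qed

lemma meets_same_point:
  fixes l l' :: "'k::field line"
  assumes "meets l l'"
  shows "poly (line_v l) (meet_w l l') = poly (line_v l') (meet_w l l')"
    and "poly (line_u l) (meet_w l l') = poly (line_u l') (meet_w l l')"
proof -
  obtain s a c s' a' c' where l: "l = (s,a,c)" "l' = (s',a',c')" by (cases l; cases l')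
  have n: "s - s' \<noteq> 0" and w: "c = c' + a * s' - s * a'" using assms by (auto simp: meets_def l algebra_simps)
  define W where "W = meet_w l l'"
  have "a - a' = W * (s - s')" using n by (simp add: l W_def)
  hence a: "a = a' + W * s - W * s'" by (simp add: algebra_simps)
  show "poly (line_v l) (meet_w l l') = poly (line_v l') (meet_w l l')"
    unfolding W_def[symmetric] by (simp add: l a algebra_simps)
  show "poly (line_u l) (meet_w l l') = poly (line_u l') (meet_w l l')"
    unfolding W_def[symmetric] by (simp add: l w a algebra_simps power2_eq_square)
qed

lemma poly_restr_meet:
  assumes "meets l l'"
  shows "poly (restr l f) (meet_w l l') = poly (restr l' f) (meet_w l l')"
  using meets_same_point[OF assms] by (simp add: poly_restr)

lemma line_form_through_point:
  fixes l l' :: "'k::field line"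
  assumes "poly (line_v l) w = poly (line_v l') w" "poly (line_u l) w = poly (line_u l') w"
  shows "line_form l l' = 0"
proof -
  obtain s a c s' a' c' where l: "l = (s,a,c)" "l' = (s',a',c')" by (cases l; cases l')
  have a: "a = a' - w * s' + w * s" using assms(1) by (simp add: l algebra_simps)
  have c: "c = - s * a + w * s^2 + c' + s' * a' - w * s'^2" using assms(2) by (simp add: l algebra_simps)
  show ?thesis unfolding l line_form.simps c by (simp add: a algebra_simps power2_eq_square)
qed

lemma line_eqI: "line_u l = line_u l' \<Longrightarrow> line_v l = line_v l' \<Longrightarrow> l = (l' :: 'k::idom line)"
  by (cases l; cases l') auto

text \<open>A line common to the surfaces \<open>f = 0\<close> and \<open>g = 0\<close> is a common zero
  \<open>(line_u b, line_v b)\<close> of \<open>f\<close> and \<open>g\<close>, as polynomials in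
  \<open>u\<close> and \<open>v\<close>, with coordinates in \<open>K[w]\<close>. So the bound for plane curves
  over the ring \<open>K[w]\<close> bounds the number of lines.\<close>
lemma common_lines_card:
  fixes f g :: "'k::field_gcd poly3"
  assumes f: "prime_elem f" and ndvd: "\<not> f dvd g" and inj: "inj_on line_u B"
    and B: "\<And>b. b \<in> B \<Longrightarrow> restr b f = 0 \<and> restr b g = 0"
  shows "card B \<le> 2 * tdeg f * tdeg g"
proof -
  have cop: "coprime f g" using f ndvd by (rule prime_elem_imp_coprime)
  note b = tdeg_bounds_degree
  let ?U = "{u. \<exists>v. poly (poly f [:v:]) u = 0 \<and> poly (poly g [:v:]) u = 0}"
  have "line_u ` B \<subseteq> ?U" using B by (auto simp: restr_def)
  hence "card (line_u ` B) \<le> card ?U"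
    by (intro card_mono coprime_common_zeros_card(1)[OF cop b(1) b(1) b(2) b(2)])
  also have "\<dots> \<le> 2 * tdeg f * tdeg g" by (rule coprime_common_zeros_card(2)[OF cop b(1) b(1) b(2) b(2)])
  finally show ?thesis using inj by (simp add: card_image)
qed

lemma common_lines_infinite:
  fixes f g :: "'k::field_gcd poly3"
  assumes f: "prime_elem f" and inf: "infinite B"
    and B: "\<And>b. b \<in> B \<Longrightarrow> restr b f = 0 \<and> restr b g = 0"
  shows "f dvd g"
proof (rule ccontr)
  assume "\<not> f dvd g"
  hence cop: "coprime f g" using f by (rule prime_elem_imp_coprime[rotated])
  have "(\<lambda>b. (line_u b, line_v b)) ` B \<subseteq> {(u,v). poly (poly f [:v:]) u = 0 \<and> poly (poly g [:v:]) u = 0}"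
    using B by (auto simp: restr_def)
  hence "finite ((\<lambda>b. (line_u b, line_v b)) ` B)" using coprime_common_zeros_finite[OF cop] by (rule finite_subset)
  moreover have "inj_on (\<lambda>b. (line_u b, line_v b)) B" by (auto intro!: inj_onI line_eqI)
  ultimately show False using inf finite_imageD by blast
qed

lemma restr_eq_0_if_many_zeros:
  assumes "finite N" "tdeg g < card N" "inj_on \<phi> N" "\<And>r. r \<in> N \<Longrightarrow> poly (restr b g) (\<phi> r) = 0"
  shows "restr b g = 0"
proof (rule ccontr)
  assume nz: "restr b g \<noteq> 0"
  have "card N = card (\<phi> ` N)" using assms(3) by (simp add: card_image)
  also have "\<dots> \<le> card {w. poly (restr b g) w = 0}"
    using assms(4) by (intro card_mono poly_roots_finite nz) auto
  also have "\<dots> \<le> degree (restr b g)" using nz by (rule card_poly_roots_bound)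
  also have "\<dots> \<le> tdeg g" by (rule degree_restr_le)
  finally show False using assms(2) by simp
qed

subsection \<open>Second order contact\<close>

text \<open>As polynomials in \<open>\<tau>\<close>, these are the first and the second derivative of \<open>f\<close> in
  the direction \<open>(\<tau>\<^sup>2, -\<tau>, 1)\<close>: the roots of the quadric are the tangent isotropic
  directions, common roots are those with contact of order two.\<close>
definition tangent_quadric :: "'k::idom poly3 \<Rightarrow> 'k poly3 poly" where
  "tangent_quadric f = [:dw f, - dv f, du f:]"

definition contact_quartic :: "'k::idom poly3 \<Rightarrow> 'k poly3 poly" where
  "contact_quartic f = D\<tau> (tangent_quadric f)"

lemma D\<tau>_is_tangent_quadric: "D\<tau> [:f:] = tangent_quadric f"
  by (simp add: D\<tau>_const tangent_quadric_def)

lemma contact_quartic_eq: "contact_quartic f =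
   [:dw (dw f), - dw (dv f) - dv (dw f), dw (du f) + dv (dv f) + du (dw f), - dv (du f) - du (dv f), du (du f):]"
proof -
  have neg: "d (- x) = - d x" if "derivation d" for d :: "'a poly3 \<Rightarrow> _" and x
    using derivation_add[OF that, of x "-x"] derivation_0[OF that] by (simp add: eq_neg_iff_add_eq_0 add.commute)
  have z: "du 0 = (0::'a poly3)" "dv 0 = (0::'a poly3)" "dw 0 = (0::'a poly3)"
    by (simp_all add: derivation_0 derivation_partials)
  have sh: "monom 1 2 * p = pCons 0 (pCons 0 p)" "monom 1 1 * p = pCons 0 p" for p :: "'a poly3 poly"
    by (simp_all add: monom_altdef numeral_2_eq_2)
  have m: "map_poly d [:x, y, z:] = [:d x, d y, d z:]" if "d 0 = 0" for d :: "'a poly3 \<Rightarrow> 'a poly3" and x y z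
    using that by (simp add: Polynomial.map_poly_pCons)
  show ?thesis unfolding contact_quartic_def tangent_quadric_def D\<tau>_def sh
     m[of du, OF z(1)] m[of dv, OF z(2)] m[of dw, OF z(3)] neg[OF derivation_partials(2)] neg[OF derivation_partials(1)] neg[OF derivation_partials(3)]
    by (simp only: add_pCons diff_pCons diff_0_right add_0_left add_0_right diff_0 minus_pCons minus_minus minus_zero diff_minus_eq_add) simp
qed

text \<open>Division of a quartic by a quadratic, after multiplication with the cube of its leading
  coefficient.\<close>
lemma pseudo_division:
  fixes a b c h0 h1 h2 h3 h4 :: "'r::comm_ring_1"
  defines "g3 \<equiv> a * h3 - b * h4" and "g2 \<equiv> a * h2 - c * h4"
  defines "k2 \<equiv> a * g2 - b * g3" and "k1 \<equiv> a * (a * h1) - c * g3"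
  shows "[:a:] ^ 3 * [:h0, h1, h2, h3, h4:] =
     [:k2, a * g3, a\<^sup>2 * h4:] * [:c, b, a:] + [:a * (a * (a * h0)) - c * k2, a * k1 - b * k2:]"
proof -
  have 1: "[:a:] * [:h0, h1, h2, h3, h4:] = [:0, 0, h4:] * [:c, b, a:] + [:a * h0, a * h1, g2, g3:]"
    by (simp add: g3_def g2_def mult.commute)
  have 2: "[:a:] * [:a * h0, a * h1, g2, g3:] = [:0, g3:] * [:c, b, a:] + [:a * (a * h0), k1, k2:]"
    by (simp add: k2_def k1_def mult.commute)
  have 3: "[:a:] * [:a * (a * h0), k1, k2:] = [:k2:] * [:c, b, a:] + [:a * (a * (a * h0)) - c * k2, a * k1 - b * k2:]"
    by (simp add: mult.commute)
  have "[:a:] ^ 3 * [:h0, h1, h2, h3, h4:] = [:a:] * ([:a:] * ([:a:] * [:h0, h1, h2, h3, h4:]))"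
    by (simp only: power3_eq_cube mult.assoc)
  also have "\<dots> = ([:a:] * ([:a:] * [:0, 0, h4:]) + [:a:] * [:0, g3:] + [:k2:]) * [:c, b, a:] +
      [:a * (a * (a * h0)) - c * k2, a * k1 - b * k2:]"
    by (simp only: 1 2 3 distrib_left distrib_right mult.assoc add.assoc)
  also have "[:a:] * ([:a:] * [:0, 0, h4:]) + [:a:] * [:0, g3:] + [:k2:] = [:k2, a * g3, a\<^sup>2 * h4:]"
    by (simp add: power2_eq_square mult.assoc)
  finally show ?thesis .
qed

text \<open>The two coefficients of the remainder of the contact quartic modulo the tangent quadric. A tangent isotropic
  direction has contact of order two wherever they vanish and \<open>du f\<close> does not.\<close>
definition contact_rem :: "'k::idom poly3 \<Rightarrow> 'k poly3 \<times> 'k poly3" where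
  "contact_rem f = (let a = du f; b = - dv f; c = dw f; h0 = dw (dw f); h1 = - dw (dv f) - dv (dw f);
     h2 = dw (du f) + dv (dv f) + du (dw f); h3 = - dv (du f) - du (dv f); h4 = du (du f);
     g3 = a * h3 - b * h4; g2 = a * h2 - c * h4; k2 = a * g2 - b * g3; k1 = a * (a * h1) - c * g3
   in (a * (a * (a * h0)) - c * k2, a * k1 - b * k2))"

lemma contact_rem: "\<exists>Q. [:du f:] ^ 3 * contact_quartic f = Q * tangent_quadric f + [:fst (contact_rem f), snd (contact_rem f):]"
  unfolding contact_quartic_eq tangent_quadric_def contact_rem_def Let_def fst_conv snd_conv
  by (rule exI, rule pseudo_division)

lemma tdeg_closure:
  "tdeg f \<le> n \<Longrightarrow> tdeg g \<le> n \<Longrightarrow> tdeg (f + g) \<le> n" "tdeg f \<le> n \<Longrightarrow> tdeg g \<le> n \<Longrightarrow> tdeg (f - g) \<le> n"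
  "tdeg f \<le> n \<Longrightarrow> tdeg (- f) \<le> n" "tdeg f \<le> n \<Longrightarrow> tdeg g \<le> m \<Longrightarrow> tdeg (f * g) \<le> n + m"
  using tdeg.D_add[of f g] tdeg.D_add[of f "-g"] tdeg.D_mult_le[of f g] by (auto simp: tdeg.D_uminus)

lemma tdeg_contact_rem: "tdeg (fst (contact_rem f)) \<le> 4 * tdeg f" "tdeg (snd (contact_rem f)) \<le> 4 * tdeg f"
proof -
  let ?d = "tdeg f"
  have p: "tdeg (du g) \<le> ?d" "tdeg (dv g) \<le> ?d" "tdeg (dw g) \<le> ?d" if "tdeg g \<le> ?d" for g
    using that tdeg_partial_le[of g] by auto
  have m2: "tdeg (x * y) \<le> 2 * ?d" if "tdeg x \<le> ?d" "tdeg y \<le> ?d" for x y using tdeg_closure(4)[OF that] by simp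
  have m3: "tdeg (x * y) \<le> 3 * ?d" if "tdeg x \<le> ?d" "tdeg y \<le> 2 * ?d" for x y using tdeg_closure(4)[OF that] by simp
  have m4: "tdeg (x * y) \<le> 4 * ?d" if "tdeg x \<le> ?d" "tdeg y \<le> 3 * ?d" for x y using tdeg_closure(4)[OF that] by simp
  define a b c where abc: "a = du f" "b = - dv f" "c = dw f"
  define h0 h1 h2 h3 h4 where h: "h0 = dw (dw f)" "h1 = - dw (dv f) - dv (dw f)"
    "h2 = dw (du f) + dv (dv f) + du (dw f)" "h3 = - dv (du f) - du (dv f)" "h4 = du (du f)"
  define g3 g2 where g: "g3 = a * h3 - b * h4" "g2 = a * h2 - c * h4"
  define k2 k1 where k: "k2 = a * g2 - b * g3" "k1 = a * (a * h1) - c * g3"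
  have 1: "tdeg a \<le> ?d" "tdeg b \<le> ?d" "tdeg c \<le> ?d" unfolding abc by (intro tdeg_closure(3) p order_refl)+
  note pp = p(1)[OF p(1)[OF order_refl]] p(1)[OF p(2)[OF order_refl]] p(1)[OF p(3)[OF order_refl]]
    p(2)[OF p(1)[OF order_refl]] p(2)[OF p(2)[OF order_refl]] p(2)[OF p(3)[OF order_refl]]
    p(3)[OF p(1)[OF order_refl]] p(3)[OF p(2)[OF order_refl]] p(3)[OF p(3)[OF order_refl]]
  have 2: "tdeg h0 \<le> ?d" "tdeg h4 \<le> ?d" unfolding h by (rule pp)+
  have 3: "tdeg h1 \<le> ?d" "tdeg h3 \<le> ?d" unfolding h by (rule tdeg_closure(2)[OF tdeg_closure(3)], rule pp, rule pp)+
  have 4: "tdeg h2 \<le> ?d" unfolding h by (rule tdeg_closure(1)[OF tdeg_closure(1)], rule pp, rule pp, rule pp)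
  have 5: "tdeg g3 \<le> 2 * ?d" "tdeg g2 \<le> 2 * ?d" unfolding g using 1 2 3 4 by (auto intro!: tdeg_closure(2) m2)
  have 6: "tdeg k2 \<le> 3 * ?d" "tdeg k1 \<le> 3 * ?d" unfolding k using 1 3 5 by (auto intro!: tdeg_closure(2) m3 m2)
  have e: "contact_rem f = (a * (a * (a * h0)) - c * k2, a * k1 - b * k2)"
    unfolding contact_rem_def Let_def k g h abc by (rule refl)
  have "tdeg (a * (a * (a * h0)) - c * k2) \<le> 4 * ?d"
    by (rule tdeg_closure(2)[OF m4[OF 1(1) m3[OF 1(1) m2[OF 1(1) 2(1)]]] m4[OF 1(3) 6(1)]])
  moreover have "tdeg (a * k1 - b * k2) \<le> 4 * ?d"
    by (rule tdeg_closure(2)[OF m4[OF 1(1) 6(2)] m4[OF 1(2) 6(1)]])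
  ultimately show "tdeg (fst (contact_rem f)) \<le> 4 * tdeg f" "tdeg (snd (contact_rem f)) \<le> 4 * tdeg f"
    unfolding e by simp_all
qed

text \<open>If the remainder vanishes on the surface, every tangent isotropic direction has contact of order two, hence of
  all orders: the elements that some power of \<open>du f\<close> brings into the ideal generated by
  \<open>f\<close> and its tangent quadric form an ideal that is stable under the derivation.\<close>
lemma derivatives_in_saturated_ideal:
  assumes r: "f dvd fst (contact_rem f)" "f dvd snd (contact_rem f)"
  shows "\<exists>n A B. [:du f:] ^ n * (D\<tau> ^^ j) [:f:] = A * tangent_quadric f + B * [:f:]"
proof -
  define e q F where "e = [:du f:]" and "q = tangent_quadric f" and "F = [:f:]"
  define J where "J = {G. \<exists>n A B. e ^ n * G = A * q + B * F}"
  have J0: "G \<in> J" if "G = A * q + B * F" for G A B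
  proof -
    have "e ^ 0 * G = A * q + B * F" using that by simp
    thus ?thesis unfolding J_def by blast
  qed
  have Jadd: "G + H \<in> J" if GH: "G \<in> J" "H \<in> J" for G H
  proof -
    obtain n A B where 1: "e ^ n * G = A * q + B * F" using GH(1) unfolding J_def by blast
    obtain n' A' B' where 2: "e ^ n' * H = A' * q + B' * F" using GH(2) unfolding J_def by blast
    have "e ^ (n + n') * (G + H) = e ^ n' * (e ^ n * G) + e ^ n * (e ^ n' * H)"
      by (simp only: power_add distrib_left mult.assoc mult.left_commute)
    also have "\<dots> = (e ^ n' * A + e ^ n * A') * q + (e ^ n' * B + e ^ n * B') * F"
      unfolding 1 2 by (simp only: ring_distribs ac_simps)
    finally show ?thesis unfolding J_def by blast
  qed
  have Jmult: "H * G \<in> J" if G: "G \<in> J" for G H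
  proof -
    obtain n A B where 1: "e ^ n * G = A * q + B * F" using G unfolding J_def by blast
    have "e ^ n * (H * G) = H * (e ^ n * G)" by (rule mult.left_commute)
    also have "\<dots> = (H * A) * q + (H * B) * F" unfolding 1 by (simp only: distrib_left mult.assoc)
    finally show ?thesis unfolding J_def by blast
  qed
  have Jdiv: "G \<in> J" if G: "e ^ n * G \<in> J" for G n
  proof -
    obtain m A B where "e ^ m * (e ^ n * G) = A * q + B * F" using G unfolding J_def by blast
    hence "e ^ (m + n) * G = A * q + B * F" by (simp only: power_add mult.assoc)
    thus ?thesis unfolding J_def by blast
  qed
  have qJ: "q \<in> J" by (rule J0[of _ 1 0]) simp
  have fJ: "F \<in> J" by (rule J0[of _ 0 1]) simp
  have DqJ: "D\<tau> q \<in> J"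
  proof -
    obtain Q where Q: "e ^ 3 * D\<tau> q = Q * q + [:fst (contact_rem f), snd (contact_rem f):]"
      using contact_rem[of f] unfolding contact_quartic_def e_def q_def by blast
    obtain x y where "fst (contact_rem f) = f * x" "snd (contact_rem f) = f * y" using r by (auto elim!: dvdE)
    hence "[:fst (contact_rem f), snd (contact_rem f):] = [:x, y:] * F" by (simp add: F_def mult.commute)
    hence "e ^ 3 * D\<tau> q = Q * q + [:x, y:] * F" using Q by simp
    thus ?thesis using J0 Jdiv by blast
  qed
  have DF: "D\<tau> F = q" by (simp add: F_def q_def D\<tau>_is_tangent_quadric)
  note dD = derivation_add[OF derivation_D\<tau>] derivation_mult[OF derivation_D\<tau>]
  have JD: "D\<tau> G \<in> J" if G: "G \<in> J" for G
  proof -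
    obtain n A B where 1: "e ^ n * G = A * q + B * F" using G unfolding J_def by blast
    have "D\<tau> (e ^ n * G) = (A * D\<tau> q + D\<tau> A * q) + (B * q + D\<tau> B * F)"
      unfolding 1 dD DF by (simp only: mult.commute)
    moreover have "(A * D\<tau> q + D\<tau> A * q) + (B * q + D\<tau> B * F) \<in> J"
      by (intro Jadd Jmult DqJ qJ fJ)
    ultimately have "e ^ n * D\<tau> G + G * D\<tau> (e ^ n) \<in> J" by (simp only: dD)
    hence "(e ^ n * D\<tau> G + G * D\<tau> (e ^ n)) + (- D\<tau> (e ^ n)) * G \<in> J" by (rule Jadd) (rule Jmult[OF G])
    moreover have "(e ^ n * D\<tau> G + G * D\<tau> (e ^ n)) + (- D\<tau> (e ^ n)) * G = e ^ n * D\<tau> G"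
      by (simp add: mult.commute)
    ultimately have "e ^ n * D\<tau> G \<in> J" by simp
    thus ?thesis by (rule Jdiv)
  qed
  have "(D\<tau> ^^ j) F \<in> J" by (induction j) (auto intro: fJ JD)
  thus ?thesis unfolding J_def e_def q_def F_def by blast
qed

text \<open>All derivatives of the restriction of \<open>f\<close> to the line vanish at the given point.\<close>
lemma isotropic_tangent_line_in_surface:
  fixes f :: "'k::idom poly3"
  assumes r: "f dvd fst (contact_rem f)" "f dvd snd (contact_rem f)"
    and char: "\<And>n. 0 < n \<Longrightarrow> n \<le> tdeg f \<Longrightarrow> of_nat n \<noteq> (0::'k)"
    and pt: "poly (restr l f) w = 0" and tan: "poly (eval\<tau> l (tangent_quadric f)) w = 0"
    and smooth: "poly (restr l (du f)) w \<noteq> 0"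
  shows "restr l f = 0"
proof (rule poly_eq_0_if_derivatives_vanish)
  fix j
  obtain n A B where e: "[:du f:] ^ n * (D\<tau> ^^ j) [:f:] = A * tangent_quadric f + B * [:f:]"
    using derivatives_in_saturated_ideal[OF r] by blast
  have c: "eval\<tau> l [:g:] = restr l g" for g by (simp add: eval\<tau>_pCons)
  have "eval\<tau> l ([:du f:] ^ n * (D\<tau> ^^ j) [:f:]) = eval\<tau> l (A * tangent_quadric f + B * [:f:])" using e by simp
  hence "restr l (du f) ^ n * (pderiv ^^ j) (restr l f) = eval\<tau> l A * eval\<tau> l (tangent_quadric f) + eval\<tau> l B * restr l f"
    using pderiv_funpow_eval\<tau>[of j l "[:f:]"] by (simp only: eval\<tau>_simps c)
  hence "poly (restr l (du f)) w ^ n * poly ((pderiv ^^ j) (restr l f)) w = 0"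
    using pt tan by (metis (no_types, lifting) add_0 mult_zero_right poly_add poly_mult poly_power)
  thus "poly ((pderiv ^^ j) (restr l f)) w = 0" using smooth by simp
next
  fix n assume "0 < n" "n \<le> degree (restr l f)"
  thus "of_nat n \<noteq> (0::'k)" using char degree_restr_le[of l f] by simp
qed

subsection \<open>Surfaces swept out by transversals\<close>

definition const3 :: "'k::idom \<Rightarrow> 'k poly3" where "const3 k = [:[:[:k:]:]:]"
definition var_u :: "'k::idom poly3" where "var_u = [:[:0, 1:]:]"
definition var_v :: "'k::idom poly3" where "var_v = [:0, 1:]"
definition var_w :: "'k::idom poly3" where "var_w = [:[:[:0, 1:]:]:]"

text \<open>The two equations that cut out the line.\<close>
fun eqn_a :: "'k::idom line \<Rightarrow> 'k poly3" where
  "eqn_a (s, a, c) = var_u + const3 s * var_v + const3 c"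
fun eqn_b :: "'k::idom line \<Rightarrow> 'k poly3" where
  "eqn_b (s, a, c) = var_v + const3 s * var_w - const3 a"

lemma restr_vars [simp]: "restr l (const3 k) = [:k:]" "restr l var_u = line_u l" "restr l var_v = line_v l"
  "restr l var_w = [:0, 1:]"
  by (simp_all add: restr_def const3_def var_u_def var_v_def var_w_def)

lemma restr_eqns:
  "restr l (eqn_a l') + [:slope l:] * restr l (eqn_b l') = [:line_form l' l:]"
  by (cases l; cases l') (simp add: algebra_simps power2_eq_square)

lemma restr_eqn_b_nonzero: "slope l \<noteq> slope l' \<Longrightarrow> restr l (eqn_b l') \<noteq> 0"
  by (cases l; cases l') auto

text \<open>The isotropic line of slope \<open>\<tau>\<close> through a point meets the line \<open>b\<close> if and only if
  \<open>eqn_a b + \<tau> eqn_b b = 0\<close> there. Elimination of \<open>\<tau>\<close> from this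
  condition and the tangent quadric yields a polynomial that vanishes on all lines of the surface that meet
  \<open>b\<close>.\<close>
definition transversal_poly :: "'k::idom poly3 \<Rightarrow> 'k line \<Rightarrow> 'k poly3" where
  "transversal_poly f b = du f * eqn_a b ^ 2 + dv f * (eqn_a b * eqn_b b) + dw f * eqn_b b ^ 2"

lemma restr_transversal_poly:
  assumes "restr l f = 0" and "line_form b l = 0"
  shows "restr l (transversal_poly f b) = 0"
proof -
  let ?B = "restr l (eqn_b b)" and ?s = "[:slope l:]"
  have A: "restr l (eqn_a b) = - ?s * ?B"
    using restr_eqns[of l b] assms(2) by (simp add: eq_neg_iff_add_eq_0)
  have "restr l (transversal_poly f b) = (?s\<^sup>2 * restr l (du f) - ?s * restr l (dv f) + restr l (dw f)) * ?B\<^sup>2"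
    unfolding transversal_poly_def restr_simps A by (simp only: power2_eq_square ring_distribs mult_minus_left
        mult_minus_right minus_minus ac_simps) simp
  also have "?s\<^sup>2 * restr l (du f) - ?s * restr l (dv f) + restr l (dw f) = pderiv (restr l f)"
    by (simp add: pderiv_restr poly_const_pow)
  finally show ?thesis using assms(1) by simp
qed

text \<open>A nonzero binary quadratic form has at most two zeros on the projective line: among three zeros
  \<open>(A, B)\<close> two coincide, which is expressed by a Vandermonde determinant.\<close>
lemma vandermonde_elimination:
  fixes x y z :: "'r::comm_ring_1"
  defines "G \<equiv> \<lambda>A B. x * A ^ 2 + y * (A * B) + z * B ^ 2"
  shows "x * ((A1 * B2 - A2 * B1) * (A1 * B3 - A3 * B1) * (A2 * B3 - A3 * B2)) =
    G A1 B1 * (B2 * B3 * (A2 * B3 - A3 * B2)) - G A2 B2 * (B1 * B3 * (A1 * B3 - A3 * B1)) +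
    G A3 B3 * (B1 * B2 * (A1 * B2 - A2 * B1))"
  unfolding G_def by (simp add: power2_eq_square algebra_simps)

lemma eval\<tau>_tangent_quadric: "eval\<tau> l (tangent_quadric f) = pderiv (restr l f)"
  using pderiv_eval\<tau>[of l "[:f:]"] by (simp add: D\<tau>_is_tangent_quadric eval\<tau>_pCons)

lemma eval\<tau>_contact_quartic: "eval\<tau> l (contact_quartic f) = pderiv (pderiv (restr l f))"
  using pderiv_eval\<tau>[of l "tangent_quadric f"] by (simp add: contact_quartic_def eval\<tau>_tangent_quadric)

lemma two_roots:
  fixes s t x y z :: "'r::idom"
  assumes "s\<^sup>2 * x - s * y + z = 0" "t\<^sup>2 * x - t * y + z = 0" "s \<noteq> t"
  shows "y = (s + t) * x" "z = s * t * x"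
proof -
  have "(s - t) * ((s + t) * x - y) = (s\<^sup>2 * x - s * y + z) - (t\<^sup>2 * x - t * y + z)"
    by (simp add: algebra_simps power2_eq_square)
  thus y: "y = (s + t) * x" using assms by simp
  have "z = (s\<^sup>2 * x - s * y + z) + s * t * x" unfolding y by (simp add: algebra_simps power2_eq_square)
  thus "z = s * t * x" using assms(1) by simp
qed

text \<open>At the meeting point of two lines of the surface the tangent quadric has both slopes as roots.\<close>
lemma gradient_at_crossing:
  assumes m: "meets b r" and f: "restr b f = 0" "restr r f = 0"
  defines "w \<equiv> meet_w b r"
  shows "poly (restr b (dv f)) w = (slope b + slope r) * poly (restr b (du f)) w"
    and "poly (restr b (dw f)) w = slope b * slope r * poly (restr b (du f)) w"
proof -
  let ?\<alpha> = "poly (restr b (du f)) w" and ?\<beta> = "poly (restr b (dv f)) w" and ?\<gamma> = "poly (restr b (dw f)) w"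
  let ?s = "slope b" and ?t = "slope r"
  have same: "poly (restr b g) w = poly (restr r g) w" for g unfolding w_def by (rule poly_restr_meet[OF m])
  have "poly (pderiv (restr b f)) w = 0" "poly (pderiv (restr r f)) w = 0" using f by simp_all
  hence e: "?s^2 * ?\<alpha> - ?s * ?\<beta> + ?\<gamma> = 0" "?t^2 * ?\<alpha> - ?t * ?\<beta> + ?\<gamma> = 0"
    by (simp_all add: pderiv_restr same)
  have ne: "?s \<noteq> ?t" using m by (simp add: meets_def)
  show "?\<beta> = (?s + ?t) * ?\<alpha>" "?\<gamma> = ?s * ?t * ?\<alpha>" by (rule two_roots[OF e ne])+
qed

text \<open>Along each line the derivatives of \<open>f\<close> vanish, so at the crossing both slopes are roots of the
  remainder, which is linear in \<open>\<tau>\<close>.\<close>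
lemma contact_rem_at_crossing:
  assumes m: "meets b r" and f: "restr b f = 0" "restr r f = 0"
  defines "w \<equiv> meet_w b r"
  shows "poly (restr b (fst (contact_rem f))) w = 0" and "poly (restr b (snd (contact_rem f))) w = 0"
proof -
  obtain Q where Q: "[:du f:] ^ 3 * contact_quartic f = Q * tangent_quadric f + [:fst (contact_rem f), snd (contact_rem f):]"
    using contact_rem by blast
  have *: "poly (restr l (fst (contact_rem f))) w + slope l * poly (restr l (snd (contact_rem f))) w = 0"
    if "restr l f = 0" for l
  proof -
    have "eval\<tau> l ([:du f:] ^ 3 * contact_quartic f) = eval\<tau> l (Q * tangent_quadric f + [:fst (contact_rem f), snd (contact_rem f):])"
      by (simp only: Q)
    hence "eval\<tau> l [:fst (contact_rem f), snd (contact_rem f):] = 0"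
      by (simp only: eval\<tau>_simps eval\<tau>_tangent_quadric eval\<tau>_contact_quartic that pderiv_0 mult_zero_right add_0_left)
    hence "restr l (fst (contact_rem f)) + [:slope l:] * restr l (snd (contact_rem f)) = 0"
      by (simp add: eval\<tau>_pCons)
    hence "poly (restr l (fst (contact_rem f)) + [:slope l:] * restr l (snd (contact_rem f))) w = 0" by simp
    thus ?thesis by simp
  qed
  have same: "poly (restr b g) w = poly (restr r g) w" for g unfolding w_def by (rule poly_restr_meet[OF m])
  let ?x = "poly (restr b (fst (contact_rem f))) w" and ?y = "poly (restr b (snd (contact_rem f))) w"
  have e: "?x + slope b * ?y = 0" "?x + slope r * ?y = 0" using *[OF f(1)] *[OF f(2)] by (simp_all add: same)
  have "(slope b - slope r) * ?y = (?x + slope b * ?y) - (?x + slope r * ?y)" by (simp add: algebra_simps)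
  hence "(slope b - slope r) * ?y = 0" using e by simp
  thus "?y = 0" using m by (simp add: meets_def)
  thus "?x = 0" using e by simp
qed

text \<open>Isotropic lines with a common point are orthogonal; so pairwise skew lines meet \<open>b\<close> in different
  points.\<close>
lemma meet_w_inj:
  assumes m: "meets b r" "meets b r'" and e: "meet_w b r = meet_w b r'"
  shows "line_form r r' = 0"
  using meets_same_point[OF m(1)] meets_same_point[OF m(2)] e
  by (intro line_form_through_point[of r "meet_w b r" r']) simp_all

text \<open>If the contact remainder vanishes on the surface, then through each general point of the line \<open>b\<close>
  the second tangent direction yields another line of the surface. These are infinitely many lines, and the
  transversal polynomial of \<open>b\<close> vanishes on all of them.\<close>
lemma transversal_poly_dvd:
  fixes f :: "'k::field_gcd poly3"
  assumes inf: "infinite (UNIV :: 'k set)" and f: "prime_elem f"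
    and char: "\<And>n. 0 < n \<Longrightarrow> n \<le> tdeg f \<Longrightarrow> of_nat n \<noteq> (0::'k)"
    and r: "f dvd fst (contact_rem f)" "f dvd snd (contact_rem f)"
    and b: "restr b f = 0" and smooth: "restr b (du f) \<noteq> 0"
    and two: "restr b (dv f) \<noteq> [:2 * slope b:] * restr b (du f)"
  shows "f dvd transversal_poly f b"
proof -
  obtain s a c where bs: "b = (s, a, c)" by (cases b)
  define \<alpha> \<beta> where "\<alpha> = restr b (du f)" and "\<beta> = restr b (dv f)"
  define h where "h = \<alpha> * (\<beta> - [:2 * s:] * \<alpha>)"
  have h: "h \<noteq> 0" using smooth two by (auto simp: h_def \<alpha>_def \<beta>_def bs)
  define W where "W = {w. poly h w \<noteq> 0}"
  have "finite {w. poly h w = 0}" using h by (rule poly_roots_finite)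
  moreover have "UNIV = W \<union> {w. poly h w = 0}" by (auto simp: W_def)
  ultimately have infW: "infinite W" using inf by (metis finite_UnI)
  \<comment> \<open>The roots of the tangent quadric
    \<open>\<alpha> \<tau>\<^sup>2 - \<beta> \<tau> + \<gamma>\<close> have the sum
    \<open>\<beta> / \<alpha>\<close>, and one of them is \<open>s\<close>.\<close>
  define \<sigma> where "\<sigma> = (\<lambda>w. poly \<beta> w / poly \<alpha> w - s)"
  define L where "L = (\<lambda>w. let v = poly (line_v b) w; u = poly (line_u b) w
      in (\<sigma> w, v + w * \<sigma> w, - u - \<sigma> w * v))"
  have slL: "slope (L w) = \<sigma> w" for w by (simp add: L_def Let_def)
  have uv: "poly (line_v (L w)) w = poly (line_v b) w" "poly (line_u (L w)) w = poly (line_u b) w" for w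
    by (simp_all add: L_def Let_def algebra_simps power2_eq_square)
  have same: "poly (restr (L w) g) w = poly (restr b g) w" for g w by (simp add: poly_restr uv)
  have ne: "\<sigma> w \<noteq> s" "poly \<alpha> w \<noteq> 0" if "w \<in> W" for w
    using that by (auto simp: W_def h_def \<sigma>_def field_simps)
  have onb: "line_form b (L w) = 0" for w by (rule line_form_through_point[of _ w]) (simp_all add: uv)
  have L0: "restr (L w) f = 0" if w: "w \<in> W" for w
  proof (rule isotropic_tangent_line_in_surface[OF r char])
    show "poly (restr (L w) f) w = 0" by (simp add: same b)
    show "poly (restr (L w) (du f)) w \<noteq> 0" using ne[OF w] by (simp add: same \<alpha>_def)
    have "poly (pderiv (restr b f)) w = 0" using b by simp
    hence "s ^ 2 * poly \<alpha> w - s * poly \<beta> w + poly (restr b (dw f)) w = 0"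
      by (simp add: pderiv_restr \<alpha>_def \<beta>_def bs)
    moreover have "poly \<beta> w = (\<sigma> w + s) * poly \<alpha> w" using ne[OF w] by (simp add: \<sigma>_def)
    moreover have "\<sigma> w ^ 2 * x - \<sigma> w * ((\<sigma> w + s) * x) + z = s ^ 2 * x - s * ((\<sigma> w + s) * x) + z" for x z
      by (simp add: algebra_simps power2_eq_square)
    ultimately have "\<sigma> w ^ 2 * poly \<alpha> w - \<sigma> w * poly \<beta> w + poly (restr b (dw f)) w = 0" by simp
    thus "poly (eval\<tau> (L w) (tangent_quadric f)) w = 0"
      by (simp add: eval\<tau>_tangent_quadric pderiv_restr same slL \<alpha>_def \<beta>_def)
  qed
  have "inj_on L W"
  proof (rule inj_onI, rule ccontr)
    fix w w' assume w: "w \<in> W" "w' \<in> W" "L w = L w'" "w \<noteq> w'"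
    obtain s' a' c' where Lw: "L w = (s', a', c')" by (cases "L w")
    have Lw': "L w' = (s', a', c')" using Lw w(3) by simp
    have "a' - s' * w = a - s * w" "a' - s' * w' = a - s * w'"
      using uv(1)[of w] uv(1)[of w'] by (simp_all add: Lw Lw' bs mult.commute)
    moreover have "(s' - s) * (w - w') = (a' - s' * w') - (a - s * w') - ((a' - s' * w) - (a - s * w))"
      by (simp add: algebra_simps)
    ultimately have "(s' - s) * (w - w') = 0" by simp
    thus False using w(4) ne[OF w(1)] slL[of w] by (simp add: Lw)
  qed
  hence "infinite (L ` W)" using infW finite_imageD by blast
  thus ?thesis
  proof (rule common_lines_infinite[OF f])
    fix l assume "l \<in> L ` W"
    thus "restr l f = 0 \<and> restr l (transversal_poly f b) = 0"
      using L0 onb by (auto intro: restr_transversal_poly)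
  qed
qed

lemma constant_if_gradient_zero:
  fixes f :: "'k::idom poly3"
  assumes char: "\<And>n. 0 < n \<Longrightarrow> n \<le> tdeg f \<Longrightarrow> of_nat n \<noteq> (0::'k)"
    and g: "du f = 0" "dv f = 0" "dw f = 0"
  shows "\<exists>k. f = const3 k"
proof -
  have z: "coeff (coeff (coeff f i) j) k = 0" if "i + j + k > 0" for i j k
  proof (rule ccontr)
    assume nz: "coeff (coeff (coeff f i) j) k \<noteq> 0"
    hence le: "i + j + k \<le> tdeg f" using tdeg_le_iff[of f "tdeg f"] by blast
    consider i' where "i = Suc i'" | j' where "j = Suc j'" | k' where "k = Suc k'"
      using \<open>i + j + k > 0\<close> by (cases i; cases j; cases k) auto
    thus False
    proof cases
      case 1 thus ?thesis using nz le char[of i] coeff_partials(2)[of f i' j k] g by (auto simp del: of_nat_Suc)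
    next
      case 2 thus ?thesis using nz le char[of j] coeff_partials(1)[of f i j' k] g by (auto simp del: of_nat_Suc)
    next
      case 3 thus ?thesis using nz le char[of k] coeff_partials(3)[of f i j k'] g by (auto simp del: of_nat_Suc)
    qed
  qed
  have "f = const3 (coeff (coeff (coeff f 0) 0) 0)"
    unfolding const3_def by (auto simp: poly_eq_iff coeff_pCons z split: nat.split)
  thus ?thesis ..
qed

lemma not_dvd_smaller_tdeg:
  assumes "(g :: 'k::idom poly3) \<noteq> 0" "tdeg g < tdeg f" shows "\<not> f dvd g"
proof
  assume "f dvd g"
  then obtain h where h: "g = f * h" by (rule dvdE)
  hence "tdeg g = tdeg f + tdeg h" using assms(1) by (auto intro: tdeg.D_mult)
  thus False using assms(2) by simp
qed

text \<open>Polynomials of degree at most \<open>4 d\<close> that vanish at the crossings of a line vanish on the line. So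
  a line on which \<open>du f\<close> vanishes lies in the singular locus, where there are at most
  \<open>2 d\<^sup>2\<close> lines, and the other lines lie on the zero set of the contact remainder, which
  contains at most \<open>8 d\<^sup>2\<close> lines of the surface unless the remainder vanishes on it. In that
  case \<open>f\<close> divides the transversal polynomials, and three lines would have three different directions
  of transversals at a general point, where the tangent quadric has only two roots; so two of the lines have all
  transversals in common.\<close>
lemma richly_crossed_lines_card:
  fixes f :: "'k::field_gcd poly3"
  assumes inf: "infinite (UNIV :: 'k set)" and f: "prime_elem f"
    and char: "\<And>n. 0 < n \<Longrightarrow> n \<le> tdeg f \<Longrightarrow> of_nat n \<noteq> (0::'k)"
    and fin: "finite B" and inj: "inj_on line_u B"
    and B: "\<And>b. b \<in> B \<Longrightarrow> restr b f = 0"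
    and N: "\<And>b. b \<in> B \<Longrightarrow> finite (N b) \<and> 4 * tdeg f < card (N b)"
    and cross: "\<And>b r. b \<in> B \<Longrightarrow> r \<in> N b \<Longrightarrow> meets b r \<and> restr r f = 0"
    and skew: "\<And>b r r'. b \<in> B \<Longrightarrow> r \<in> N b \<Longrightarrow> r' \<in> N b \<Longrightarrow> r \<noteq> r' \<Longrightarrow> line_form r r' \<noteq> 0"
    and few: "\<And>b b'. b \<in> B \<Longrightarrow> b' \<in> B \<Longrightarrow> b \<noteq> b' \<Longrightarrow> card {r \<in> N b. line_form b' r = 0} < card (N b)"
  shows "card B \<le> 10 * tdeg f ^ 2"
proof (cases "B = {}")
  case False
  define d where "d = tdeg f"
  have winj: "inj_on (meet_w b) (N b)" if "b \<in> B" for b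
  proof (rule inj_onI, rule ccontr)
    fix r r' assume r: "r \<in> N b" "r' \<in> N b" "meet_w b r = meet_w b r'" "r \<noteq> r'"
    have "line_form r r' = 0" using cross[OF that] r(1-3) by (intro meet_w_inj[of b]) auto
    thus False using skew[OF that] r by blast
  qed
  have vanish: "restr b g = 0" if b: "b \<in> B" and g: "tdeg g \<le> 4 * d"
    and z: "\<And>r. r \<in> N b \<Longrightarrow> poly (restr b g) (meet_w b r) = 0" for b g
    by (rule restr_eq_0_if_many_zeros[of "N b" g "meet_w b"]) (use N[OF b] g z winj[OF b] in \<open>auto simp: d_def\<close>)
  have nconst: "f \<noteq> const3 k" for k
  proof
    assume fk: "f = const3 k"
    from False obtain b where "b \<in> B" by blast
    hence "k = 0" using B[of b] fk by simp
    thus False using f fk by (simp add: const3_def)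
  qed
  hence grad: "\<not> (du f = 0 \<and> dv f = 0 \<and> dw f = 0)" using constant_if_gradient_zero[OF char] by blast
  have dpos: "d \<noteq> 0"
  proof
    assume d0: "d = 0"
    hence "f = const3 (coeff (coeff (coeff f 0) 0) 0)"
      using tdeg_le_iff[of f 0] by (auto simp: const3_def d_def poly_eq_iff coeff_pCons split: nat.split)
    thus False using nconst by blast
  qed
  define S where "S = {b \<in> B. restr b (du f) = 0}"
  have tp: "tdeg (du f) \<le> d - 1" "tdeg (dv f) \<le> d - 1" "tdeg (dw f) \<le> d - 1"
    unfolding d_def by (rule tdeg_partial_le)+
  have sing: "restr b (dv f) = 0 \<and> restr b (dw f) = 0" if b: "b \<in> S" for b
  proof -
    have bB: "b \<in> B" and u: "restr b (du f) = 0" using b by (auto simp: S_def)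
    have "poly (restr b (dv f)) (meet_w b r) = 0 \<and> poly (restr b (dw f)) (meet_w b r) = 0" if "r \<in> N b" for r
      using cross[OF bB that] gradient_at_crossing[of b r f] B[OF bB] u by simp
    thus ?thesis using vanish[OF bB, of "dv f"] vanish[OF bB, of "dw f"] tp by simp
  qed
  have "card S \<le> 2 * d * d"
  proof -
    obtain g where g: "g \<in> {du f, dv f, dw f}" "g \<noteq> 0" using grad by blast
    have lt: "tdeg g < tdeg f" using g tp dpos by (auto simp: d_def)
    have "card S \<le> 2 * tdeg f * tdeg g"
    proof (rule common_lines_card[OF f not_dvd_smaller_tdeg[OF g(2) lt]])
      show "inj_on line_u S" by (rule inj_on_subset[OF inj]) (auto simp: S_def)
      fix b assume "b \<in> S"
      hence "b \<in> B" "restr b (du f) = 0" "restr b (dv f) = 0" "restr b (dw f) = 0" using sing[of b] by (auto simp: S_def)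
      thus "restr b f = 0 \<and> restr b g = 0" using B[of b] g by blast
    qed
    also have "\<dots> \<le> 2 * d * d" using lt by (simp add: d_def)
    finally show ?thesis .
  qed
  moreover have "card (B - S) \<le> 8 * d * d"
  proof (cases "f dvd fst (contact_rem f) \<and> f dvd snd (contact_rem f)")
    case False
    then obtain g where g: "g \<in> {fst (contact_rem f), snd (contact_rem f)}" "\<not> f dvd g" by blast
    have tg: "tdeg g \<le> 4 * d" using g tdeg_contact_rem[of f] by (auto simp: d_def)
    have "card (B - S) \<le> 2 * tdeg f * tdeg g"
    proof (rule common_lines_card[OF f g(2)])
      show "inj_on line_u (B - S)" by (rule inj_on_subset[OF inj]) auto
      fix b assume b: "b \<in> B - S"
      hence bB: "b \<in> B" by simp
      have "restr b g = 0"
      proof (rule vanish[OF bB tg])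
        fix r assume "r \<in> N b"
        thus "poly (restr b g) (meet_w b r) = 0"
          using cross[OF bB] contact_rem_at_crossing[of b r f] B[OF bB] g by auto
      qed
      thus "restr b f = 0 \<and> restr b g = 0" using B[OF bB] by simp
    qed
    also have "\<dots> \<le> 2 * d * (4 * d)" unfolding d_def[symmetric] using tg by (intro mult_left_mono) auto
    finally show ?thesis by simp
  next
    case True
    have tr: "f dvd transversal_poly f b" if b: "b \<in> B - S" for b
    proof (rule transversal_poly_dvd[OF inf f char])
      have bB: "b \<in> B" using b by simp
      show "f dvd fst (contact_rem f)" "f dvd snd (contact_rem f)" using True by auto
      show "restr b f = 0" by (rule B[OF bB])
      show u: "restr b (du f) \<noteq> 0" using b by (simp add: S_def)
      show "restr b (dv f) \<noteq> [:2 * slope b:] * restr b (du f)"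
      proof
        assume e: "restr b (dv f) = [:2 * slope b:] * restr b (du f)"
        have "poly (restr b (du f)) (meet_w b r) = 0" if r: "r \<in> N b" for r
        proof -
          let ?x = "poly (restr b (du f)) (meet_w b r)"
          have m: "meets b r" using cross[OF bB r] by simp
          have "2 * slope b * ?x = (slope b + slope r) * ?x"
            using gradient_at_crossing(1)[OF m B[OF bB]] cross[OF bB r] e by simp
          hence "(slope b - slope r) * ?x = 0" by (simp add: algebra_simps)
          thus ?thesis using m by (simp add: meets_def)
        qed
        hence "restr b (du f) = 0" using vanish[OF bB] tp by simp
        thus False using u by simp
      qed
    qed
    have "card (B - S) \<le> 2"
    proof (rule ccontr)
      assume "\<not> ?thesis"
      hence "3 \<le> card (B - S)" by simp
      then obtain T where T: "T \<subseteq> B - S" "card T = 3" by (rule obtain_subset_with_card_n)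
      then obtain b1 b2 b3 where b: "T = {b1, b2, b3}" "b1 \<noteq> b2" "b1 \<noteq> b3" "b2 \<noteq> b3"
        by (auto simp: card_3_iff)
      hence bB: "b1 \<in> B - S" "b2 \<in> B - S" "b3 \<in> B - S" using T by auto
      \<comment> \<open>It vanishes where the transversals to \<open>b\<close> and to \<open>b'\<close> have the same
        direction.\<close>
      define \<Delta> where "\<Delta> = (\<lambda>b b' :: 'k line. eqn_a b * eqn_b b' - eqn_a b' * eqn_b b)"
      have "f dvd du f * (\<Delta> b1 b2 * \<Delta> b1 b3 * \<Delta> b2 b3)"
        unfolding \<Delta>_def vandermonde_elimination[where y="dv f" and z="dw f"]
        unfolding transversal_poly_def[symmetric]
        by (rule dvd_add[OF dvd_diff[OF dvd_mult2[OF tr[OF bB(1)]] dvd_mult2[OF tr[OF bB(2)]]] dvd_mult2[OF tr[OF bB(3)]]])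
      moreover have "\<not> f dvd du f" using bB(1) B[of b1] restr_dvd[of f "du f" b1] by (auto simp: S_def)
      ultimately have "f dvd \<Delta> b1 b2 \<or> f dvd \<Delta> b1 b3 \<or> f dvd \<Delta> b2 b3"
        using f by (simp add: prime_elem_dvd_mult_iff)
      then obtain b b' where bb: "b \<in> B" "b' \<in> B" "b \<noteq> b'" "f dvd \<Delta> b b'" using b bB by blast
      have "line_form b' r = 0" if r: "r \<in> N b" for r
      proof -
        have m: "meets b r" and f0: "restr r f = 0" using cross[OF bb(1) r] by auto
        let ?s = "[:slope r:]" and ?B = "restr r (eqn_b b)"
        have A: "restr r (eqn_a b) = - ?s * ?B"
          using restr_eqns[of r b] m by (simp add: meets_def eq_neg_iff_add_eq_0)
        have "restr r (\<Delta> b b') = - ((restr r (eqn_a b') + ?s * restr r (eqn_b b')) * ?B)"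
          unfolding \<Delta>_def restr_simps A by (simp only: ring_distribs mult_minus_left mult_minus_right minus_add_distrib diff_conv_add_uminus ac_simps)
        also have "\<dots> = - ([:line_form b' r:] * ?B)" by (simp only: restr_eqns)
        finally have "[:line_form b' r:] * ?B = 0" using restr_dvd[OF bb(4) f0] by simp
        moreover have "?B \<noteq> 0" using m by (intro restr_eqn_b_nonzero) (auto simp: meets_def)
        ultimately show ?thesis by simp
      qed
      hence "{r \<in> N b. line_form b' r = 0} = N b" by blast
      thus False using few[OF bb(1-3)] by simp
    qed
    also have "2 \<le> 8 * d * d" using dpos by (cases d) auto
    finally show ?thesis .
  qed
  moreover have "card B = card S + card (B - S)"
  proof -
    have "S \<subseteq> B" "finite S" using fin by (auto simp: S_def)
    thus ?thesis using fin card_mono[of B S] by (simp add: card_Diff_subset)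
  qed
  ultimately show ?thesis by (simp add: d_def power2_eq_square)
qed simp

lemma tdeg_prod: "finite A \<Longrightarrow> (\<And>a. a \<in> A \<Longrightarrow> \<phi> a \<noteq> 0) \<Longrightarrow> tdeg (prod \<phi> A) = (\<Sum>a\<in>A. tdeg (\<phi> a))"
proof (induction A rule: finite_induct)
  case empty
  have "tdeg (1::'b poly3) = 0" using tdeg.D_mult[of "1::'b poly3" 1] by simp
  thus ?case by simp
next
  case (insert x F)
  thus ?case by (simp add: tdeg.D_mult)
qed

lemma restr_prod: "restr l (prod \<phi> A) = (\<Prod>a\<in>A. restr l (\<phi> a))"
  by (induction A rule: infinite_finite_induct) auto

lemma tdeg_dvd_le: "(g::'k::idom poly3) \<noteq> 0 \<Longrightarrow> f dvd g \<Longrightarrow> tdeg f \<le> tdeg g"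
  using not_dvd_smaller_tdeg[of g f] by (meson not_le)

lemma sum_squares_le_square_sum:
  fixes \<phi> :: "'a \<Rightarrow> nat"
  assumes "finite A"
  shows "(\<Sum>a\<in>A. \<phi> a ^ 2) \<le> (\<Sum>a\<in>A. \<phi> a) ^ 2"
  using assms
proof (induction A rule: finite_induct)
  case (insert x F)
  have "\<phi> x ^ 2 + (\<Sum>a\<in>F. \<phi> a) ^ 2 \<le> (\<phi> x + (\<Sum>a\<in>F. \<phi> a)) ^ 2" by (simp add: power2_sum)
  thus ?case using insert by simp
qed simp

text \<open>The bound for reducible surfaces: lines on two components are few, and a line on one
  component meets the other components in few points.\<close>
lemma richly_crossed_lines_card_reducible:
  fixes f :: "'k::field_gcd poly3"
  assumes inf: "infinite (UNIV :: 'k set)" and f: "f \<noteq> 0"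
    and char: "\<And>n. 0 < n \<Longrightarrow> n \<le> tdeg f \<Longrightarrow> of_nat n \<noteq> (0::'k)"
    and fin: "finite B" and inj: "inj_on line_u B"
    and B: "\<And>b. b \<in> B \<Longrightarrow> restr b f = 0"
    and N: "\<And>b. b \<in> B \<Longrightarrow> finite (N b) \<and> 5 * tdeg f < card (N b)"
    and cross: "\<And>b r. b \<in> B \<Longrightarrow> r \<in> N b \<Longrightarrow> meets b r \<and> restr r f = 0"
    and skew: "\<And>b r r'. b \<in> B \<Longrightarrow> r \<in> N b \<Longrightarrow> r' \<in> N b \<Longrightarrow> r \<noteq> r' \<Longrightarrow> line_form r r' \<noteq> 0"
    and few: "\<And>b b'. b \<in> B \<Longrightarrow> b' \<in> B \<Longrightarrow> b \<noteq> b' \<Longrightarrow>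
      card {r \<in> N b. line_form b' r = 0} + tdeg f < card (N b)"
  shows "card B \<le> 12 * tdeg f ^ 2"
proof -
  define P where "P = prime_factors f"
  have finP: "finite P" by (simp add: P_def)
  have prP: "prime_elem g" "g \<noteq> 0" if "g \<in> P" for g
    using that by (auto simp: P_def in_prime_factors_iff dest: prime_imp_prime_elem)
  have ndvd: "\<not> g dvd g'" if "g \<in> P" "g' \<in> P" "g \<noteq> g'" for g g'
    using that primes_dvd_imp_eq unfolding P_def by (meson in_prime_factors_imp_prime)
  have "normalize (\<Prod>\<^sub># (prime_factorization f)) = normalize f"
    using f by (rule prod_mset_prime_factorization_weak)
  hence pf: "\<Prod>\<^sub># (prime_factorization f) dvd f" "f dvd \<Prod>\<^sub># (prime_factorization f)"
    using associatedD1 associatedD2 by blast+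
  have "\<Prod>P dvd \<Prod>\<^sub># (prime_factorization f)"
  proof -
    have "\<Prod>P = \<Prod>\<^sub># (mset_set P)" by (simp add: prod_unfold_prod_mset)
    moreover have "mset_set P \<subseteq># prime_factorization f"
      unfolding P_def by (rule mset_set_set_mset_msubset)
    ultimately show ?thesis by (simp add: prod_mset_subset_imp_dvd)
  qed
  hence prodP: "\<Prod>P dvd f" using pf(1) by (rule dvd_trans)
  have zero: "\<exists>g\<in>P. restr l g = 0" if "restr l f = 0" for l
  proof -
    have "restr l (\<Prod>\<^sub># (prime_factorization f)) = 0" using pf(2) that by (rule restr_dvd)
    moreover have "restr l (\<Prod>\<^sub># M) = 0 \<Longrightarrow> \<exists>g\<in>#M. restr l g = 0" for M
      by (induction M) auto
    ultimately show ?thesis by (auto simp: P_def)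
  qed
  define d where "d = tdeg f"
  have sumd: "(\<Sum>g\<in>P. tdeg g) \<le> d"
    using tdeg_dvd_le[OF f prodP] tdeg_prod[OF finP, of id] prP by (simp add: d_def)
  have dle: "tdeg g \<le> d" if "g \<in> P" for g using sumd member_le_sum[OF that, of tdeg] finP by simp
  define comp where "comp = (\<lambda>b. {g \<in> P. restr b g = 0})"
  define bad where "bad = (\<lambda>g g'. {b \<in> B. restr b g = 0 \<and> restr b g' = 0})"
  define good where "good = (\<lambda>g. {b \<in> B. comp b = {g}})"
  let ?PP = "{(g, g'). g \<in> P \<and> g' \<in> P \<and> g \<noteq> g'}"
  have finPP: "finite ?PP" by (rule finite_subset[of _ "P \<times> P"]) (use finP in auto)
  have cover: "B \<subseteq> (\<Union>(g,g')\<in>?PP. bad g g') \<union> (\<Union>g\<in>P. good g)"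
  proof
    fix b assume b: "b \<in> B"
    then obtain g where g: "g \<in> P" "restr b g = 0" using zero[OF B] by blast
    show "b \<in> (\<Union>(g,g')\<in>?PP. bad g g') \<union> (\<Union>g\<in>P. good g)"
    proof (cases "comp b = {g}")
      case True thus ?thesis using b g by (auto simp: good_def)
    next
      case False
      then obtain g' where "g' \<in> P" "restr b g' = 0" "g' \<noteq> g" using g by (auto simp: comp_def)
      hence "(g, g') \<in> ?PP" "b \<in> bad g g'" using b g by (auto simp: bad_def)
      thus ?thesis by blast
    qed
  qed
  have cbad: "card (bad g g') \<le> 2 * tdeg g * tdeg g'" if "(g, g') \<in> ?PP" for g g'
  proof (rule common_lines_card)
    show "prime_elem g" "\<not> g dvd g'" using that prP ndvd by auto
    show "inj_on line_u (bad g g')" by (rule inj_on_subset[OF inj]) (auto simp: bad_def)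
  qed (auto simp: bad_def)
  have cgood: "card (good g) \<le> 10 * tdeg g ^ 2" if g: "g \<in> P" for g
  proof -
    define N' where "N' = (\<lambda>b. {r \<in> N b. restr r g = 0})"
    define h where "h = \<Prod>(P - {g})"
    have th: "tdeg h \<le> d"
      using tdeg_prod[of "P - {g}" id] finP prP sumd sum.remove[OF finP g, of tdeg] by (simp add: h_def)
    have gd: "b \<in> B" "restr b g = 0" if "b \<in> good g" for b using that by (auto simp: good_def comp_def)
    have big: "card (N b) \<le> card (N' b) + d" if b: "b \<in> good g" for b
    proof -
      note bB = gd(1)[OF b]
      have "restr b h \<noteq> 0" unfolding h_def restr_prod using b finP by (auto simp: good_def comp_def)
      moreover have "poly (restr b h) (meet_w b r) = 0" if r: "r \<in> N b - N' b" for r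
      proof -
        obtain g' where g': "g' \<in> P" "restr r g' = 0" using zero cross[OF bB, of r] r by blast
        hence "g' \<in> P - {g}" using r by (auto simp: N'_def)
        hence "restr r h = 0" unfolding h_def restr_prod using g' finP by auto
        thus ?thesis using poly_restr_meet[of b r h] cross[OF bB, of r] r by simp
      qed
      moreover have "inj_on (meet_w b) (N b - N' b)"
      proof (rule inj_onI, rule ccontr)
        fix r r' assume r: "r \<in> N b - N' b" "r' \<in> N b - N' b" "meet_w b r = meet_w b r'" "r \<noteq> r'"
        have "line_form r r' = 0" using cross[OF bB] r(1-3) by (intro meet_w_inj[of b]) auto
        thus False using skew[OF bB] r by blast
      qed
      moreover have "finite (N b - N' b)" using N[OF bB] by simp
      ultimately have "\<not> tdeg h < card (N b - N' b)" using restr_eq_0_if_many_zeros by blast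
      moreover have "card (N b - N' b) = card (N b) - card (N' b)"
        using N[OF bB] by (intro card_Diff_subset) (auto simp: N'_def)
      ultimately show ?thesis using th by linarith
    qed
    show ?thesis
    proof (rule richly_crossed_lines_card[OF inf, where N=N'])
      show "prime_elem g" by (rule prP[OF g])
      show "of_nat n \<noteq> (0::'k)" if "0 < n" "n \<le> tdeg g" for n
        using char[of n] that dle[OF g] by (simp add: d_def)
      show "finite (good g)" using fin by (simp add: good_def)
      show "inj_on line_u (good g)" by (rule inj_on_subset[OF inj]) (auto simp: good_def)
    next
      fix b assume b: "b \<in> good g"
      note bB = gd(1)[OF b]
      show "restr b g = 0" using gd(2)[OF b] .
      show "finite (N' b) \<and> 4 * tdeg g < card (N' b)"
        using N[OF bB] big[OF b] dle[OF g] by (auto simp: N'_def d_def)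
      show "meets b r \<and> restr r g = 0" if "r \<in> N' b" for r using that cross[OF bB] by (auto simp: N'_def)
      show "line_form r r' \<noteq> 0" if "r \<in> N' b" "r' \<in> N' b" "r \<noteq> r'" for r r'
        using that skew[OF bB] by (auto simp: N'_def)
      fix b' assume b': "b' \<in> good g" "b \<noteq> b'"
      have "card {r \<in> N' b. line_form b' r = 0} \<le> card {r \<in> N b. line_form b' r = 0}"
        using N[OF bB] by (intro card_mono) (auto simp: N'_def)
      thus "card {r \<in> N' b. line_form b' r = 0} < card (N' b)"
        using few[OF bB gd(1)[OF b'(1)] b'(2)] big[OF b] by (simp add: d_def)
    qed
  qed
  have finU: "finite ((\<Union>(g,g')\<in>?PP. bad g g') \<union> (\<Union>g\<in>P. good g))"
    using finPP finP fin by (auto simp: bad_def good_def)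
  have "card B \<le> card (\<Union>(g,g')\<in>?PP. bad g g') + card (\<Union>g\<in>P. good g)"
    using card_mono[OF finU cover] card_Un_le by (rule order.trans)
  also have "\<dots> \<le> (\<Sum>x\<in>?PP. 2 * tdeg (fst x) * tdeg (snd x)) + (\<Sum>g\<in>P. 10 * tdeg g ^ 2)"
  proof (intro add_mono)
    have "card (\<Union>x\<in>?PP. bad (fst x) (snd x)) \<le> (\<Sum>x\<in>?PP. card (bad (fst x) (snd x)))"
      by (rule card_UN_le[OF finPP])
    also have "\<dots> \<le> (\<Sum>x\<in>?PP. 2 * tdeg (fst x) * tdeg (snd x))" using cbad by (intro sum_mono) auto
    finally show "card (\<Union>(g,g')\<in>?PP. bad g g') \<le> (\<Sum>x\<in>?PP. 2 * tdeg (fst x) * tdeg (snd x))"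
      by (simp add: case_prod_beta)
    have "card (\<Union>g\<in>P. good g) \<le> (\<Sum>g\<in>P. card (good g))" by (rule card_UN_le[OF finP])
    also have "\<dots> \<le> (\<Sum>g\<in>P. 10 * tdeg g ^ 2)" by (intro sum_mono cgood)
    finally show "card (\<Union>g\<in>P. good g) \<le> (\<Sum>g\<in>P. 10 * tdeg g ^ 2)" .
  qed
  also have "(\<Sum>x\<in>?PP. 2 * tdeg (fst x) * tdeg (snd x)) \<le> (\<Sum>x\<in>P \<times> P. 2 * tdeg (fst x) * tdeg (snd x))"
    using finP by (intro sum_mono2) auto
  also have "(\<Sum>x\<in>P \<times> P. 2 * tdeg (fst x) * tdeg (snd x)) = 2 * (\<Sum>g\<in>P. tdeg g) ^ 2"
  proof -
    have "(\<Sum>g\<in>P. tdeg g) ^ 2 = (\<Sum>x\<in>P \<times> P. tdeg (fst x) * tdeg (snd x))"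
      unfolding power2_eq_square sum_product sum.cartesian_product by (simp add: case_prod_beta)
    thus ?thesis by (simp only: sum_distrib_left mult.assoc)
  qed
  also have "2 * (\<Sum>g\<in>P. tdeg g) ^ 2 \<le> 2 * d ^ 2" using sumd by (simp add: power_mono)
  also have "(\<Sum>g\<in>P. 10 * tdeg g ^ 2) \<le> 10 * d ^ 2"
    using sum_squares_le_square_sum[OF finP, of tdeg] power_mono[OF sumd, of 2]
    unfolding sum_distrib_left[symmetric] by linarith
  finally show ?thesis by (simp add: d_def)
qed

section \<open>Surfaces through many lines\<close>

text \<open>Gaussian elimination of one variable with one equation.\<close>
lemma homogeneous_system_solvable:
  fixes M :: "'j \<Rightarrow> 'i \<Rightarrow> 'k::field"
  assumes "finite J" "finite I" "card J < card I"
  shows "\<exists>x. (\<exists>i\<in>I. x i \<noteq> 0) \<and> (\<forall>j\<in>J. (\<Sum>i\<in>I. M j i * x i) = 0)"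
  using assms
proof (induction J arbitrary: I M rule: finite_induct)
  case empty
  then obtain i where "i \<in> I" by fastforce
  thus ?case by (intro exI[of _ "\<lambda>_. 1"]) auto
next
  case (insert j J)
  show ?case
  proof (cases "\<forall>i\<in>I. M j i = 0")
    case True
    have "card J < card I" using insert by simp
    then obtain x where x: "\<exists>i\<in>I. x i \<noteq> 0" "\<forall>j\<in>J. (\<Sum>i\<in>I. M j i * x i) = 0"
      using insert.IH[OF insert.prems(1), of M] by blast
    thus ?thesis using True by (intro exI[of _ x]) auto
  next
    case False
    then obtain i0 where i0: "i0 \<in> I" "M j i0 \<noteq> 0" by blast
    define I' where "I' = I - {i0}"
    define M' where "M' = (\<lambda>j' i. M j' i - M j' i0 * M j i / M j i0)"
    have "card J < card I'" "finite I'" using insert i0 by (auto simp: I'_def)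
    then obtain x where x: "\<exists>i\<in>I'. x i \<noteq> 0" "\<forall>j\<in>J. (\<Sum>i\<in>I'. M' j i * x i) = 0"
      using insert.IH[of I' M'] by blast
    define y where "y = (\<lambda>i. if i = i0 then - (\<Sum>i\<in>I'. M j i * x i) / M j i0 else x i)"
    have split: "(\<Sum>i\<in>I. M j' i * y i) = M j' i0 * y i0 + (\<Sum>i\<in>I'. M j' i * x i)" for j'
      unfolding I'_def using insert.prems(1) i0(1)
      by (subst sum.remove[of _ i0]) (auto simp: y_def intro!: sum.cong)
    have "(\<Sum>i\<in>I. M j i * y i) = 0" unfolding split using i0(2) by (simp add: y_def)
    moreover have "(\<Sum>i\<in>I. M j' i * y i) = 0" if "j' \<in> J" for j'
    proof -
      have "(\<Sum>i\<in>I'. M' j' i * x i) = (\<Sum>i\<in>I'. M j' i * x i) - M j' i0 / M j i0 * (\<Sum>i\<in>I'. M j i * x i)"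
        unfolding M'_def by (simp add: algebra_simps sum_subtractf sum_distrib_left sum_divide_distrib)
      moreover have "M j' i0 * y i0 = - (M j' i0 / M j i0 * (\<Sum>i\<in>I'. M j i * x i))" by (simp add: y_def)
      ultimately show ?thesis unfolding split using x(2) that by simp
    qed
    moreover have "\<exists>i\<in>I. y i \<noteq> 0" using x(1) by (auto simp: y_def I'_def)
    ultimately show ?thesis by (intro exI[of _ y]) auto
  qed
qed

text \<open>There are \<open>n\<^sup>3\<close> monomials with exponents below \<open>n\<close>, and each line imposes at
  most \<open>3 n\<close> linear conditions on a combination of them.\<close>
lemma surface_through_lines:
  fixes R :: "'k::field line set"
  assumes fin: "finite R" and n: "3 * card R < n ^ 2"
  shows "\<exists>f. f \<noteq> 0 \<and> tdeg f \<le> 3 * (n - 1) \<and> (\<forall>r\<in>R. restr r f = 0)"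
proof -
  define I where "I = {..<n} \<times> {..<n} \<times> {..<n}"
  define J where "J = R \<times> {..<3 * n}"
  define mono where "mono = (\<lambda>(i, j, k). monom (monom (monom (1::'k) k) j) i)"
  have n0: "n > 0" using n by (cases n) auto
  have "card J = 3 * n * card R" by (simp add: J_def card_cartesian_product mult.commute)
  also have "\<dots> = n * (3 * card R)" by simp
  also have "\<dots> < n * n ^ 2" using n n0 by (intro mult_strict_left_mono)
  also have "\<dots> = card I" by (simp add: I_def card_cartesian_product power2_eq_square)
  finally have "card J < card I" .
  moreover have finI: "finite I" and "finite J" using fin by (simp_all add: I_def J_def)
  ultimately obtain x where x: "\<exists>i\<in>I. x i \<noteq> 0"
    "\<forall>j\<in>J. (\<Sum>i\<in>I. (\<lambda>(r, m) i. coeff (restr r (mono i)) m) j i * x i) = 0"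
    using homogeneous_system_solvable[of J I "\<lambda>(r, m) i. coeff (restr r (mono i)) m"] by blast
  define f where "f = (\<Sum>i\<in>I. const3 (x i) * mono i)"
  have cm: "coeff (coeff (coeff (const3 y * mono t) i) j) k = (if t = (i, j, k) then y else 0)" for y t i j k
    by (cases t) (simp add: const3_def mono_def)
  have cf: "coeff (coeff (coeff f i) j) k = (if (i, j, k) \<in> I then x (i, j, k) else 0)" for i j k
  proof -
    have "coeff (coeff (coeff f i) j) k = (\<Sum>t\<in>I. if t = (i, j, k) then x t else 0)"
      unfolding f_def by (simp add: coeff_sum cm)
    thus ?thesis using finI by (simp add: sum.delta')
  qed
  have "f \<noteq> 0" using x(1) cf by (metis coeff_0 prod_cases3)
  moreover have td: "tdeg f \<le> 3 * (n - 1)"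
    unfolding tdeg_le_iff cf by (auto simp: I_def split: if_splits)
  moreover have "restr r f = 0" if r: "r \<in> R" for r
  proof (rule poly_eqI)
    fix m
    have rs: "restr r (\<Sum>i\<in>A. \<phi> i) = (\<Sum>i\<in>A. restr r (\<phi> i))" for A and \<phi> :: "(nat \<times> nat \<times> nat) \<Rightarrow> 'k poly3"
      by (induction A rule: infinite_finite_induct) auto
    have c: "coeff (restr r f) m = (\<Sum>i\<in>I. coeff (restr r (mono i)) m * x i)"
      unfolding f_def rs by (simp add: coeff_sum mult.commute)
    show "coeff (restr r f) m = coeff 0 m"
    proof (cases "m < 3 * n")
      case True
      thus ?thesis unfolding c using x(2) r by (auto simp: J_def)
    next
      case False
      hence "degree (restr r f) < m" using degree_restr_le[of r f] td n0 by linarith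
      thus ?thesis by (simp add: coeff_eq_0)
    qed
  qed
  ultimately show ?thesis by blast
qed

subsection \<open>Sampling\<close>

text \<open>The sum on the left is at most its mean when each point is put into \<open>S\<close> independently
  with probability \<open>q\<close>.\<close>
lemma subset_below_mean:
  fixes a b :: "'i \<Rightarrow> 'r \<Rightarrow> real" and w :: "'i \<Rightarrow> real"
  assumes "finite R" "0 \<le> q" "q \<le> 1"
  shows "\<exists>S\<subseteq>R. (\<Sum>i\<in>I. w i * (\<Prod>r\<in>R. if r \<in> S then a i r else b i r)) \<le>
    (\<Sum>i\<in>I. w i * (\<Prod>r\<in>R. q * a i r + (1 - q) * b i r))"
  using assms(1)
proof (induction R arbitrary: w rule: finite_induct)
  case (insert x R)
  let ?m = "\<lambda>i. \<Prod>r\<in>R. q * a i r + (1 - q) * b i r"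
  let ?A = "\<Sum>i\<in>I. (w i * a i x) * ?m i" and ?B = "\<Sum>i\<in>I. (w i * b i x) * ?m i"
  have tot: "(\<Sum>i\<in>I. w i * (\<Prod>r\<in>insert x R. q * a i r + (1 - q) * b i r)) = q * ?A + (1 - q) * ?B"
    using insert by (simp add: sum_distrib_left sum.distrib[symmetric] algebra_simps)
  have cong: "(\<Prod>r\<in>R. if r \<in> insert x S then a i r else b i r) = (\<Prod>r\<in>R. if r \<in> S then a i r else b i r)"
    "(\<Prod>r\<in>R. if r \<in> S - {x} then a i r else b i r) = (\<Prod>r\<in>R. if r \<in> S then a i r else b i r)" for i S
    using insert by (auto intro!: prod.cong)
  consider "?A \<le> q * ?A + (1 - q) * ?B" | "?B \<le> q * ?A + (1 - q) * ?B"
  proof (cases "?A \<le> ?B")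
    case True
    have "q * ?A + (1 - q) * ?B - ?A = (1 - q) * (?B - ?A)" by (simp add: algebra_simps)
    also have "\<dots> \<ge> 0" using True assms by simp
    finally show ?thesis using that by simp
  next
    case False
    have "q * ?A + (1 - q) * ?B - ?B = q * (?A - ?B)" by (simp add: algebra_simps)
    also have "\<dots> \<ge> 0" using False assms by simp
    finally show ?thesis using that by simp
  qed
  thus ?case
  proof cases
    case 1
    obtain S where S: "S \<subseteq> R" "(\<Sum>i\<in>I. (w i * a i x) * (\<Prod>r\<in>R. if r \<in> S then a i r else b i r)) \<le> ?A"
      using insert.IH[of "\<lambda>i. w i * a i x"] by blast
    show ?thesis unfolding tot
      by (rule exI[of _ "insert x S"]) (use S 1 insert cong in \<open>auto simp: mult.assoc\<close>)
  next
    case 2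
    obtain S where S: "S \<subseteq> R" "(\<Sum>i\<in>I. (w i * b i x) * (\<Prod>r\<in>R. if r \<in> S then a i r else b i r)) \<le> ?B"
      using insert.IH[of "\<lambda>i. w i * b i x"] by blast
    have "x \<notin> S" using S insert by blast
    thus ?thesis unfolding tot
      by (intro exI[of _ S]) (use S 2 insert in \<open>auto simp: mult.assoc\<close>)
  qed
qed simp

text \<open>A Chernoff bound: \<open>2 ^ card S\<close> controls the size of the random set and
  \<open>(1/2) ^ card (N b \<inter> S)\<close> controls its intersection with \<open>N b\<close> from
  below. The weighted sum of these quantities is at most its mean for some \<open>S\<close>.\<close>
lemma sampling:
  fixes N :: "'b \<Rightarrow> 'r set" and q :: real
  assumes fin: "finite R" "finite B" and q: "0 < q" "q \<le> 1"
    and N: "\<And>b. b \<in> B \<Longrightarrow> N b \<subseteq> R \<and> D \<le> card (N b)" and D: "q * real D \<ge> 6"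
  shows "\<exists>S\<subseteq>R. real (card S) \<le> 1 + 2 * q * card R \<and>
    real (card {b \<in> B. real (card (N b \<inter> S)) < q * D / 4}) \<le> card B / 2"
proof (cases "B = {}")
  case True
  thus ?thesis using q by (intro exI[of _ "{}"]) auto
next
  case False
  \<comment> \<open>The index \<open>None\<close> stands for the test of the size, \<open>Some b\<close> for the
    test of \<open>N b\<close>; the weights make the total mean of either kind at most 1.\<close>
  define a where "a = (\<lambda>i r. case i of None \<Rightarrow> 2 | Some b \<Rightarrow> if r \<in> N b then 1/2 else (1::real))"
  define W where "W = real (card B) * (1 - q / 2) ^ D"
  define w where "w = (\<lambda>i. case i of None \<Rightarrow> 1 / (1 + q) ^ card R | Some (b::'b) \<Rightarrow> 1 / W)"
  have cB: "card B > 0" using False fin by (simp add: card_gt_0_iff)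
  have W: "W > 0" using cB q by (simp add: W_def)
  let ?I = "insert None (Some ` B)"
  obtain S where S: "S \<subseteq> R" and le: "(\<Sum>i\<in>?I. w i * (\<Prod>r\<in>R. if r \<in> S then a i r else 1)) \<le>
    (\<Sum>i\<in>?I. w i * (\<Prod>r\<in>R. q * a i r + (1 - q) * 1))"
    using subset_below_mean[OF fin(1), where q=q and I="?I" and w=w and a=a and b="\<lambda>_ _. 1"] q by auto
  have sumI: "(\<Sum>i\<in>?I. \<phi> i) = \<phi> None + (\<Sum>b\<in>B. \<phi> (Some b))" for \<phi> :: "'b option \<Rightarrow> real"
    using fin by (subst sum.insert) (auto simp: sum.reindex)
  have finS: "finite S" using S fin finite_subset by blast
  have prodset: "(\<Prod>r\<in>R. if r \<in> Y then c else 1) = c ^ card (R \<inter> Y)" for Y and c :: real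
    using fin(1) by (simp add: prod.If_cases)
  have L1: "(\<Prod>r\<in>R. if r \<in> S then a None r else 1) = 2 ^ card S"
    using prodset[of S 2] S by (simp add: a_def Int_absorb1 cong: if_cong)
  have L2: "(\<Prod>r\<in>R. if r \<in> S then a (Some b) r else 1) = (1/2) ^ card (N b \<inter> S)" if "b \<in> B" for b
  proof -
    have "(\<Prod>r\<in>R. if r \<in> S then a (Some b) r else 1) = (\<Prod>r\<in>R. if r \<in> N b \<inter> S then 1/2 else 1)"
      by (intro prod.cong) (auto simp: a_def)
    also have "R \<inter> (N b \<inter> S) = N b \<inter> S" using S by blast
    hence "(\<Prod>r\<in>R. if r \<in> N b \<inter> S then 1/2 else 1::real) = (1/2) ^ card (N b \<inter> S)"
      using prodset[of "N b \<inter> S" "1/2"] by simp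
    finally show ?thesis .
  qed
  have R1: "(\<Prod>r\<in>R. q * a None r + (1 - q) * 1) = (1 + q) ^ card R"
    by (simp add: a_def algebra_simps)
  have R2: "(\<Prod>r\<in>R. q * a (Some b) r + (1 - q) * 1) \<le> (1 - q/2) ^ D" if "b \<in> B" for b
  proof -
    have "(\<Prod>r\<in>R. q * a (Some b) r + (1 - q) * 1) = (\<Prod>r\<in>R. if r \<in> N b then 1 - q/2 else 1)"
      by (intro prod.cong) (auto simp: a_def)
    also have "\<dots> = (1 - q/2) ^ card (N b)" using prodset[of "N b" "1 - q/2"] N[OF that] by (simp add: Int_absorb1)
    also have "\<dots> \<le> (1 - q/2) ^ D" using N[OF that] q by (intro power_decreasing) auto
    finally show ?thesis .
  qed
  have "(\<Sum>i\<in>?I. w i * (\<Prod>r\<in>R. q * a i r + (1 - q) * 1)) =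
      1 + (\<Sum>b\<in>B. (\<Prod>r\<in>R. q * a (Some b) r + (1 - q) * 1) / W)"
    unfolding sumI R1 using q by (simp add: w_def)
  also have "\<dots> \<le> 1 + (\<Sum>b\<in>B. (1 - q/2) ^ D / W)"
    using R2 W by (intro add_left_mono sum_mono divide_right_mono) auto
  also have "(\<Sum>b\<in>B. (1 - q/2) ^ D / W) = 1" using W q by (auto simp: W_def zero_less_mult_iff)
  finally have le2: "2 ^ card S / (1 + q) ^ card R + (\<Sum>b\<in>B. (1/2) ^ card (N b \<inter> S)) / W \<le> 2"
    using le unfolding sumI L1 by (simp add: L2 w_def sum_divide_distrib cong: sum.cong)
  have p1: "0 \<le> 2 ^ card S / (1 + q) ^ card R" "0 \<le> (\<Sum>b\<in>B. (1/2::real) ^ card (N b \<inter> S)) / W"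
    using q W by (auto intro!: divide_nonneg_pos sum_nonneg)
  have ln2: "ln (2::real) \<ge> 1/2" "ln (2::real) \<le> 1" using ln_ge_iff[of 2 "1/2"] exp_half_le2 ln_le_minus_one[of "2::real"] by auto
  have "2 ^ card S / (1 + q) ^ card R \<le> 2" using le2 p1(2) by linarith
  hence "2 ^ card S \<le> 2 * (1 + q) ^ card R" using q by (simp add: pos_divide_le_eq)
  also have "\<dots> \<le> 2 * exp (q * card R)"
    using power_mono[of "1 + q" "exp q" "card R"] exp_ge_add_one_self[of q] q
    by (simp add: exp_of_nat_mult mult.commute[of q])
  finally have "ln (2 ^ card S) \<le> ln (2 * exp (q * card R))" by (subst ln_le_cancel_iff) auto
  hence s: "card S * ln 2 \<le> ln 2 + q * card R" by (simp add: ln_realpow ln_mult)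
  have "real (card S) \<le> 1 + 2 * q * card R"
  proof (cases "card S \<le> 1")
    case True
    thus ?thesis using q by (simp add: add_increasing2)
  next
    case False
    hence "(real (card S) - 1) * (1/2) \<le> (real (card S) - 1) * ln 2" using ln2 by (intro mult_left_mono) auto
    also have "\<dots> \<le> q * card R" using s by (simp add: algebra_simps)
    finally show ?thesis by simp
  qed
  moreover have "real (card {b \<in> B. real (card (N b \<inter> S)) < q * D / 4}) \<le> card B / 2" (is "real (card ?bad) \<le> _")
  proof -
    let ?\<theta> = "q * D / 4"
    have "card ?bad * exp (- ?\<theta>) = (\<Sum>b\<in>?bad. exp (- ?\<theta>))" by simp
    also have "\<dots> \<le> (\<Sum>b\<in>?bad. (1/2) ^ card (N b \<inter> S))"
    proof (intro sum_mono)
      fix b assume "b \<in> ?bad"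
      hence c: "real (card (N b \<inter> S)) \<le> ?\<theta>" by simp
      have "card (N b \<inter> S) * ln 2 \<le> real (card (N b \<inter> S)) * 1" using ln2 by (intro mult_left_mono) auto
      hence "- ?\<theta> \<le> card (N b \<inter> S) * ln (1/2)" using c by (simp add: ln_div)
      hence "exp (- ?\<theta>) \<le> exp (card (N b \<inter> S) * ln (1/2))" by simp
      thus "exp (- ?\<theta>) \<le> (1/2) ^ card (N b \<inter> S)" by (simp add: exp_of_nat_mult)
    qed
    also have "\<dots> \<le> (\<Sum>b\<in>B. (1/2) ^ card (N b \<inter> S))" using fin by (intro sum_mono2) auto
    also have "\<dots> \<le> 2 * W"
    proof -
      have "(\<Sum>b\<in>B. (1/2) ^ card (N b \<inter> S)) / W \<le> 2" using le2 p1(1) by linarith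
      thus ?thesis using W by (simp only: pos_divide_le_eq)
    qed
    also have "W \<le> card B * exp (- (q * D / 2))"
    proof -
      have "(1 - q/2) ^ D \<le> exp (- (q/2)) ^ D" using q exp_ge_add_one_self[of "-(q/2)"] by (intro power_mono) auto
      thus ?thesis by (simp add: W_def exp_of_nat_mult[symmetric] mult.commute mult_left_mono)
    qed
    finally have "card ?bad * exp (- ?\<theta>) \<le> 2 * (card B * exp (- (q * D / 2)))" by simp
    also have "exp (- (q * D / 2)) = exp (- ?\<theta>) * exp (- ?\<theta>)" by (simp flip: exp_add)
    finally have "card ?bad * exp (- ?\<theta>) \<le> (2 * card B * exp (- ?\<theta>)) * exp (- ?\<theta>)" by (simp add: mult.assoc)
    hence 1: "card ?bad \<le> 2 * card B * exp (- ?\<theta>)" by (rule mult_right_le_imp_le) simp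
    have "exp (- ?\<theta>) \<le> 1/4"
    proof -
      have "4 \<le> exp (1::real) * exp (1/2)" using exp_ge_add_one_self[of "1::real"] exp_lower_Taylor_quadratic[of "1::real"]
          exp_lower_Taylor_quadratic[of "1/2::real"] mult_mono[of "5/2" "exp (1::real)" "13/8" "exp (1/2)"]
        by (simp add: power2_eq_square)
      also have "\<dots> = exp (3/2)" by (simp flip: exp_add)
      also have "\<dots> \<le> exp ?\<theta>" using D by simp
      finally show ?thesis by (simp add: exp_minus field_simps)
    qed
    hence "2 * card B * exp (- ?\<theta>) \<le> 2 * card B * (1/4)" by (intro mult_left_mono) auto
    thus ?thesis using 1 by simp
  qed
  ultimately show ?thesis using S by blast
qed

subsection \<open>Crossings between two families of lines\<close>

text \<open>If every line of \<open>B\<close> crosses \<open>D\<close> lines of a family \<open>R\<close> that is not larger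
  than \<open>B\<close>, with \<open>D\<close> large, then a sample of \<open>R\<close> lies on a surface whose
  degree is a small multiple of the square root of \<open>card R\<close>, at least half of \<open>B\<close> lies
  on it too, and this exceeds the number of richly crossed lines on the surface.\<close>
theorem crossing_degree_le:
  fixes R B :: "'k::field_gcd line set" and N :: "'k line \<Rightarrow> 'k line set"
  assumes inf: "infinite (UNIV :: 'k set)"
    and char: "\<And>n. 0 < n \<Longrightarrow> n < p \<Longrightarrow> of_nat n \<noteq> (0::'k)" and p: "27 * card R < p\<^sup>2"
    and fin: "finite R" "finite B" and le: "card R \<le> card B" and ne: "B \<noteq> {}"
    and inj: "inj_on line_u B"
    and N: "\<And>b. b \<in> B \<Longrightarrow> N b \<subseteq> R \<and> D \<le> card (N b)"
    and cross: "\<And>b r. b \<in> B \<Longrightarrow> r \<in> N b \<Longrightarrow> meets b r"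
    and skew: "\<And>r r'. r \<in> R \<Longrightarrow> r' \<in> R \<Longrightarrow> r \<noteq> r' \<Longrightarrow> line_form r r' \<noteq> 0"
    and few: "\<And>b b'. b \<in> B \<Longrightarrow> b' \<in> B \<Longrightarrow> b \<noteq> b' \<Longrightarrow> card {r \<in> N b. line_form b' r = 0} \<le> k"
  shows "real D \<le> 20000 * (sqrt (card R) + k)"
proof (rule ccontr)
  assume "\<not> ?thesis"
  hence D: "real D > 20000 * (sqrt (card R) + k)" by simp
  \<comment> \<open>With \<open>d\<^sup>2 \<le> 27 card S\<close> and
    \<open>card B \<le> 2 * 12 * d\<^sup>2 \<le> 648 card S\<close>, a sample of size about
    \<open>2 q card R\<close> gives \<open>card B \<le> card R / 2\<close>, up to the constant 648.\<close>
  define q where "q = (1/2592::real)"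
  obtain b0 where b0: "b0 \<in> B" using ne by blast
  have DR: "D \<le> card R" using N[OF b0] card_mono[OF fin(1)] by (meson order.trans)
  have "real (card R) = sqrt (card R) * sqrt (card R)" by simp
  hence "20000 * sqrt (card R) < sqrt (card R) * sqrt (card R)" using D DR by auto
  hence sq: "sqrt (card R) > 20000" by (rule mult_right_less_imp_less) simp
  have R0: "real (card R) > 1296"
  proof -
    have "20000 * 20000 \<le> sqrt (card R) * sqrt (card R)" using sq by (intro mult_mono) auto
    thus ?thesis by simp
  qed
  have "q * real D \<ge> 6" using D sq by (simp add: q_def)
  then obtain S where S: "S \<subseteq> R" "real (card S) \<le> 1 + 2 * q * card R"
    "real (card {b \<in> B. real (card (N b \<inter> S)) < q * D / 4}) \<le> card B / 2"
    using sampling[OF fin, of q N D] N by (auto simp: q_def)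
  define n where "n = (LEAST n. 3 * card S < n ^ 2)"
  have ex: "3 * card S < (3 * card S + 1) ^ 2" by (simp add: power2_eq_square)
  have n: "3 * card S < n ^ 2" unfolding n_def by (rule LeastI[of _ "3 * card S + 1"]) (rule ex)
  have n0: "n > 0" using n by (cases n) auto
  have nm: "(n - 1) ^ 2 \<le> 3 * card S"
    using not_less_Least[of "n - 1" "\<lambda>n. 3 * card S < n ^ 2"] n0 by (auto simp: n_def[symmetric] not_less)
  obtain f where f: "f \<noteq> 0" "tdeg f \<le> 3 * (n - 1)" "\<And>r. r \<in> S \<Longrightarrow> restr r f = 0"
    using surface_through_lines[of S n] n finite_subset[OF S(1) fin(1)] by blast
  define d where "d = tdeg f"
  have "d ^ 2 \<le> (3 * (n - 1)) ^ 2" unfolding d_def by (rule power_mono[OF f(2)]) simp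
  hence d2: "d ^ 2 \<le> 27 * card S" using nm by (simp add: power_mult_distrib)
  have cS: "card S \<le> card R" using S fin by (simp add: card_mono)
  have "d < p"
  proof (rule power_less_imp_less_base)
    show "d ^ 2 < p ^ 2" using d2 cS p by simp
  qed simp
  have S2: "real (card S) \<le> 4 * q * card R" using S(2) R0 by (simp add: q_def)
  have "real d ^ 2 \<le> 27 * real (card S)" using d2 by (metis of_nat_le_iff of_nat_mult of_nat_numeral of_nat_power)
  also have "\<dots> \<le> 27 * (4 * q * card R)" using S2 by simp
  also have "\<dots> \<le> (sqrt (card R) / 4) ^ 2" by (simp add: q_def power_divide)
  finally have d4: "real d \<le> sqrt (card R) / 4" by (rule power2_le_imp_le) simp
  define B1 where "B1 = {b \<in> B. real (card (N b \<inter> S)) \<ge> q * D / 4}"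
  have qD: "q * D / 4 > 1.9 * (sqrt (card R) + k)" using D by (simp add: q_def)
  have "card B = card B1 + card {b \<in> B. real (card (N b \<inter> S)) < q * D / 4}"
    using fin(2) by (subst card_Un_disjoint[symmetric]) (auto simp: B1_def intro!: arg_cong[of _ _ card])
  hence half: "real (card B) \<le> 2 * card B1" using S(3) by simp
  have finN: "finite (N b)" if "b \<in> B" for b using N[OF that] fin(1) finite_subset by blast
  have "card B1 \<le> 12 * tdeg f ^ 2"
  proof (rule richly_crossed_lines_card_reducible[OF inf f(1), where N = "\<lambda>b. N b \<inter> S"])
    show "of_nat n \<noteq> (0::'k)" if "0 < n" "n \<le> tdeg f" for n
      using char[of n] that \<open>d < p\<close> by (simp add: d_def)
    show "finite B1" using fin(2) by (simp add: B1_def)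
    show "inj_on line_u B1" by (rule inj_on_subset[OF inj]) (auto simp: B1_def)
  next
    fix b assume b: "b \<in> B1"
    hence bB: "b \<in> B" by (simp add: B1_def)
    have c: "real (card (N b \<inter> S)) > 1.9 * (sqrt (card R) + k)" using b qD by (simp add: B1_def)
    have c5: "5 * d < card (N b \<inter> S)"
    proof -
      have "real (5 * d) \<le> 1.25 * sqrt (card R)" using d4 by simp
      also have "\<dots> < 1.9 * (sqrt (card R) + k)" using sq by (simp add: algebra_simps)
      finally show ?thesis using c by linarith
    qed
    thus "finite (N b \<inter> S) \<and> 5 * tdeg f < card (N b \<inter> S)" using finN[OF bB] by (simp add: d_def)
    show "meets b r \<and> restr r f = 0" if "r \<in> N b \<inter> S" for r using that cross[OF bB] f(3) by auto
    show "line_form r r' \<noteq> 0" if "r \<in> N b \<inter> S" "r' \<in> N b \<inter> S" "r \<noteq> r'" for r r'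
      using that skew S(1) by blast
    show "restr b f = 0"
    proof (rule restr_eq_0_if_many_zeros[of "N b \<inter> S" f "meet_w b"])
      show "finite (N b \<inter> S)" using finN[OF bB] by simp
      show "tdeg f < card (N b \<inter> S)" using c5 by (simp add: d_def)
      show "inj_on (meet_w b) (N b \<inter> S)"
      proof (rule inj_onI, rule ccontr)
        fix r r' assume r: "r \<in> N b \<inter> S" "r' \<in> N b \<inter> S" "meet_w b r = meet_w b r'" "r \<noteq> r'"
        have "line_form r r' = 0" using cross[OF bB] r(1-3) by (intro meet_w_inj[of b]) auto
        thus False using skew r S(1) by blast
      qed
      show "poly (restr b f) (meet_w b r) = 0" if "r \<in> N b \<inter> S" for r
        using that poly_restr_meet[of b r f] cross[OF bB] f(3) by auto
    qed
    fix b' assume b': "b' \<in> B1" "b \<noteq> b'"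
    have "card {r \<in> N b \<inter> S. line_form b' r = 0} \<le> card {r \<in> N b. line_form b' r = 0}"
      using finN[OF bB] by (intro card_mono) auto
    also have "\<dots> \<le> k" using few[OF bB _ b'(2)] b'(1) by (simp add: B1_def)
    finally have "real (card {r \<in> N b \<inter> S. line_form b' r = 0} + d) \<le> k + sqrt (card R) / 4" using d4 by simp
    also have "\<dots> \<le> 1.9 * (sqrt (card R) + k)" by simp
    also have "\<dots> < card (N b \<inter> S)" by (rule c)
    finally show "card {r \<in> N b \<inter> S. line_form b' r = 0} + tdeg f < card (N b \<inter> S)" by (simp add: d_def)
  qed
  also have "\<dots> \<le> 12 * (27 * card S)" using d2 by (simp add: d_def)
  finally have "real (card B1) \<le> 324 * real (card S)" by linarith
  hence "real (card B) \<le> 648 * real (card S)" using half by simp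
  also have "\<dots> \<le> 648 * (1 + 2 * q * card R)" using S(2) by simp
  also have "\<dots> = 648 + real (card R) / 2" by (simp add: q_def)
  also have "\<dots> < real (card R)" using R0 by simp
  finally show False using le by simp
qed

section \<open>Orthogonal pairs for a symplectic form over a finite field\<close>

instance alg_closure :: (field) field_gcd ..

text \<open>Otherwise the product of all linear factors plus 1 would have no root.\<close>
lemma infinite_alg_closure: "infinite (UNIV :: 'a::field alg_closure set)"
proof
  assume fin: "finite (UNIV :: 'a alg_closure set)"
  define P where "P = (\<Prod>x\<in>(UNIV :: 'a alg_closure set). [:- x, 1:])"
  have "degree P = card (UNIV :: 'a alg_closure set)" unfolding P_def
    by (subst degree_prod_eq_sum_degree) auto
  hence d: "degree P > 0" using fin by (simp add: card_gt_0_iff)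
  hence "degree (P + 1) > 0" by (simp add: degree_add_eq_left)
  then obtain x where "poly (P + 1) x = 0" using alg_closed_imp_poly_has_root by blast
  moreover have "poly P x = 0" unfolding P_def poly_prod using fin by (intro prod_zero) auto
  ultimately show False by simp
qed

lemma finite_polys_of_bounded_degree: "finite {g :: 'a::{finite,comm_ring_1} poly. degree g \<le> n}"
proof (rule finite_subset)
  have "g = Poly (map (coeff g) [0..<Suc n])" if "degree g \<le> n" for g :: "'a poly"
    using that by (auto simp: poly_eq_iff nth_default_def coeff_eq_0 simp del: upt_Suc)
  thus "{g :: 'a poly. degree g \<le> n} \<subseteq> Poly ` {xs. set xs \<subseteq> UNIV \<and> length xs = Suc n}" by fastforce
  show "finite (Poly ` {xs :: 'a list. set xs \<subseteq> UNIV \<and> length xs = Suc n})"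
    by (intro finite_imageI finite_lists_length_eq) simp
qed

lemma generic_element_exists:
  "\<exists>\<theta> :: 'a::{field,finite} alg_closure. \<forall>g. degree g \<le> n \<longrightarrow> poly (map_poly to_ac g) \<theta> = 0 \<longrightarrow> g = 0"
proof -
  let ?G = "{g :: 'a poly. degree g \<le> n} - {0}"
  let ?Z = "\<Union>g\<in>?G. {x. poly (map_poly to_ac g) x = 0}"
  have "map_poly to_ac g \<noteq> 0" if "g \<noteq> 0" for g :: "'a poly"
    using that by (metis coeff_map_poly leading_coeff_0_iff coeff_0 to_ac_0 to_ac_eq_0_iff)
  hence "finite ?Z" using finite_polys_of_bounded_degree[where 'a='a, of n] by (auto intro!: poly_roots_finite)
  then obtain \<theta> where "\<theta> \<notin> ?Z" using infinite_alg_closure ex_new_if_finite by blast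
  thus ?thesis by (intro exI[of _ \<theta>]) auto
qed

lemma line_form_swap: "line_form q q' = - line_form q' q"
  by (cases q; cases q') simp

lemma line_form_self [simp]: "line_form q q = 0"
  by (cases q) simp

text \<open>Two affine maps that preserve orthogonality between one another: the form of a red and a blue image is
  \<open>\<theta>\<^sup>3\<close> times the original form. For generic \<open>\<theta>\<close> no two distinct
  points over the ground field have orthogonal images under the same map, since the form of the images is a
  nonzero polynomial in \<open>\<theta>\<close> of degree at most 6.\<close>
fun red :: "'a::field alg_closure \<Rightarrow> 'a line \<Rightarrow> 'a alg_closure line" where
  "red \<theta> (s, a, c) = (to_ac s, to_ac a, \<theta> * to_ac s + \<theta> ^ 2 * to_ac a + \<theta> ^ 3 * to_ac c)"
fun blue :: "'a::field alg_closure \<Rightarrow> 'a line \<Rightarrow> 'a alg_closure line" where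
  "blue \<theta> (s, a, c) = (\<theta> ^ 3 * to_ac s + \<theta> ^ 2, \<theta> ^ 3 * to_ac a - \<theta>, \<theta> ^ 3 * to_ac c)"

lemma line_form_red_blue: "line_form (red \<theta> q) (blue \<theta> q') = \<theta> ^ 3 * to_ac (line_form q q')"
  by (cases q; cases q') (simp add: algebra_simps power2_eq_square power3_eq_cube)

lemma to_ac_poly_eval:
  "poly (map_poly to_ac [:c0, c1, c2, c3, c4, c5, c6:]) \<theta> =
    to_ac c0 + \<theta> * (to_ac c1 + \<theta> * (to_ac c2 + \<theta> * (to_ac c3 + \<theta> * (to_ac c4 + \<theta> * (to_ac c5 + \<theta> * to_ac c6)))))"
  by (simp add: Polynomial.map_poly_pCons)

context
  fixes \<theta> :: "'a::{field,finite} alg_closure"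
  assumes gen: "\<And>g. degree g \<le> 6 \<Longrightarrow> poly (map_poly to_ac g) \<theta> = 0 \<Longrightarrow> g = 0"
begin

lemma generic_coeffs:
  assumes "to_ac c0 + \<theta> * (to_ac c1 + \<theta> * (to_ac c2 + \<theta> * (to_ac c3 + \<theta> * (to_ac c4 + \<theta> * (to_ac c5 + \<theta> * to_ac c6))))) = 0"
  shows "c0 = 0 \<and> c1 = 0 \<and> c2 = 0 \<and> c3 = 0 \<and> c4 = 0 \<and> c5 = 0 \<and> c6 = 0"
proof -
  have "[:c0, c1, c2, c3, c4, c5, c6:] = 0"
  proof (rule gen)
    show "poly (map_poly to_ac [:c0, c1, c2, c3, c4, c5, c6:]) \<theta> = 0" unfolding to_ac_poly_eval by (rule assms)
  qed simp
  thus ?thesis by simp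
qed

lemma generic_nonzero: "\<theta> \<noteq> 0"
proof
  assume "\<theta> = 0"
  thus False using generic_coeffs[of 0 1 0 0 0 0 0] by simp
qed

lemma red_skew: "line_form (red \<theta> q) (red \<theta> q') = 0 \<Longrightarrow> q = q'"
proof -
  assume z: "line_form (red \<theta> q) (red \<theta> q') = 0"
  obtain s a c s' a' c' where q: "q = (s, a, c)" "q' = (s', a', c')" by (cases q; cases q')
  have "to_ac (s * a' - a * s') + \<theta> * (to_ac (s - s') + \<theta> * (to_ac (a - a') + \<theta> * (to_ac (c - c') + \<theta> * (to_ac 0 + \<theta> * (to_ac 0 + \<theta> * to_ac 0))))) =
      line_form (red \<theta> q) (red \<theta> q')"
    by (simp add: q algebra_simps power2_eq_square power3_eq_cube)
  from generic_coeffs[OF this[unfolded z]] show ?thesis by (simp add: q)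
qed

lemma blue_skew: "line_form (blue \<theta> q) (blue \<theta> q') = 0 \<Longrightarrow> q = q'"
proof -
  assume z: "line_form (blue \<theta> q) (blue \<theta> q') = 0"
  obtain s a c s' a' c' where q: "q = (s, a, c)" "q' = (s', a', c')" by (cases q; cases q')
  have "to_ac 0 + \<theta> * (to_ac 0 + \<theta> * (to_ac 0 + \<theta> * (to_ac (c - c') + \<theta> * (to_ac (s' - s) + \<theta> * (to_ac (a' - a) + \<theta> * to_ac (s * a' - a * s')))))) =
      line_form (blue \<theta> q) (blue \<theta> q')"
    by (simp add: q algebra_simps power2_eq_square power3_eq_cube)
  from generic_coeffs[OF this[unfolded z]] show ?thesis by (simp add: q)
qed

lemma red_line_u: "line_u (red \<theta> q) = line_u (red \<theta> q') \<Longrightarrow> q = q'"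
proof -
  assume z: "line_u (red \<theta> q) = line_u (red \<theta> q')"
  obtain s a c s' a' c' where q: "q = (s, a, c)" "q' = (s', a', c')" by (cases q; cases q')
  have "to_ac (s' * a' - s * a) + \<theta> * (to_ac (s' - s) + \<theta> * (to_ac (a' - a) + \<theta> * (to_ac (c' - c) + \<theta> * (to_ac 0 + \<theta> * (to_ac 0 + \<theta> * to_ac 0))))) = 0"
    using z by (simp add: q algebra_simps power2_eq_square power3_eq_cube)
  from generic_coeffs[OF this] show ?thesis by (simp add: q)
qed

lemma blue_line_u: "line_u (blue \<theta> q) = line_u (blue \<theta> q') \<Longrightarrow> q = q'"
proof -
  assume z: "line_u (blue \<theta> q) = line_u (blue \<theta> q')"
  obtain s a c s' a' c' where q: "q = (s, a, c)" "q' = (s', a', c')" by (cases q; cases q')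
  have "to_ac 0 + \<theta> * (to_ac 0 + \<theta> * (to_ac 0 + \<theta> * (to_ac (c' - c) + \<theta> * (to_ac (s - s') + \<theta> * (to_ac (a' - a) + \<theta> * to_ac (s' * a' - s * a)))))) = 0"
    using z by (simp add: q algebra_simps power2_eq_square power3_eq_cube)
  from generic_coeffs[OF this] show ?thesis by (simp add: q)
qed

lemma red_blue_slopes: "slope (red \<theta> q) \<noteq> slope (blue \<theta> q')"
proof
  assume z: "slope (red \<theta> q) = slope (blue \<theta> q')"
  obtain s a c s' a' c' where q: "q = (s, a, c)" "q' = (s', a', c')" by (cases q; cases q')
  have "to_ac s + \<theta> * (to_ac 0 + \<theta> * (to_ac (-1) + \<theta> * (to_ac (-s') + \<theta> * (to_ac 0 + \<theta> * (to_ac 0 + \<theta> * to_ac 0))))) = 0"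
    using z by (simp add: q algebra_simps power2_eq_square power3_eq_cube)
  from generic_coeffs[OF this] show False by simp
qed

lemma line_form_red_blue_0: "line_form (red \<theta> q) (blue \<theta> q') = 0 \<longleftrightarrow> line_form q q' = 0"
  by (simp add: line_form_red_blue generic_nonzero)

end

text \<open>The two colours may have to be exchanged, since the crossing bound assumes that the second family is the larger
  one; hence the abstract embeddings \<open>\<phi>\<close> and \<open>\<psi>\<close>.\<close>
lemma degree_le_via_embedding:
  fixes Xr :: "'x set" and Yb :: "'y set" and \<phi> :: "'x \<Rightarrow> 'a::{field,finite} alg_closure line"
    and \<psi> :: "'y \<Rightarrow> 'a alg_closure line"
  assumes char: "\<And>n. 0 < n \<Longrightarrow> n < p \<Longrightarrow> of_nat n \<noteq> (0::'a)" and p: "27 * card Xr < p\<^sup>2"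
    and fin: "finite Xr" "finite Yb" and le: "card Xr \<le> card Yb" and ne: "Yb \<noteq> {}"
    and G: "\<And>b. b \<in> Yb \<Longrightarrow> G b \<subseteq> Xr \<and> D \<le> card (G b)"
    and orth: "\<And>b r. b \<in> Yb \<Longrightarrow> r \<in> G b \<Longrightarrow> orth r b"
    and few: "\<And>b b'. b \<in> Yb \<Longrightarrow> b' \<in> Yb \<Longrightarrow> b \<noteq> b' \<Longrightarrow> card {r \<in> G b. orth r b'} \<le> k"
    and skew: "\<And>r r'. line_form (\<phi> r) (\<phi> r') = 0 \<Longrightarrow> r = r'"
    and inj: "\<And>b b'. line_u (\<psi> b) = line_u (\<psi> b') \<Longrightarrow> b = b'"
    and slopes: "\<And>b r. slope (\<psi> b) \<noteq> slope (\<phi> r)"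
    and form: "\<And>b r. line_form (\<psi> b) (\<phi> r) = 0 \<longleftrightarrow> orth r b"
  shows "real D \<le> 20000 * (sqrt (card Xr) + k)"
proof -
  have inj\<phi>: "inj \<phi>" by (rule injI, rule skew) simp
  have inj\<psi>: "inj \<psi>" by (rule injI, rule inj) simp
  have card\<phi>: "card (\<phi> ` A) = card A" for A by (rule card_image) (rule inj_on_subset[OF inj\<phi> subset_UNIV])
  have card\<psi>: "card (\<psi> ` A) = card A" for A by (rule card_image) (rule inj_on_subset[OF inj\<psi> subset_UNIV])
  define N where "N = (\<lambda>l. \<phi> ` G (inv_into UNIV \<psi> l))"
  have N: "N (\<psi> b) = \<phi> ` G b" for b using inj\<psi> by (simp add: N_def)
  have "real D \<le> 20000 * (sqrt (card (\<phi> ` Xr)) + k)"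
  proof (rule crossing_degree_le[where B = "\<psi> ` Yb" and N = N and p = p])
    show "infinite (UNIV :: 'a alg_closure set)" by (rule infinite_alg_closure)
    show "of_nat n \<noteq> (0 :: 'a alg_closure)" if "0 < n" "n < p" for n
      using char[OF that] by (metis to_ac_eq_0_iff to_ac_of_nat)
    show "27 * card (\<phi> ` Xr) < p\<^sup>2" "card (\<phi> ` Xr) \<le> card (\<psi> ` Yb)" using p le card\<phi> card\<psi> by auto
    show "inj_on line_u (\<psi> ` Yb)" by (rule inj_onI) (use inj in blast)
    fix b assume "b \<in> \<psi> ` Yb"
    then obtain y where y: "b = \<psi> y" "y \<in> Yb" by blast
    show "N b \<subseteq> \<phi> ` Xr \<and> D \<le> card (N b)" using G[OF y(2)] unfolding y(1) N card\<phi> by blast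
    show "meets b r" if r: "r \<in> N b" for r
    proof -
      obtain x where "r = \<phi> x" "x \<in> G y" using r unfolding y(1) N by blast
      thus ?thesis using orth[OF y(2)] form slopes unfolding meets_def y(1) by metis
    qed
    fix b' assume b': "b' \<in> \<psi> ` Yb" "b \<noteq> b'"
    then obtain y' where y': "b' = \<psi> y'" "y' \<in> Yb" "y \<noteq> y'" using y by blast
    have "{r \<in> N b. line_form b' r = 0} = \<phi> ` {r \<in> G y. orth r y'}"
      unfolding N y(1) y'(1) form[symmetric] by blast
    thus "card {r \<in> N b. line_form b' r = 0} \<le> k" using few[OF y(2) y'(2,3)] by (simp add: card\<phi>)
  next
    show "line_form r r' \<noteq> 0" if "r \<in> \<phi> ` Xr" "r' \<in> \<phi> ` Xr" "r \<noteq> r'" for r r' using that skew by blast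
  qed (use ne fin in auto)
  thus ?thesis by (simp add: card\<phi>)
qed

lemma finite_set_maximizer:
  fixes \<Phi> :: "'x \<Rightarrow> 'y::linorder"
  assumes "finite A" "A \<noteq> {}" shows "\<exists>z\<in>A. \<forall>w\<in>A. \<Phi> w \<le> \<Phi> z"
proof -
  have "Max (\<Phi> ` A) \<in> \<Phi> ` A" using assms by (intro Max_in) auto
  then obtain z where "z \<in> A" "\<Phi> z = Max (\<Phi> ` A)" by auto
  thus ?thesis using assms by (intro bexI[of _ z]) auto
qed

text \<open>A pair of vertex sets that maximises the number of edges minus \<open>D\<close> times the number of vertices has
  minimal degree at least \<open>D\<close>: the removal of a vertex of smaller degree would increase the
  difference.\<close>
lemma min_degree_subgraph:
  fixes E :: "('x \<times> 'y) set"
  assumes fin: "finite T" "finite U" and E: "E \<subseteq> T \<times> U" and big: "D * (card T + card U) < card E"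
  shows "\<exists>Xr\<subseteq>T. \<exists>Yb\<subseteq>U. Xr \<noteq> {} \<and> Yb \<noteq> {} \<and> (\<forall>x\<in>Xr. D \<le> card {y \<in> Yb. (x, y) \<in> E}) \<and>
    (\<forall>y\<in>Yb. D \<le> card {x \<in> Xr. (x, y) \<in> E})"
proof -
  define \<Phi> where "\<Phi> = (\<lambda>(Xr, Yb). int (card (E \<inter> Xr \<times> Yb)) - int D * (int (card Xr) + int (card Yb)))"
  have finE: "finite E" using E fin finite_subset by blast
  define A where "A = Pow T \<times> Pow U"
  have "finite A" "A \<noteq> {}" using fin by (auto simp: A_def)
  then obtain Z where Z: "Z \<in> A" "\<And>W. W \<in> A \<Longrightarrow> \<Phi> W \<le> \<Phi> Z"
    using finite_set_maximizer[of A \<Phi>] by blast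
  obtain Xr Yb where XYs: "Z = (Xr, Yb)" by (cases Z)
  have sub: "Xr \<subseteq> T" "Yb \<subseteq> U" using Z(1) by (auto simp: XYs A_def)
  have finXYs: "finite Xr" "finite Yb" using sub fin finite_subset by auto
  have "E \<inter> T \<times> U = E" using E by blast
  hence "\<Phi> (T, U) = int (card E) - int (D * (card T + card U))" by (simp add: \<Phi>_def algebra_simps)
  hence "\<Phi> (T, U) > 0" using big by (metis diff_gt_0_iff_gt of_nat_less_iff)
  hence pos: "\<Phi> (Xr, Yb) > 0" using Z(2)[of "(T, U)"] unfolding XYs A_def by fastforce
  have ne: "Xr \<noteq> {}" "Yb \<noteq> {}"
  proof -
    have "E \<inter> Xr \<times> Yb \<noteq> {}"
    proof
      assume "E \<inter> Xr \<times> Yb = {}"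
      hence "\<Phi> (Xr, Yb) \<le> 0" by (simp add: \<Phi>_def)
      thus False using pos by simp
    qed
    thus "Xr \<noteq> {}" "Yb \<noteq> {}" by auto
  qed
  have "D \<le> card {y \<in> Yb. (x, y) \<in> E}" if x: "x \<in> Xr" for x
  proof -
    have "E \<inter> Xr \<times> Yb = (E \<inter> (Xr - {x}) \<times> Yb) \<union> Pair x ` {y \<in> Yb. (x, y) \<in> E}" using x by auto
    hence "card (E \<inter> Xr \<times> Yb) \<le> card (E \<inter> (Xr - {x}) \<times> Yb) + card (Pair x ` {y \<in> Yb. (x, y) \<in> E})"
      by (simp add: card_Un_le)
    also have "card (Pair x ` {y \<in> Yb. (x, y) \<in> E}) \<le> card {y \<in> Yb. (x, y) \<in> E}"
      using finXYs by (intro card_image_le) auto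
    finally have 1: "card (E \<inter> Xr \<times> Yb) \<le> card (E \<inter> (Xr - {x}) \<times> Yb) + card {y \<in> Yb. (x, y) \<in> E}" by simp
    have "\<Phi> (Xr - {x}, Yb) \<le> \<Phi> (Xr, Yb)" using Z(2)[of "(Xr - {x}, Yb)"] sub by (auto simp: XYs A_def)
    moreover have "int (card Xr) = int (card (Xr - {x})) + 1" using card_Suc_Diff1[OF finXYs(1) x] by linarith
    ultimately have "int D \<le> int (card (E \<inter> Xr \<times> Yb)) - int (card (E \<inter> (Xr - {x}) \<times> Yb))"
      by (simp add: \<Phi>_def algebra_simps)
    thus ?thesis using 1 by linarith
  qed
  moreover have "D \<le> card {x \<in> Xr. (x, y) \<in> E}" if y: "y \<in> Yb" for y
  proof -
    have "E \<inter> Xr \<times> Yb = (E \<inter> Xr \<times> (Yb - {y})) \<union> (\<lambda>x. (x, y)) ` {x \<in> Xr. (x, y) \<in> E}" using y by auto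
    hence "card (E \<inter> Xr \<times> Yb) \<le> card (E \<inter> Xr \<times> (Yb - {y})) + card ((\<lambda>x. (x, y)) ` {x \<in> Xr. (x, y) \<in> E})"
      by (simp add: card_Un_le)
    also have "card ((\<lambda>x. (x, y)) ` {x \<in> Xr. (x, y) \<in> E}) \<le> card {x \<in> Xr. (x, y) \<in> E}"
      using finXYs by (intro card_image_le) auto
    finally have 1: "card (E \<inter> Xr \<times> Yb) \<le> card (E \<inter> Xr \<times> (Yb - {y})) + card {x \<in> Xr. (x, y) \<in> E}" by simp
    have "\<Phi> (Xr, Yb - {y}) \<le> \<Phi> (Xr, Yb)" using Z(2)[of "(Xr, Yb - {y})"] sub by (auto simp: XYs A_def)
    moreover have "int (card Yb) = int (card (Yb - {y})) + 1" using card_Suc_Diff1[OF finXYs(2) y] by linarith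
    ultimately have "int D \<le> int (card (E \<inter> Xr \<times> Yb)) - int (card (E \<inter> Xr \<times> (Yb - {y})))"
      by (simp add: \<Phi>_def algebra_simps)
    thus ?thesis using 1 by linarith
  qed
  ultimately show ?thesis using sub ne by blast
qed

text \<open>If there were more pairs, a bipartite subgraph of minimal degree larger than the bound for crossings would
  exist. Its smaller side plays the role of the family from which the sample is drawn.\<close>
theorem null_pairs_card:
  fixes T :: "'a::{field,finite} line set"
  assumes char: "\<And>n. 0 < n \<Longrightarrow> n < p \<Longrightarrow> of_nat n \<noteq> (0::'a)" and p: "27 * card T < p\<^sup>2"
    and E: "E \<subseteq> T \<times> T" and orth: "\<And>q q'. (q, q') \<in> E \<Longrightarrow> line_form q q' = 0"
    and sym: "\<And>q q'. (q, q') \<in> E \<Longrightarrow> (q', q) \<in> E"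
    and few: "\<And>b b'. b \<in> T \<Longrightarrow> b' \<in> T \<Longrightarrow> b \<noteq> b' \<Longrightarrow> card {r. (r, b) \<in> E \<and> line_form r b' = 0} \<le> k"
  shows "real (card E) \<le> 100000 * card T * (sqrt (card T) + k)"
proof (cases "T = {}")
  case True
  thus ?thesis using E by simp
next
  case False
  obtain \<theta> :: "'a alg_closure" where gen: "\<And>g. degree g \<le> 6 \<Longrightarrow> poly (map_poly to_ac g) \<theta> = 0 \<Longrightarrow> g = 0"
    using generic_element_exists[of 6] by blast
  note \<theta> = red_skew[of \<theta>] blue_skew[of \<theta>] red_line_u[of \<theta>] blue_line_u[of \<theta>] red_blue_slopes[of \<theta>]
    line_form_red_blue_0[of \<theta>]
  let ?M = "card T"
  have M: "real ?M \<ge> 1" using False by (simp add: Suc_leI card_gt_0_iff)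
  define D where "D = nat \<lfloor>20000 * (sqrt ?M + k)\<rfloor> + 1"
  have D1: "real D > 20000 * (sqrt ?M + k)" unfolding D_def by (simp add: add.commute) linarith
  have D2: "real D \<le> 20000 * (sqrt ?M + k) + 1" unfolding D_def by simp
  have "card E \<le> D * (?M + ?M)"
  proof (rule ccontr)
    assume "\<not> ?thesis"
    then obtain Xr Yb where XYs: "Xr \<subseteq> T" "Yb \<subseteq> T" "Xr \<noteq> {}" "Yb \<noteq> {}"
      "\<And>x. x \<in> Xr \<Longrightarrow> D \<le> card {y \<in> Yb. (x, y) \<in> E}" "\<And>y. y \<in> Yb \<Longrightarrow> D \<le> card {x \<in> Xr. (x, y) \<in> E}"
      using min_degree_subgraph[OF _ _ E, of D] unfolding not_le by (smt (verit, best) finite)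
    have finE: "finite {r. (r, b) \<in> E \<and> P r}" for b P by simp
    have cXr: "card Xr \<le> ?M" and cY: "card Yb \<le> ?M" using XYs by (auto intro: card_mono)
    have "\<exists>m\<le>?M. real D \<le> 20000 * (sqrt m + k)"
    proof (cases "card Xr \<le> card Yb")
      case True
      have "real D \<le> 20000 * (sqrt (card Xr) + k)"
      proof (rule degree_le_via_embedding[OF char _ finite finite True XYs(4), where orth = "\<lambda>r b. line_form r b = 0" and G = "\<lambda>b. {r \<in> Xr. (r, b) \<in> E}" and \<phi> = "red \<theta>" and \<psi> = "blue \<theta>"])
        show "27 * card Xr < p\<^sup>2" using cXr p by simp
        show "card {r \<in> {r \<in> Xr. (r, b) \<in> E}. line_form r b' = 0} \<le> k" if "b \<in> Yb" "b' \<in> Yb" "b \<noteq> b'" for b b'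
          by (rule order.trans[OF card_mono[OF finE] few[of b b']]) (use that XYs in blast)+
        show "line_form (blue \<theta> b) (red \<theta> r) = 0 \<longleftrightarrow> line_form r b = 0" for b r
          using \<theta>(6)[OF gen] line_form_swap[of "blue \<theta> b" "red \<theta> r"] by simp
        show "slope (blue \<theta> b) \<noteq> slope (red \<theta> r)" for b r using \<theta>(5)[OF gen] by metis
      qed (use XYs orth \<theta>(1)[OF gen] \<theta>(4)[OF gen] in blast)+
      thus ?thesis using cXr by blast
    next
      case False
      hence le: "card Yb \<le> card Xr" by simp
      have "real D \<le> 20000 * (sqrt (card Yb) + k)"
      proof (rule degree_le_via_embedding[OF char _ finite finite le XYs(3), where orth = "\<lambda>r b. line_form r b = 0" and G = "\<lambda>x. {y \<in> Yb. (x, y) \<in> E}" and \<phi> = "blue \<theta>" and \<psi> = "red \<theta>"])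
        show "27 * card Yb < p\<^sup>2" using cY p by simp
        show "card {r \<in> {y \<in> Yb. (b, y) \<in> E}. line_form r b' = 0} \<le> k" if "b \<in> Xr" "b' \<in> Xr" "b \<noteq> b'" for b b'
          by (rule order.trans[OF card_mono[OF finE] few[of b b']]) (use that XYs sym in blast)+
        show "line_form (red \<theta> b) (blue \<theta> r) = 0 \<longleftrightarrow> line_form r b = 0" for b r
          using \<theta>(6)[OF gen] line_form_swap[of b r] by simp
        show "line_form r b = 0" if "b \<in> Xr" "r \<in> {y \<in> Yb. (b, y) \<in> E}" for b r using that orth[OF sym] by blast
      qed (use XYs \<theta>(2)[OF gen] \<theta>(3)[OF gen] \<theta>(5)[OF gen] in blast)+
      thus ?thesis using cY by blast
    qed
    then obtain m where m: "m \<le> ?M" "real D \<le> 20000 * (sqrt m + k)" by blast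
    have "sqrt m \<le> sqrt ?M" using m(1) by simp
    hence "20000 * (sqrt m + k) \<le> 20000 * (sqrt ?M + k)" by simp
    thus False using D1 m(2) by (meson leD order.trans)
  qed
  hence "real (card E) \<le> real D * (2 * ?M)" by (metis mult_2 of_nat_le_iff of_nat_mult of_nat_numeral)
  also have "\<dots> \<le> (20000 * (sqrt ?M + k) + 1) * (2 * ?M)" using D2 by (intro mult_right_mono) auto
  also have "\<dots> \<le> (50000 * (sqrt ?M + k)) * (2 * ?M)"
  proof (intro mult_right_mono)
    have "sqrt ?M \<ge> 1" using M by simp
    moreover have "real k \<ge> 0" by simp
    ultimately show "20000 * (sqrt ?M + k) + 1 \<le> 50000 * (sqrt ?M + k)" unfolding distrib_left by linarith
  qed auto
  finally show ?thesis by (simp add: algebra_simps)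
qed

section \<open>Incidences of lines with a Cartesian product\<close>

lemma square_sum_le_card_mult_sum_squares:
  fixes f :: "'x \<Rightarrow> real"
  assumes "finite A"
  shows "(\<Sum>x\<in>A. f x) ^ 2 \<le> card A * (\<Sum>x\<in>A. f x ^ 2)"
proof (cases "A = {}")
  case False
  define m where "m = (\<Sum>x\<in>A. f x) / card A"
  have n: "real (card A) > 0" using False assms by (simp add: card_gt_0_iff)
  have S: "(\<Sum>x\<in>A. f x) = card A * m" using n by (simp add: m_def)
  have "0 \<le> (\<Sum>x\<in>A. (f x - m) ^ 2)" by (intro sum_nonneg) simp
  also have "\<dots> = (\<Sum>x\<in>A. f x ^ 2) - 2 * m * (\<Sum>x\<in>A. f x) + card A * m ^ 2"
  proof -
    have "(f x - m) ^ 2 = f x ^ 2 - 2 * m * f x + m ^ 2" for x by (simp add: power2_eq_square algebra_simps)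
    thus ?thesis by (simp add: sum.distrib sum_subtractf sum_distrib_left)
  qed
  also have "\<dots> = (\<Sum>x\<in>A. f x ^ 2) - card A * m ^ 2" by (simp add: S power2_eq_square algebra_simps)
  finally have "card A * (card A * m ^ 2) \<le> card A * (\<Sum>x\<in>A. f x ^ 2)" by (intro mult_left_mono) auto
  thus ?thesis by (simp add: S power_mult_distrib power2_eq_square mult_ac)
qed simp

lemma card_pairs_same_value:
  assumes "finite A" "finite Ys" "\<And>t. t \<in> A \<Longrightarrow> v t \<in> Ys"
  shows "card A ^ 2 \<le> card Ys * card {(t, t'). t \<in> A \<and> t' \<in> A \<and> v t = v t'}"
proof -
  define n where "n = (\<lambda>y. card {t \<in> A. v t = y})"
  have A: "A = (\<Union>y\<in>Ys. {t \<in> A. v t = y})" using assms(3) by blast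
  have cA: "card A = (\<Sum>y\<in>Ys. n y)" unfolding n_def
    by (subst A, rule card_UN_disjoint) (use assms in auto)
  have "{(t, t'). t \<in> A \<and> t' \<in> A \<and> v t = v t'} = (\<Union>y\<in>Ys. {t \<in> A. v t = y} \<times> {t \<in> A. v t = y})"
    using assms(3) by auto
  hence "card {(t, t'). t \<in> A \<and> t' \<in> A \<and> v t = v t'} = (\<Sum>y\<in>Ys. card ({t \<in> A. v t = y} \<times> {t \<in> A. v t = y}))"
    by (simp only:) (rule card_UN_disjoint, use assms in auto)
  also have "\<dots> = (\<Sum>y\<in>Ys. n y ^ 2)" by (simp add: n_def card_cartesian_product power2_eq_square)
  finally have N: "card {(t, t'). t \<in> A \<and> t' \<in> A \<and> v t = v t'} = (\<Sum>y\<in>Ys. n y ^ 2)" .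
  have "(\<Sum>y\<in>Ys. real (n y)) ^ 2 \<le> card Ys * (\<Sum>y\<in>Ys. real (n y) ^ 2)"
    by (rule square_sum_le_card_mult_sum_squares[OF assms(2)])
  hence "real ((\<Sum>y\<in>Ys. n y) ^ 2) \<le> real (card Ys * (\<Sum>y\<in>Ys. n y ^ 2))" by simp
  hence "(\<Sum>y\<in>Ys. n y) ^ 2 \<le> card Ys * (\<Sum>y\<in>Ys. n y ^ 2)" by (simp only: of_nat_le_iff)
  thus ?thesis by (simp add: cA N)
qed

text \<open>The line \<open>y = s x + c\<close> is the pair \<open>(s, c)\<close>. Two incidences on the same row,
  \<open>s x + c = s' x' + c'\<close>, say that the points \<open>(s, x', c)\<close> and
  \<open>(s', x, c')\<close> of three-space are orthogonal for the symplectic form. By the Cauchy-Schwarz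
  inequality the square of the number of incidences is at most \<open>h\<close> times the number of such pairs.
  Two points have few common partners because their partners correspond either to different columns or to lines
  through one point.\<close>
theorem cartesian_incidences:
  fixes Ps L :: "('a::{field,finite} \<times> 'a) set"
  assumes char: "\<And>n. 0 < n \<Longrightarrow> n < p \<Longrightarrow> of_nat n \<noteq> (0::'a)"
    and p: "27 * (h * card L) < p\<^sup>2"
    and Ps: "Ps \<subseteq> Xs \<times> Ys" and h: "card Xs \<le> h" "card Ys \<le> h"
    and pencil: "\<And>x y. (x, y) \<in> Ps \<Longrightarrow> card {(s, c). (s, c) \<in> L \<and> y = s * x + c} \<le> h"
  shows "real (card {((x, y), (s, c)). (x, y) \<in> Ps \<and> (s, c) \<in> L \<and> y = s * x + c}) ^ 2
    \<le> 100000 * h * (h * card L) * (sqrt (h * card L) + h)"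
proof -
  let ?I = "{((x, y), (s, c)). (x, y) \<in> Ps \<and> (s, c) \<in> L \<and> y = s * x + c}"
  define v where "v = (\<lambda>((x::'a, y::'a), (s::'a, c::'a)). y)"
  define NN where "NN = {(t, t'). t \<in> ?I \<and> t' \<in> ?I \<and> v t = v t'}"
  define T where "T = {(s, a, c). (s, c) \<in> L \<and> a \<in> Xs}"
  define f where "f = (\<lambda>(((x::'a, y::'a), (s::'a, c::'a)), ((x'::'a, y'::'a), (s'::'a, c'::'a))). ((s, x', c), (s', x, c')))"
  define E where "E = {((s, x', c), (s', x, c')). (s, c) \<in> L \<and> (s', c') \<in> L \<and>
      (x, s * x + c) \<in> Ps \<and> (x', s' * x' + c') \<in> Ps \<and> s * x + c = s' * x' + c'}"
  have EI: "((s, x', c), (s', x, c')) \<in> E \<longleftrightarrow> (s, c) \<in> L \<and> (s', c') \<in> L \<and>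
      (x, s * x + c) \<in> Ps \<and> (x', s' * x' + c') \<in> Ps \<and> s * x + c = s' * x' + c'" for s x' c s' x c'
    by (simp add: E_def)
  have "card ?I ^ 2 \<le> card Ys * card NN"
    unfolding NN_def by (rule card_pairs_same_value) (use Ps in \<open>auto simp: v_def\<close>)
  moreover have "card NN \<le> card E"
  proof (rule card_inj_on_le)
    show "inj_on f NN" by (rule inj_onI) (clarsimp simp: f_def NN_def v_def)
    show "f ` NN \<subseteq> E" by (rule image_subsetI) (clarsimp simp: f_def NN_def v_def EI)
  qed simp
  ultimately have I2: "card ?I ^ 2 \<le> h * card E" using h(2) mult_mono[of "card Ys" h "card NN" "card E"] by linarith
  have cT: "card T = card L * card Xs"
  proof -
    have "T = (\<lambda>((s, c), a). (s, a, c)) ` (L \<times> Xs)" unfolding T_def by force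
    moreover have "inj_on (\<lambda>((s::'a, c::'a), a::'a). (s, a, c)) (L \<times> Xs)" by (auto simp: inj_on_def)
    ultimately show ?thesis by (simp add: card_image card_cartesian_product)
  qed
  have cTh: "card T \<le> h * card L" unfolding cT using h(1) by (simp add: mult.commute)
  have "real (card E) \<le> 100000 * card T * (sqrt (card T) + h)"
  proof (rule null_pairs_card[OF char])
    show "27 * card T < p\<^sup>2" using cTh p by simp
    have tr: "\<exists>s x' c s' x c'. q = (s, x', c) \<and> q' = (s', x, c')" for q q' :: "'a line" by (cases q; cases q') auto
    show "E \<subseteq> T \<times> T"
    proof
      fix z assume z: "z \<in> E"
      obtain s x' c s' x c' where zz: "z = ((s, x', c), (s', x, c'))" by (cases z) (use tr in blast)
      show "z \<in> T \<times> T" using z Ps unfolding zz EI T_def by blast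
    qed
    fix q q' assume qq: "(q, q') \<in> E"
    obtain s x' c s' x c' where q: "q = (s, x', c)" "q' = (s', x, c')" using tr by blast
    note e = qq[unfolded q EI]
    show "(q', q) \<in> E" using e unfolding q EI by auto
    show "line_form q q' = 0" using e by (simp add: q algebra_simps)
  next
    fix b b' assume bT: "b \<in> T" "b' \<in> T" and ne: "b \<noteq> b'"
    obtain s1 x1 c1 s2 x2 c2 where b: "b = (s1, x1, c1)" "b' = (s2, x2, c2)" by (cases b; cases b')
    let ?S = "{r. (r, b) \<in> E \<and> line_form r b' = 0}"
    have S: "(s, c) \<in> L \<and> x' \<in> Xs \<and> s * x1 + c = s1 * x' + c1 \<and> (x1, s * x1 + c) \<in> Ps \<and> s * x2 + c = s2 * x' + c2"
      if "(s, x', c) \<in> ?S" for s x' c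
    proof -
      have "s * x2 - x' * s2 + c - c2 = 0" using that by (simp add: b)
      hence "s * x2 + c = s2 * x' + c2" by (simp add: algebra_simps)
      moreover have "(s, c) \<in> L \<and> (x1, s * x1 + c) \<in> Ps \<and> (x', s1 * x' + c1) \<in> Ps \<and> s * x1 + c = s1 * x' + c1"
        using that unfolding b EI mem_Collect_eq by blast
      ultimately show ?thesis using Ps by blast
    qed
    \<comment> \<open>If \<open>x1 \<noteq> x2\<close>, the column \<open>x'\<close> determines two points of the
      line \<open>(s, c)\<close>. If \<open>x1 = x2\<close>, then \<open>x'\<close> is the abscissa
      \<open>x0\<close> at which the lines \<open>(s1, c1)\<close> and \<open>(s2, c2)\<close> cross, and
      \<open>(s, c)\<close> passes through \<open>(x1, y0)\<close>.\<close>
    show "card ?S \<le> h"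
    proof (cases "x1 = x2")
      case False
      have "inj_on (\<lambda>(s, x', c). x') ?S"
      proof (rule inj_onI)
        fix r r' assume r: "r \<in> ?S" "r' \<in> ?S" and eq: "(\<lambda>(s, x', c). x') r = (\<lambda>(s, x', c). x') r'"
        obtain s x' c where rr: "r = (s, x', c)" by (cases r)
        obtain t d where rr': "r' = (t, x', d)" using eq by (cases r') (simp add: rr)
        have 2: "s * x1 + c = t * x1 + d" "s * x2 + c = t * x2 + d"
          using S[of s x' c] S[of t x' d] r unfolding rr rr' by auto
        have "(s - t) * (x1 - x2) = (s * x1 + c) - (t * x1 + d) - ((s * x2 + c) - (t * x2 + d))"
          by (simp add: algebra_simps)
        hence "(s - t) * (x1 - x2) = 0" using 2 by simp
        hence "s = t" using False by simp
        thus "r = r'" using 2(1) by (simp add: rr rr')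
      qed
      hence "card ?S \<le> card Xs" by (rule card_inj_on_le) (use S in auto)
      thus ?thesis using h(1) by simp
    next
      case True
      have sne: "s1 \<noteq> s2" if "r \<in> ?S" for r
      proof
        assume e: "s1 = s2"
        obtain s x' c where r: "r = (s, x', c)" by (cases r)
        have "s1 * x' + c1 = s2 * x' + c2" using S[of s x' c] that True unfolding r by auto
        hence "c1 = c2" using e by simp
        thus False using ne b True e by simp
      qed
      define x0 where "x0 = (c2 - c1) / (s1 - s2)"
      define y0 where "y0 = s1 * x0 + c1"
      have x0: "x' = x0" if "(s, x', c) \<in> ?S" for s x' c
      proof -
        have "s1 * x' + c1 = s2 * x' + c2" using S[OF that] True by metis
        hence "(s1 - s2) * x' = c2 - c1" by (simp add: algebra_simps)
        thus ?thesis using sne[OF that] by (simp add: x0_def field_simps)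
      qed
      show ?thesis
      proof (cases "?S = {}")
        case False
        then obtain r where "r \<in> ?S" by blast
        moreover obtain s x' c where "r = (s, x', c)" by (cases r)
        ultimately have e: "(s, x', c) \<in> ?S" by simp
        have "(x1, y0) \<in> Ps" using S[OF e] x0[OF e] unfolding y0_def by metis
        hence pen: "card {(s, c). (s, c) \<in> L \<and> y0 = s * x1 + c} \<le> h" by (rule pencil)
        have "card ?S \<le> card {(s, c). (s, c) \<in> L \<and> y0 = s * x1 + c}"
        proof (rule card_inj_on_le)
          show "inj_on (\<lambda>(s, x', c). (s, c)) ?S"
          proof (rule inj_onI)
            fix r r' assume r: "r \<in> ?S" "r' \<in> ?S" and eq: "(\<lambda>(s, x', c). (s, c)) r = (\<lambda>(s, x', c). (s, c)) r'"
            obtain s x' c where rr: "r = (s, x', c)" by (cases r)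
            obtain z where rr': "r' = (s, z, c)" using eq by (cases r') (simp add: rr)
            show "r = r'" using x0[of s x' c] x0[of s z c] r unfolding rr rr' by simp
          qed
          show "(\<lambda>(s, x', c). (s, c)) ` ?S \<subseteq> {(s, c). (s, c) \<in> L \<and> y0 = s * x1 + c}"
          proof (rule image_subsetI)
            fix r assume r: "r \<in> ?S"
            obtain s x' c where rr: "r = (s, x', c)" by (cases r)
            show "(\<lambda>(s, x', c). (s, c)) r \<in> {(s, c). (s, c) \<in> L \<and> y0 = s * x1 + c}"
              using S[of s x' c] x0[of s x' c] r unfolding rr y0_def by auto
          qed
        qed simp
        thus ?thesis using pen by simp
      next
        case True thus ?thesis by (metis card.empty zero_le)
      qed
    qed
  qed
  also have "\<dots> \<le> (100000 * real (h * card L)) * (sqrt (h * card L) + h)"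
  proof -
    have T: "real (card T) \<le> real (h * card L)" using cTh by (simp only: of_nat_le_iff)
    hence "sqrt (card T) \<le> sqrt (h * card L)" by (simp only: real_sqrt_le_iff)
    hence "(100000 * real (card T)) * (sqrt (card T) + h) \<le> (100000 * real (h * card L)) * (sqrt (h * card L) + h)"
      using T by (intro mult_mono add_mono) auto
    thus ?thesis by simp
  qed
  finally have E: "real (card E) \<le> (100000 * real (h * card L)) * (sqrt (h * card L) + h)" .
  have "real (card ?I) ^ 2 = real (card ?I ^ 2)" by simp
  also have "\<dots> \<le> real (h * card E)" using I2 by (simp only: of_nat_le_iff)
  also have "\<dots> = real h * real (card E)" by simp
  also have "\<dots> \<le> real h * ((100000 * real (h * card L)) * (sqrt (h * card L) + h))" using E by (rule mult_left_mono) simp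
  also have "\<dots> = 100000 * h * (h * card L) * (sqrt (h * card L) + h)" by simp
  finally show ?thesis .
qed

section \<open>Regular subconfigurations of an incidence structure\<close>

definition incidences :: "('x \<Rightarrow> 'y \<Rightarrow> bool) \<Rightarrow> 'x set \<Rightarrow> 'y set \<Rightarrow> nat" where
  "incidences inc P L = (\<Sum>x\<in>P. card {l \<in> L. inc x l})"

lemma incidences_card:
  "finite P \<Longrightarrow> finite L \<Longrightarrow> incidences inc P L = card {(x, l). x \<in> P \<and> l \<in> L \<and> inc x l}"
proof -
  assume fin: "finite P" "finite L"
  have "{(x, l). x \<in> P \<and> l \<in> L \<and> inc x l} = (SIGMA x:P. {l \<in> L. inc x l})" by auto
  thus ?thesis unfolding incidences_def using fin by (simp add: card_SigmaI)
qed

lemma incidences_swap: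
  assumes "finite P" "finite L"
  shows "incidences inc P L = (\<Sum>l\<in>L. card {x \<in> P. inc x l})"
  using sum.swap_restrict[OF assms, of "\<lambda>_ _. 1::nat" inc] by (simp add: incidences_def)

lemma incidences_mono: "finite P' \<Longrightarrow> finite L' \<Longrightarrow> P \<subseteq> P' \<Longrightarrow> L \<subseteq> L' \<Longrightarrow> incidences inc P L \<le> incidences inc P' L'"
proof -
  assume a: "finite P'" "finite L'" "P \<subseteq> P'" "L \<subseteq> L'"
  have "(\<Sum>x\<in>P. card {l \<in> L. inc x l}) \<le> (\<Sum>x\<in>P. card {l \<in> L'. inc x l})"
    using a(2,4) by (intro sum_mono card_mono) auto
  also have "\<dots> \<le> (\<Sum>x\<in>P'. card {l \<in> L'. inc x l})" using a(1,3) by (intro sum_mono2) auto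
  finally show ?thesis by (simp add: incidences_def)
qed

text \<open>In a configuration that maximises \<open>I\<^sup>3 / (card P * card L)\<close> the points of very high
  degree carry a small part of the incidences: they are at most \<open>card P / 8\<^sup>3\<close>, and by
  maximality an \<open>8\<^sup>3\<close>-th part of the points has at most an eighth of the incidences.\<close>
lemma high_degree_incidences:
  assumes fin: "finite P" "finite L" and pos: "incidences inc P L > 0"
    and ext: "\<And>P'. P' \<subseteq> P \<Longrightarrow>
      real (incidences inc P' L) ^ 3 * card P \<le> real (incidences inc P L) ^ 3 * card P'"
  shows "real (incidences inc {x \<in> P. real (card {l \<in> L. inc x l}) > 512 * (incidences inc P L / card P)} L)
    \<le> incidences inc P L / 8"
proof -
  let ?I = "real (incidences inc P L)"
  let ?H = "{x \<in> P. real (card {l \<in> L. inc x l}) > 512 * (?I / card P)}"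
  have a: "real (card P) > 0" using pos fin by (cases "P = {}") (auto simp: incidences_def card_gt_0_iff)
  have "card ?H * (512 * (?I / card P)) = (\<Sum>x\<in>?H. 512 * (?I / card P))" by simp
  also have "\<dots> \<le> (\<Sum>x\<in>?H. real (card {l \<in> L. inc x l}))" by (intro sum_mono) auto
  also have "\<dots> = real (incidences inc ?H L)" by (simp add: incidences_def)
  also have "\<dots> \<le> ?I" using incidences_mono[OF fin, of ?H L inc] by auto
  finally have "real (card ?H) * 512 \<le> card P" using pos a by (simp add: field_simps)
  hence "?I ^ 3 * card ?H \<le> ?I ^ 3 * (card P / 512)" by (intro mult_left_mono) auto
  hence "real (incidences inc ?H L) ^ 3 * card P \<le> (?I / 8) ^ 3 * card P"
    using ext[of ?H] by (simp add: power_divide)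
  hence "real (incidences inc ?H L) ^ 3 \<le> (?I / 8) ^ 3" using a by simp
  thus ?thesis by (subst (asm) power_mono_iff) auto
qed

lemma pair_with_many_common:
  fixes G :: "'x \<Rightarrow> ('q \<times> 'q) set"
  assumes fin: "finite P" "finite Q" and G: "\<And>x. x \<in> P \<Longrightarrow> G x \<subseteq> Q \<times> Q"
    and big: "M * real (card Q) ^ 2 < (\<Sum>x\<in>P. real (card (G x)))"
  shows "\<exists>z\<in>Q \<times> Q. M < real (card {x \<in> P. z \<in> G x})"
proof (rule ccontr)
  assume "\<not> ?thesis"
  hence le: "\<And>z. z \<in> Q \<times> Q \<Longrightarrow> real (card {x \<in> P. z \<in> G x}) \<le> M" by force
  have "(\<Sum>x\<in>P. real (card (G x))) = (\<Sum>x\<in>P. \<Sum>z\<in>{z \<in> Q \<times> Q. z \<in> G x}. 1)"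
  proof (rule sum.cong)
    fix x assume "x \<in> P"
    hence "{z \<in> Q \<times> Q. z \<in> G x} = G x" using G by blast
    thus "real (card (G x)) = (\<Sum>z\<in>{z \<in> Q \<times> Q. z \<in> G x}. 1)" by simp
  qed simp
  also have "\<dots> = (\<Sum>z\<in>Q \<times> Q. \<Sum>x\<in>{x \<in> P. z \<in> G x}. 1)"
    using fin by (intro sum.swap_restrict) auto
  also have "\<dots> \<le> (\<Sum>z\<in>Q \<times> Q. M)" by (intro sum_mono) (use le in auto)
  also have "\<dots> = M * real (card Q) ^ 2" by (simp add: card_cartesian_product power2_eq_square)
  finally show False using big by simp
qed

text \<open>The points of typical degree \<open>\<delta>\<close> are collinear with about
  \<open>\<delta> \<epsilon>\<close> others, hence with about \<open>\<delta>\<^sup>2 \<epsilon>\<^sup>2\<close>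
  pairs \<open>(q1, q2)\<close>, and since \<open>\<delta>\<close> is large, few of these pairs are on the same
  line as the point. So some pair serves many points \<open>x\<close>, which lie on the grid formed by the lines
  through \<open>q1\<close> and the lines through \<open>q2\<close>.\<close>
lemma rich_grid:
  fixes P :: "'x set" and L :: "'y set"
  assumes fin: "finite P" "finite L"
    and ext: "\<And>P' L'. P' \<subseteq> P \<Longrightarrow> L' \<subseteq> L \<Longrightarrow>
      real (incidences inc P' L') ^ 3 * (card P * card L) \<le> real (incidences inc P L) ^ 3 * (card P' * card L')"
    and C4: "\<And>x x' l l'. x \<in> P \<Longrightarrow> x' \<in> P \<Longrightarrow> l \<in> L \<Longrightarrow> l' \<in> L \<Longrightarrow> inc x l \<Longrightarrow> inc x l' \<Longrightarrow> inc x' l \<Longrightarrow> inc x' l' \<Longrightarrow>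
      x = x' \<or> l = l'"
    and \<delta>: "\<delta> = incidences inc P L / card P" "2 ^ 26 \<le> \<delta>" and \<epsilon>: "\<epsilon> = incidences inc P L / card L" "4 \<le> \<epsilon>"
  shows "\<exists>q1 q2 L1 P'. q1 \<in> P \<and> q2 \<in> P \<and> L1 \<subseteq> L \<and> P' \<subseteq> P \<and> q1 \<noteq> q2 \<and>
    (\<forall>x\<in>P'. x \<noteq> q1 \<and> x \<noteq> q2 \<and>
      (\<exists>l1\<in>L1. \<exists>l2\<in>L1. l1 \<noteq> l2 \<and> inc x l1 \<and> inc q1 l1 \<and> inc x l2 \<and> inc q2 l2)) \<and>
    (\<forall>x\<in>insert q1 (insert q2 P'). real (card {l \<in> L1. inc x l}) \<le> 512 * \<delta>) \<and>
    (\<forall>x\<in>P'. \<delta> / 4 \<le> real (card {l \<in> L1. inc x l})) \<and>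
    \<delta> ^ 2 * \<epsilon> ^ 2 \<le> 256 * card P * real (card P')"
proof -
  define I a b where "I = real (incidences inc P L)" and "a = real (card P)" and "b = real (card L)"
  have Ipos: "I > 0"
  proof (rule ccontr)
    assume "\<not> ?thesis"
    hence "I = 0" by (simp add: I_def)
    thus False using \<delta> by (simp add: I_def)
  qed
  have ab: "a > 0" "b > 0" using \<delta> \<epsilon> by (auto simp: a_def b_def intro: ccontr)
  have Ia: "I = a * \<delta>" and Ib: "I = b * \<epsilon>" using ab \<delta>(1) \<epsilon>(1) by (simp_all add: I_def a_def b_def)
  define H where "H = {x \<in> P. real (card {l \<in> L. inc x l}) > 512 * \<delta>}"
  define HL where "HL = {l \<in> L. real (card {x \<in> P. inc x l}) > 512 * \<epsilon>}"
  have cI: "incidences (\<lambda>l x. inc x l) L' P' = incidences inc P' L'" if "P' \<subseteq> P" "L' \<subseteq> L" for P' L'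
  proof -
    have "finite P'" "finite L'" using that fin finite_subset by blast+
    hence "incidences inc P' L' = (\<Sum>l\<in>L'. card {x \<in> P'. inc x l})" by (rule incidences_swap)
    thus ?thesis by (simp add: incidences_def)
  qed
  have IH: "real (incidences inc H L) \<le> I / 8"
    unfolding H_def I_def \<delta>(1)
  proof (rule high_degree_incidences[OF fin])
    show "0 < incidences inc P L" using Ipos by (simp add: I_def)
    show "real (incidences inc P' L) ^ 3 * card P \<le> real (incidences inc P L) ^ 3 * card P'" if "P' \<subseteq> P" for P'
      using ext[OF that subset_refl] ab by (simp add: b_def)
  qed
  have IHL: "real (incidences inc P HL) \<le> I / 8"
  proof -
    have "real (incidences (\<lambda>l x. inc x l) HL P) \<le> incidences (\<lambda>l x. inc x l) L P / 8"
      unfolding HL_def \<epsilon>(1) cI[OF subset_refl subset_refl, symmetric]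
    proof (rule high_degree_incidences[OF fin(2,1)])
      show "0 < incidences (\<lambda>l x. inc x l) L P" using Ipos by (simp add: I_def cI)
      show "real (incidences (\<lambda>l x. inc x l) L' P) ^ 3 * card L \<le> real (incidences (\<lambda>l x. inc x l) L P) ^ 3 * card L'"
        if "L' \<subseteq> L" for L' using ext[OF subset_refl that] ab that by (simp add: a_def cI)
    qed
    thus ?thesis using cI[of P HL] cI[of P L] by (simp add: I_def HL_def)
  qed
  define P1 L1 where "P1 = P - H" and "L1 = L - HL"
  have sub1: "P1 \<subseteq> P" "L1 \<subseteq> L" "finite P1" "finite L1" using fin by (auto simp: P1_def L1_def)
  have dx: "real (card {l \<in> L1. inc x l}) \<le> 512 * \<delta>" if "x \<in> P1" for x
  proof -
    have "card {l \<in> L1. inc x l} \<le> card {l \<in> L. inc x l}" using fin sub1 by (intro card_mono) auto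
    moreover have "real (card {l \<in> L. inc x l}) \<le> 512 * \<delta>" using that by (auto simp: P1_def H_def)
    ultimately show ?thesis by linarith
  qed
  have I1: "3 * I / 4 \<le> incidences inc P1 L1"
  proof -
    have "I = incidences inc H L + incidences inc P1 L"
      unfolding I_def incidences_def P1_def using fin
      by (subst sum.subset_diff[of H P]) (auto simp: H_def)
    moreover have "incidences inc P1 L \<le> incidences inc P1 L1 + incidences inc P1 HL"
    proof -
      have "card {l \<in> L. inc x l} \<le> card {l \<in> L1. inc x l} + card {l \<in> HL. inc x l}" for x
      proof -
        have "{l \<in> L. inc x l} = {l \<in> L1. inc x l} \<union> {l \<in> HL. inc x l}" by (auto simp: L1_def HL_def)
        thus ?thesis by (simp add: card_Un_le)
      qed
      thus ?thesis unfolding incidences_def sum.distrib[symmetric] by (intro sum_mono)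
    qed
    moreover have "incidences inc P1 HL \<le> incidences inc P HL"
      using fin sub1 by (intro incidences_mono) (auto simp: HL_def)
    ultimately show ?thesis using IH IHL by linarith
  qed
  define P2 where "P2 = {x \<in> P1. \<delta> / 4 \<le> real (card {l \<in> L1. inc x l})}"
  have P2: "P2 \<subseteq> P1" "finite P2" "P2 \<subseteq> P" using sub1 by (auto simp: P2_def)
  define J where "J = real (incidences inc P2 L1)"
  have J: "I / 2 \<le> J"
  proof -
    have 1: "real (incidences inc P1 L1) = (\<Sum>x\<in>P1 - P2. real (card {l \<in> L1. inc x l})) + J"
      unfolding J_def incidences_def of_nat_sum by (rule sum.subset_diff[OF P2(1) sub1(3)])
    have 2: "(\<Sum>x\<in>P1 - P2. real (card {l \<in> L1. inc x l})) \<le> (\<Sum>x\<in>P1 - P2. \<delta> / 4)"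
      by (intro sum_mono) (auto simp: P2_def)
    have 3: "(\<Sum>x\<in>P1 - P2. \<delta> / 4) \<le> a * (\<delta> / 4)"
    proof -
      have "card (P1 - P2) \<le> card P" using fin sub1 by (intro card_mono) auto
      thus ?thesis using \<delta>(2) by (simp add: a_def mult_right_mono)
    qed
    show ?thesis using 1 2 3 I1 Ia by linarith
  qed
  define d where "d = (\<lambda>l. real (card {x \<in> P2. inc x l}))"
  have dl: "d l \<le> 512 * \<epsilon>" if "l \<in> L1" for l
  proof -
    have "card {x \<in> P2. inc x l} \<le> card {x \<in> P. inc x l}" using fin P2 by (intro card_mono) auto
    moreover have "real (card {x \<in> P. inc x l}) \<le> 512 * \<epsilon>" using that by (auto simp: L1_def HL_def)
    ultimately show ?thesis unfolding d_def by linarith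
  qed
  have Jd: "J = (\<Sum>l\<in>L1. d l)" unfolding J_def d_def using incidences_swap[OF P2(2) sub1(4), of inc] by simp
  have JI: "J \<le> I" unfolding J_def I_def using incidences_mono[OF fin P2(3) sub1(2), of inc] by simp
  \<comment> \<open>\<open>S x\<close>: the points collinear with \<open>x\<close>; \<open>B x\<close>: the
    pairs that are degenerate because one line contains them and \<open>x\<close>; \<open>G x\<close>: the pairs
    that have \<open>x\<close> on their grid.\<close>
  define S where "S = (\<lambda>x. {q \<in> P2. q \<noteq> x \<and> (\<exists>l\<in>L1. inc x l \<and> inc q l)})"
  define B where "B = (\<lambda>x. {(q1, q2). q1 \<in> P2 \<and> q2 \<in> P2 \<and> (\<exists>l\<in>L1. inc x l \<and> inc q1 l \<and> inc q2 l)})"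
  define G where "G = (\<lambda>x. S x \<times> S x - B x)"
  have swapL: "(\<Sum>x\<in>P2. \<Sum>l\<in>{l \<in> L1. inc x l}. g l) = (\<Sum>l\<in>L1. d l * g l)" for g :: "'y \<Rightarrow> real"
    unfolding d_def using sum.swap_restrict[OF P2(2) sub1(4), of "\<lambda>_ l. g l" inc] by simp
  define pts where "pts = (\<lambda>l. {q \<in> P2. inc q l})"
  have finpts: "finite (pts l)" for l using P2(2) by (simp add: pts_def)
  have dpts: "d l = real (card (pts l))" for l by (simp add: d_def pts_def)
  have cS: "real (card (S x)) = (\<Sum>l\<in>{l \<in> L1. inc x l}. d l - 1)" if x: "x \<in> P2" for x
  proof -
    let ?T = "{l \<in> L1. inc x l}"
    have "S x = (\<Union>l\<in>?T. pts l - {x})" unfolding S_def pts_def by blast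
    moreover have "card (\<Union>l\<in>?T. pts l - {x}) = (\<Sum>l\<in>?T. card (pts l - {x}))"
    proof (rule card_UN_disjoint)
      show "\<forall>l\<in>?T. \<forall>l'\<in>?T. l \<noteq> l' \<longrightarrow> (pts l - {x}) \<inter> (pts l' - {x}) = {}"
      proof (intro ballI impI)
        fix l l' assume l: "l \<in> ?T" "l' \<in> ?T" "l \<noteq> l'"
        have "q = x" if "q \<in> pts l" "q \<in> pts l'" for q
          using C4[of q x l l'] that l x P2 sub1 unfolding pts_def by blast
        thus "(pts l - {x}) \<inter> (pts l' - {x}) = {}" by blast
      qed
    qed (use sub1 finpts in auto)
    moreover have "real (card (pts l - {x})) = d l - 1" if "l \<in> ?T" for l
    proof -
      have "x \<in> pts l" using x that by (simp add: pts_def)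
      hence "card (pts l) = Suc (card (pts l - {x}))" using finpts by (intro card.remove)
      thus ?thesis by (simp add: dpts)
    qed
    ultimately show ?thesis by simp
  qed
  have cB: "real (card (B x)) \<le> (\<Sum>l\<in>{l \<in> L1. inc x l}. d l ^ 2)" for x
  proof -
    let ?T = "{l \<in> L1. inc x l}"
    have "B x = (\<Union>l\<in>?T. pts l \<times> pts l)" unfolding B_def pts_def by blast
    hence "card (B x) \<le> (\<Sum>l\<in>?T. card (pts l \<times> pts l))" using sub1 by (simp only:) (rule card_UN_le, simp)
    hence "real (card (B x)) \<le> real (\<Sum>l\<in>?T. card (pts l \<times> pts l))" by (simp only: of_nat_le_iff)
    thus ?thesis by (simp add: dpts card_cartesian_product power2_eq_square)
  qed
  have finSB: "finite (S x)" "finite (B x)" for x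
    using P2(2) by (auto simp: S_def B_def intro: finite_subset[of _ "P2 \<times> P2"])
  have cG: "real (card (S x)) ^ 2 - real (card (B x)) \<le> real (card (G x))" for x
  proof -
    have "card (S x \<times> S x) - card (B x) \<le> card (G x)" unfolding G_def
      using finSB by (intro diff_card_le_card_Diff) auto
    hence "card (S x) * card (S x) \<le> card (G x) + card (B x)" by (simp add: card_cartesian_product)
    hence "real (card (S x) * card (S x)) \<le> real (card (G x) + card (B x))" by (simp only: of_nat_le_iff)
    thus ?thesis by (simp add: power2_eq_square)
  qed
  have sumS: "I * \<epsilon> / 8 \<le> (\<Sum>x\<in>P2. real (card (S x)))"
  proof -
    have "(\<Sum>x\<in>P2. real (card (S x))) = (\<Sum>x\<in>P2. \<Sum>l\<in>{l \<in> L1. inc x l}. d l - 1)" by (simp add: cS)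
    also have "\<dots> = (\<Sum>l\<in>L1. d l * (d l - 1))" by (rule swapL[of "\<lambda>l. d l - 1"])
    also have "\<dots> = (\<Sum>l\<in>L1. d l ^ 2) - J" by (simp add: Jd sum_subtractf algebra_simps power2_eq_square)
    finally have e: "(\<Sum>x\<in>P2. real (card (S x))) = (\<Sum>l\<in>L1. d l ^ 2) - J" .
    have "J ^ 2 \<le> card L1 * (\<Sum>l\<in>L1. d l ^ 2)" unfolding Jd by (rule square_sum_le_card_mult_sum_squares[OF sub1(4)])
    also have "\<dots> \<le> b * (\<Sum>l\<in>L1. d l ^ 2)"
      unfolding b_def using card_mono[OF fin(2) sub1(2)] by (intro mult_right_mono sum_nonneg) auto
    finally have "J * (J / b) \<le> (\<Sum>l\<in>L1. d l ^ 2)" using ab by (simp add: field_simps power2_eq_square)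
    moreover have "J * (\<epsilon> / 2) \<le> J * (J / b)"
    proof (rule mult_left_mono)
      have "\<epsilon> / 2 = (I / 2) / b" using Ib ab by (simp add: field_simps)
      also have "\<dots> \<le> J / b" using J ab by (intro divide_right_mono) auto
      finally show "\<epsilon> / 2 \<le> J / b" .
    qed (simp add: J_def)
    moreover have "I * \<epsilon> / 8 \<le> J * (\<epsilon> / 4)" using mult_right_mono[OF J, of "\<epsilon> / 4"] \<epsilon>(2) by simp
    moreover have "J * (\<epsilon> / 4) \<le> J * (\<epsilon> / 2) - J"
    proof -
      have "J * 1 \<le> J * (\<epsilon> / 4)" using \<epsilon>(2) by (intro mult_left_mono) (auto simp: J_def)
      thus ?thesis by simp
    qed
    ultimately show ?thesis unfolding e by linarith
  qed
  have sumB: "(\<Sum>x\<in>P2. real (card (B x))) \<le> 2 ^ 18 * \<epsilon> ^ 2 * I"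
  proof -
    have 1: "(\<Sum>x\<in>P2. real (card (B x))) \<le> (\<Sum>x\<in>P2. \<Sum>l\<in>{l \<in> L1. inc x l}. d l ^ 2)" by (intro sum_mono cB)
    have 2: "(\<Sum>x\<in>P2. \<Sum>l\<in>{l \<in> L1. inc x l}. d l ^ 2) = (\<Sum>l\<in>L1. d l * d l ^ 2)"
      by (rule swapL[of "\<lambda>l. d l ^ 2"])
    have 3: "(\<Sum>l\<in>L1. d l * d l ^ 2) \<le> (\<Sum>l\<in>L1. d l * (512 * \<epsilon>) ^ 2)"
      using dl by (intro sum_mono mult_left_mono power_mono) (auto simp: d_def)
    have 4: "(\<Sum>l\<in>L1. d l * (512 * \<epsilon>) ^ 2) = (512 * \<epsilon>) ^ 2 * J"
      unfolding Jd by (simp only: sum_distrib_right[symmetric] mult.commute)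
    have 5: "(512 * \<epsilon>) ^ 2 * J \<le> (512 * \<epsilon>) ^ 2 * I" using JI by (rule mult_left_mono) simp
    have 6: "(512 * \<epsilon>) ^ 2 * I = 2 ^ 18 * \<epsilon> ^ 2 * I" by (simp add: power_mult_distrib)
    show ?thesis using 1 2 3 4 5 6 by linarith
  qed
  have sumG: "I * \<delta> * \<epsilon> ^ 2 / 128 \<le> (\<Sum>x\<in>P2. real (card (G x)))"
  proof -
    have "(I * \<epsilon> / 8) ^ 2 \<le> (\<Sum>x\<in>P2. real (card (S x))) ^ 2"
      using sumS Ipos \<epsilon>(2) by (intro power_mono) auto
    also have "\<dots> \<le> card P2 * (\<Sum>x\<in>P2. real (card (S x)) ^ 2)" by (rule square_sum_le_card_mult_sum_squares[OF P2(2)])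
    also have "\<dots> \<le> a * (\<Sum>x\<in>P2. real (card (S x)) ^ 2)"
      unfolding a_def using card_mono[OF fin(1) P2(3)] by (intro mult_right_mono sum_nonneg) auto
    finally have "a * (I * \<delta> * \<epsilon> ^ 2 / 64) \<le> a * (\<Sum>x\<in>P2. real (card (S x)) ^ 2)"
      unfolding Ia by (simp add: power2_eq_square mult_ac)
    hence "I * \<delta> * \<epsilon> ^ 2 / 64 \<le> (\<Sum>x\<in>P2. real (card (S x)) ^ 2)" using ab by simp
    moreover have "(\<Sum>x\<in>P2. real (card (S x)) ^ 2) - (\<Sum>x\<in>P2. real (card (B x))) \<le> (\<Sum>x\<in>P2. real (card (G x)))"
      unfolding sum_subtractf[symmetric] by (intro sum_mono cG)
    moreover have "2 ^ 18 * \<epsilon> ^ 2 * I \<le> I * \<delta> * \<epsilon> ^ 2 / 128"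
    proof -
      have "2 ^ 18 * (\<epsilon> ^ 2 * I) \<le> (\<delta> / 128) * (\<epsilon> ^ 2 * I)" using \<delta>(2) Ipos by (intro mult_right_mono) auto
      thus ?thesis by (simp add: mult_ac)
    qed
    ultimately show ?thesis using sumB by linarith
  qed
  define M where "M = \<delta> ^ 2 * \<epsilon> ^ 2 / (256 * a)"
  have "M * real (card P2) ^ 2 < (\<Sum>x\<in>P2. real (card (G x)))"
  proof -
    have "M * real (card P2) ^ 2 \<le> M * a ^ 2"
      unfolding a_def using card_mono[OF fin(1) P2(3)] ab by (intro mult_left_mono power_mono) (auto simp: M_def a_def)
    also have "\<dots> = I * \<delta> * \<epsilon> ^ 2 / 256" unfolding M_def Ia using ab by (simp add: power2_eq_square field_simps)
    also have "\<dots> < I * \<delta> * \<epsilon> ^ 2 / 128" using Ipos \<delta>(2) \<epsilon>(2) by simp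
    also have "\<dots> \<le> (\<Sum>x\<in>P2. real (card (G x)))" by (rule sumG)
    finally show ?thesis .
  qed
  note many = this
  have SP: "S x \<subseteq> P2" for x by (simp add: S_def)
  have GP: "G x \<subseteq> P2 \<times> P2" for x
    unfolding G_def by (rule order.trans[OF Diff_subset Sigma_mono[OF SP SP]])
  have "\<exists>z\<in>P2 \<times> P2. M < real (card {x \<in> P2. z \<in> G x})"
    by (rule pair_with_many_common[where P = P2 and Q = P2 and G = G and M = M, OF P2(2) P2(2) GP many])
  then obtain z where z: "z \<in> P2 \<times> P2" "M < real (card {x \<in> P2. z \<in> G x})" by (rule bexE)
  obtain q1 q2 where q: "z = (q1, q2)" by (cases z)
  define P' where "P' = {x \<in> P2. z \<in> G x}"
  have P'D: "x \<in> P2 \<and> x \<noteq> q1 \<and> x \<noteq> q2 \<and> q1 \<noteq> q2 \<and>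
      (\<exists>l1\<in>L1. \<exists>l2\<in>L1. l1 \<noteq> l2 \<and> inc x l1 \<and> inc q1 l1 \<and> inc x l2 \<and> inc q2 l2)" if "x \<in> P'" for x
  proof -
    have x: "x \<in> P2" "q1 \<in> S x" "q2 \<in> S x" "(q1, q2) \<notin> B x" using that unfolding P'_def q G_def by blast+
    obtain l1 where l1: "l1 \<in> L1" "inc x l1" "inc q1 l1" "q1 \<in> P2" "x \<noteq> q1" using x(2) unfolding S_def by blast
    obtain l2 where l2: "l2 \<in> L1" "inc x l2" "inc q2 l2" "q2 \<in> P2" "x \<noteq> q2" using x(3) unfolding S_def by blast
    have nB: "\<not> (inc x l \<and> inc q1 l \<and> inc q2 l)" if "l \<in> L1" for l
      using x(4) l1(4) l2(4) that unfolding B_def by blast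
    have "l1 \<noteq> l2" using nB[OF l1(1)] l1 l2 by blast
    moreover have "q1 \<noteq> q2" using nB[OF l1(1)] l1 by blast
    ultimately show ?thesis using x(1) l1 l2 by blast
  qed
  have "M \<ge> 0" using ab by (simp add: M_def)
  hence "real (card P') > 0" using z(2) unfolding P'_def by (rule le_less_trans)
  hence "P' \<noteq> {}" by force
  hence ne: "q1 \<noteq> q2" using P'D by blast
  have "\<delta> ^ 2 * \<epsilon> ^ 2 = 256 * a * M" using ab by (simp add: M_def)
  also have "\<dots> \<le> 256 * a * real (card P')" using z(2) ab by (intro mult_left_mono) (auto simp: P'_def)
  finally have card: "\<delta> ^ 2 * \<epsilon> ^ 2 \<le> 256 * card P * real (card P')" unfolding a_def by simp
  have q12: "q1 \<in> P2" "q2 \<in> P2" using z(1) q by auto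
  have P'2: "P' \<subseteq> P2" by (auto simp: P'_def)
  show ?thesis
  proof (rule exI[of _ q1], rule exI[of _ q2], rule exI[of _ L1], rule exI[of _ P'], intro conjI)
    show "\<forall>x\<in>P'. x \<noteq> q1 \<and> x \<noteq> q2 \<and>
      (\<exists>l1\<in>L1. \<exists>l2\<in>L1. l1 \<noteq> l2 \<and> inc x l1 \<and> inc q1 l1 \<and> inc x l2 \<and> inc q2 l2)" using P'D by blast
    show "\<forall>x\<in>insert q1 (insert q2 P'). real (card {l \<in> L1. inc x l}) \<le> 512 * \<delta>"
      using dx q12 P'2 P2(1) by blast
    show "\<forall>x\<in>P'. \<delta> / 4 \<le> real (card {l \<in> L1. inc x l})" using P'2 by (auto simp: P2_def)
  qed (use ne sub1 P'2 P2 q12 card in auto)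
qed

section \<open>Incidences in the projective plane\<close>

type_synonym 'a vec3 = "'a \<times> 'a \<times> 'a"

fun dot :: "'a::comm_ring_1 vec3 \<Rightarrow> 'a vec3 \<Rightarrow> 'a" where
  "dot (x1, x2, x3) (y1, y2, y3) = x1 * y1 + x2 * y2 + x3 * y3"

fun cross :: "'a::comm_ring_1 vec3 \<Rightarrow> 'a vec3 \<Rightarrow> 'a vec3" where
  "cross (x1, x2, x3) (y1, y2, y3) = (x2 * y3 - x3 * y2, x3 * y1 - x1 * y3, x1 * y2 - x2 * y1)"

abbreviation zero3 :: "'a::comm_ring_1 vec3" where "zero3 \<equiv> (0, 0, 0)"

text \<open>A set of representatives of pairwise distinct points of the projective plane.\<close>
definition projective :: "'a::comm_ring_1 vec3 set \<Rightarrow> bool" where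
  "projective V \<longleftrightarrow> zero3 \<notin> V \<and> (\<forall>x\<in>V. \<forall>y\<in>V. cross x y = zero3 \<longrightarrow> x = y)"

lemma dot_commute: "dot x y = dot y x"
  by (cases x; cases y) (simp add: mult.commute)

lemma cross_cross_orthogonal:
  assumes "dot u x = 0" "dot u y = 0" shows "cross u (cross x y) = zero3"
proof -
  obtain u1 u2 u3 x1 x2 x3 y1 y2 y3 where e: "u = (u1, u2, u3)" "x = (x1, x2, x3)" "y = (y1, y2, y3)"
    by (cases u; cases x; cases y)
  have 1: "cross u (cross x y) = (x1 * dot u y - y1 * dot u x, x2 * dot u y - y2 * dot u x, x3 * dot u y - y3 * dot u x)"
    by (simp add: e algebra_simps)
  show ?thesis unfolding 1 assms by simp
qed

lemma cross_trans:
  fixes u v n :: "'a::idom vec3"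
  assumes "cross u n = zero3" "cross v n = zero3" "n \<noteq> zero3"
  shows "cross u v = zero3"
proof -
  obtain u1 u2 u3 v1 v2 v3 n1 n2 n3 where e: "u = (u1, u2, u3)" "v = (v1, v2, v3)" "n = (n1, n2, n3)"
    by (cases u; cases v; cases n)
  have u: "u2 * n3 = u3 * n2" "u3 * n1 = u1 * n3" "u1 * n2 = u2 * n1"
    and v: "v2 * n3 = v3 * n2" "v3 * n1 = v1 * n3" "v1 * n2 = v2 * n1" using assms by (simp_all add: e)
  have key: "(u2 * v3 - u3 * v2) * (m * m) = 0 \<and> (u3 * v1 - u1 * v3) * (m * m) = 0 \<and> (u1 * v2 - u2 * v1) * (m * m) = 0"
    if "m \<in> {n1, n2, n3}" for m
  proof -
    have "\<exists>k l. (u1 * m = k * n1 \<and> u2 * m = k * n2 \<and> u3 * m = k * n3) \<and> (v1 * m = l * n1 \<and> v2 * m = l * n2 \<and> v3 * m = l * n3)"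
    proof -
      consider "m = n1" | "m = n2" | "m = n3" using \<open>m \<in> {n1, n2, n3}\<close> by blast
      thus ?thesis
      proof cases
        case 1 thus ?thesis using u v by (intro exI[of _ u1] exI[of _ v1]) simp
      next
        case 2 thus ?thesis using u v by (intro exI[of _ u2] exI[of _ v2]) simp
      next
        case 3 thus ?thesis using u v by (intro exI[of _ u3] exI[of _ v3]) simp
      qed
    qed
    then obtain k l where k: "u1 * m = k * n1" "u2 * m = k * n2" "u3 * m = k * n3"
      and l: "v1 * m = l * n1" "v2 * m = l * n2" "v3 * m = l * n3" by blast
    have "(u2 * v3 - u3 * v2) * (m * m) = (u2 * m) * (v3 * m) - (u3 * m) * (v2 * m)"
      "(u3 * v1 - u1 * v3) * (m * m) = (u3 * m) * (v1 * m) - (u1 * m) * (v3 * m)"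
      "(u1 * v2 - u2 * v1) * (m * m) = (u1 * m) * (v2 * m) - (u2 * m) * (v1 * m)"
      by (simp_all add: algebra_simps)
    thus ?thesis unfolding k l by (simp add: algebra_simps)
  qed
  obtain m where m: "m \<in> {n1, n2, n3}" "m \<noteq> 0" using assms(3) by (auto simp: e)
  show ?thesis using key[OF m(1)] m(2) by (simp add: e)
qed

text \<open>Two distinct points lie on at most one line.\<close>
lemma projective_C4_free:
  fixes V W :: "'a::idom vec3 set"
  assumes V: "projective V" "x \<in> V" "x' \<in> V" and W: "projective W" "l \<in> W" "l' \<in> W"
    and inc: "dot x l = 0" "dot x l' = 0" "dot x' l = 0" "dot x' l' = 0"
  shows "x = x' \<or> l = l'"
proof (rule ccontr)
  assume ne: "\<not> ?thesis"
  have n: "cross x x' \<noteq> zero3" using V ne unfolding projective_def by blast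
  have "cross l (cross x x') = zero3" "cross l' (cross x x') = zero3"
    using inc by (auto intro!: cross_cross_orthogonal simp: dot_commute)
  hence "cross l l' = zero3" using n by (rule cross_trans)
  thus False using W ne unfolding projective_def by blast
qed

text \<open>Coordinates with respect to a basis \<open>q1, q2, q3\<close>, by Cramer's rule.\<close>
definition det3 :: "'a::comm_ring_1 vec3 \<Rightarrow> 'a vec3 \<Rightarrow> 'a vec3 \<Rightarrow> 'a" where
  "det3 x y z = dot (cross x y) z"

lemma cramer:
  "det3 q1 q2 q3 * dot x l = det3 x q2 q3 * dot q1 l + det3 q1 x q3 * dot q2 l + det3 q1 q2 x * dot q3 l"
  by (cases q1; cases q2; cases q3; cases x; cases l) (simp add: det3_def algebra_simps)

lemma basis_extension:
  fixes n :: "'a::comm_ring_1 vec3"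
  assumes "n \<noteq> zero3" shows "\<exists>q. dot n q \<noteq> 0"
proof -
  obtain n1 n2 n3 where n: "n = (n1, n2, n3)" by (cases n)
  have "dot n (1,0,0) = n1" "dot n (0,1,0) = n2" "dot n (0,0,1) = n3" by (simp_all add: n)
  thus ?thesis using assms n by (metis prod.inject)
qed

lemma orthogonal_to_basis:
  fixes m :: "'a::idom vec3"
  assumes D: "det3 q1 q2 q3 \<noteq> 0" and m: "dot q1 m = 0" "dot q2 m = 0" "dot q3 m = 0"
  shows "m = zero3"
proof -
  have "det3 q1 q2 q3 * dot x m = 0" for x by (subst cramer) (simp add: m)
  hence z: "dot x m = 0" for x using D by simp
  obtain m1 m2 m3 where e: "m = (m1, m2, m3)" by (cases m)
  show ?thesis using z[of "(1,0,0)"] z[of "(0,1,0)"] z[of "(0,0,1)"] by (simp add: e)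
qed

lemma parallel_if_proportional_on_basis:
  fixes l l' :: "'a::idom vec3"
  assumes D: "det3 q1 q2 q3 \<noteq> 0"
    and p: "dot q1 l * k' = dot q1 l' * k" "dot q2 l * k' = dot q2 l' * k" "dot q3 l * k' = dot q3 l' * k"
    and k: "k' \<noteq> 0" 
  shows "cross l l' = zero3"
proof -
  obtain l1 l2 l3 m1 m2 m3 where e: "l = (l1, l2, l3)" "l' = (m1, m2, m3)" by (cases l; cases l')
  let ?m = "(l1 * k' - m1 * k, l2 * k' - m2 * k, l3 * k' - m3 * k)"
  have dm: "dot q ?m = dot q l * k' - dot q l' * k" for q by (cases q) (simp add: e algebra_simps)
  have "?m = zero3" by (rule orthogonal_to_basis[OF D]) (simp_all only: dm p diff_self)
  hence "l1 * k' = m1 * k" "l2 * k' = m2 * k" "l3 * k' = m3 * k" by simp_all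
  moreover have "k' * (l2 * m3 - l3 * m2) = (l2 * k') * m3 - (l3 * k') * m2"
    "k' * (l3 * m1 - l1 * m3) = (l3 * k') * m1 - (l1 * k') * m3" "k' * (l1 * m2 - l2 * m1) = (l1 * k') * m2 - (l2 * k') * m1"
    by (simp_all add: algebra_simps)
  ultimately have "k' * (l2 * m3 - l3 * m2) = 0" "k' * (l3 * m1 - l1 * m3) = 0" "k' * (l1 * m2 - l2 * m1) = 0"
    by (simp_all add: mult.commute mult.left_commute)
  thus ?thesis using k by (simp add: e)
qed

text \<open>A projective transformation sends \<open>q1\<close> and \<open>q2\<close> to the points at infinity of the
  coordinate axes: the grid becomes a Cartesian product of at most \<open>h\<close> by \<open>h\<close> points,
  and a line that misses \<open>q1\<close> becomes the graph of an affine function.\<close>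
lemma grid_incidences:
  fixes V W L P :: "'a::{field,finite} vec3 set"
  assumes char: "\<And>n. 0 < n \<Longrightarrow> n < p \<Longrightarrow> of_nat n \<noteq> (0::'a)"
    and p: "27 * (h * card L) < p\<^sup>2"
    and V: "projective V" "P \<subseteq> V" "q1 \<in> V" "q2 \<in> V" "q1 \<noteq> q2" and W: "projective W" "L \<subseteq> W"
    and grid: "\<And>x. x \<in> P \<Longrightarrow> x \<noteq> q1 \<and> x \<noteq> q2 \<and> (\<exists>l1\<in>L. \<exists>l2\<in>L. l1 \<noteq> l2 \<and>
      dot x l1 = 0 \<and> dot q1 l1 = 0 \<and> dot x l2 = 0 \<and> dot q2 l2 = 0)"
    and deg: "\<And>x. x \<in> insert q1 (insert q2 P) \<Longrightarrow> card {l \<in> L. dot x l = 0} \<le> h"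
  shows "real (incidences (\<lambda>x l. dot x l = 0) P {l \<in> L. dot q1 l \<noteq> 0}) ^ 2
    \<le> 100000 * h * (h * card L) * (sqrt (h * card L) + h)"
proof -
  define n where "n = cross q1 q2"
  have n: "n \<noteq> zero3" using V unfolding projective_def n_def by blast
  obtain q3 where q3: "dot n q3 \<noteq> 0" using basis_extension[OF n] by blast
  have D: "det3 q1 q2 q3 \<noteq> 0" using q3 by (simp add: det3_def n_def)
  have qn: "dot q1 n = 0" "dot q2 n = 0" by (cases q1; cases q2; simp add: n_def algebra_simps)+
  have d3: "det3 q1 q2 x \<noteq> 0" if x: "x \<in> P" for x
  proof
    assume "det3 q1 q2 x = 0"
    hence xn: "dot x n = 0" by (simp add: det3_def n_def dot_commute)
    obtain l1 l2 where l: "l1 \<in> L" "l2 \<in> L" "l1 \<noteq> l2" "dot x l1 = 0" "dot q1 l1 = 0" "dot x l2 = 0" "dot q2 l2 = 0"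
      using grid[OF x] by blast
    have par: "cross l n = zero3" if "q \<in> V" "x \<noteq> q" "dot q n = 0" "dot x l = 0" "dot q l = 0" for q l
    proof (rule cross_trans)
      show "cross l (cross q x) = zero3" "cross n (cross q x) = zero3"
        using that xn by (auto intro!: cross_cross_orthogonal simp: dot_commute)
      show "cross q x \<noteq> zero3" using that V x unfolding projective_def by blast
    qed
    have "cross l1 n = zero3" by (rule par[of q1]) (use V grid[OF x] qn l in auto)
    moreover have "cross l2 n = zero3" by (rule par[of q2]) (use V grid[OF x] qn l in auto)
    ultimately have "cross l1 l2 = zero3" using n by (rule cross_trans)
    thus False using l W unfolding projective_def by blast
  qed
  \<comment> \<open>\<open>yy x\<close>, \<open>xx x\<close> and 1 are, up to a common factor, the coordinates
    of \<open>x\<close> in the basis \<open>q1, q2, q3\<close>; in the dual coordinates \<open>sl\<close> and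
    \<open>ic\<close> are slope and intercept.\<close>
  define xx where "xx = (\<lambda>x. det3 q1 x q3 / det3 q1 q2 x)"
  define yy where "yy = (\<lambda>x. det3 x q2 q3 / det3 q1 q2 x)"
  define sl where "sl = (\<lambda>l. - dot q2 l / dot q1 l)"
  define ic where "ic = (\<lambda>l. - dot q3 l / dot q1 l)"
  define L' where "L' = {l \<in> L. dot q1 l \<noteq> 0}"
  have coords: "det3 q1 q2 q3 * dot x l = det3 q1 q2 x * (yy x * dot q1 l + xx x * dot q2 l + dot q3 l)"
    if "x \<in> P" for x l
  proof -
    have "det3 q1 x q3 = det3 q1 q2 x * xx x" "det3 x q2 q3 = det3 q1 q2 x * yy x"
      using d3[OF that] by (simp_all add: xx_def yy_def)
    thus ?thesis by (subst cramer) (simp add: algebra_simps)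
  qed
  have zero: "dot x l = 0 \<longleftrightarrow> yy x * dot q1 l + xx x * dot q2 l + dot q3 l = 0" if "x \<in> P" for x l
  proof -
    have "det3 q1 q2 q3 * dot x l = 0 \<longleftrightarrow> det3 q1 q2 x * (yy x * dot q1 l + xx x * dot q2 l + dot q3 l) = 0"
      by (simp only: coords[OF that])
    thus ?thesis unfolding mult_eq_0_iff using d3[OF that] D by blast
  qed
  have inc: "dot x l = 0 \<longleftrightarrow> yy x = sl l * xx x + ic l" if "x \<in> P" "l \<in> L'" for x l
  proof -
    have nz: "dot q1 l \<noteq> 0" using that by (simp add: L'_def)
    have "yy x * dot q1 l + xx x * dot q2 l + dot q3 l = dot q1 l * (yy x - (sl l * xx x + ic l))"
      using nz by (simp add: sl_def ic_def field_simps)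
    thus ?thesis unfolding zero[OF that(1)] using nz by simp
  qed
  have inj1: "inj_on (\<lambda>x. (xx x, yy x)) P"
  proof (rule inj_onI)
    fix x x' assume x: "x \<in> P" "x' \<in> P" and e: "(xx x, yy x) = (xx x', yy x')"
    have pr: "dot l x * det3 q1 q2 x' = dot l x' * det3 q1 q2 x" for l
    proof -
      have "det3 q1 q2 q3 * (dot x l * det3 q1 q2 x') = det3 q1 q2 q3 * (dot x' l * det3 q1 q2 x)"
      proof -
        have e': "xx x = xx x'" "yy x = yy x'" using e by simp_all
        have "det3 q1 q2 q3 * (dot x l * det3 q1 q2 x') = (det3 q1 q2 q3 * dot x l) * det3 q1 q2 x'" by (rule mult.assoc[symmetric])
        also have "\<dots> = (det3 q1 q2 q3 * dot x' l) * det3 q1 q2 x"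
          unfolding coords[OF x(1)] coords[OF x(2)] e' by (simp only: mult.assoc mult.commute mult.left_commute)
        finally show ?thesis by (simp only: mult.assoc)
      qed
      thus ?thesis using D by (simp add: dot_commute)
    qed
    have "cross x x' = zero3"
      by (rule parallel_if_proportional_on_basis[of "(1,0,0)" "(0,1,0)" "(0,0,1)", OF _ pr pr pr d3[OF x(2)]])
        (simp add: det3_def)
    thus "x = x'" using V x unfolding projective_def by blast
  qed
  have inj2: "inj_on (\<lambda>l. (sl l, ic l)) L'"
  proof (rule inj_onI)
    fix l l' assume l: "l \<in> L'" "l' \<in> L'" and e: "(sl l, ic l) = (sl l', ic l')"
    have nz: "dot q1 l \<noteq> 0" "dot q1 l' \<noteq> 0" using l by (auto simp: L'_def)
    have "dot q2 l * dot q1 l' = dot q2 l' * dot q1 l" "dot q3 l * dot q1 l' = dot q3 l' * dot q1 l"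
      using e nz by (simp_all add: sl_def ic_def frac_eq_eq)
    hence "cross l l' = zero3"
      by (intro parallel_if_proportional_on_basis[OF D _ _ _ nz(2), where k = "dot q1 l"]) (simp_all add: mult.commute)
    thus "l = l'" using W l unfolding projective_def L'_def by blast
  qed
  define Ps where "Ps = (\<lambda>x. (xx x, yy x)) ` P"
  define Ls where "Ls = (\<lambda>l. (sl l, ic l)) ` L'"
  have lnz: "l \<noteq> zero3" if "l \<in> L" for l using W that unfolding projective_def by blast
  have cL: "card Ls \<le> card L"
  proof -
    have "card Ls \<le> card L'" unfolding Ls_def by (rule card_image_le) simp
    also have "card L' \<le> card L" by (rule card_mono) (auto simp: L'_def)
    finally show ?thesis .
  qed
  have cX: "card (xx ` P) \<le> h"
  proof -
    have "xx ` P \<subseteq> (\<lambda>l. - dot q3 l / dot q2 l) ` {l \<in> L. dot q1 l = 0}"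
    proof (rule image_subsetI)
      fix x assume x: "x \<in> P"
      obtain l where l: "l \<in> L" "dot x l = 0" "dot q1 l = 0" using grid[OF x] by blast
      have e: "xx x * dot q2 l + dot q3 l = 0" using zero[OF x, of l] l by simp
      have "dot q2 l \<noteq> 0" using e orthogonal_to_basis[OF D, of l] l lnz by auto
      moreover have "xx x * dot q2 l = - dot q3 l" using e by (simp add: eq_neg_iff_add_eq_0)
      ultimately have "xx x = - dot q3 l / dot q2 l" by (rule eq_divide_imp)
      thus "xx x \<in> (\<lambda>l. - dot q3 l / dot q2 l) ` {l \<in> L. dot q1 l = 0}" using l by blast
    qed
    hence "card (xx ` P) \<le> card {l \<in> L. dot q1 l = 0}" by (intro surj_card_le) auto
    thus ?thesis using deg[of q1] by simp
  qed
  have cY: "card (yy ` P) \<le> h"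
  proof -
    have "yy ` P \<subseteq> (\<lambda>l. - dot q3 l / dot q1 l) ` {l \<in> L. dot q2 l = 0}"
    proof (rule image_subsetI)
      fix x assume x: "x \<in> P"
      obtain l where l: "l \<in> L" "dot x l = 0" "dot q2 l = 0" using grid[OF x] by blast
      have e: "yy x * dot q1 l + dot q3 l = 0" using zero[OF x, of l] l by simp
      have "dot q1 l \<noteq> 0" using e orthogonal_to_basis[OF D, of l] l lnz by auto
      moreover have "yy x * dot q1 l = - dot q3 l" using e by (simp add: eq_neg_iff_add_eq_0)
      ultimately have "yy x = - dot q3 l / dot q1 l" by (rule eq_divide_imp)
      thus "yy x \<in> (\<lambda>l. - dot q3 l / dot q1 l) ` {l \<in> L. dot q2 l = 0}" using l by blast
    qed
    hence "card (yy ` P) \<le> card {l \<in> L. dot q2 l = 0}" by (intro surj_card_le) auto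
    thus ?thesis using deg[of q2] by simp
  qed
  let ?I = "{((x, y), (s, c)). (x, y) \<in> Ps \<and> (s, c) \<in> Ls \<and> y = s * x + c}"
  have "27 * (h * card Ls) \<le> 27 * (h * card L)" using cL by simp
  hence p': "27 * (h * card Ls) < p\<^sup>2" using p by linarith
  have "real (card ?I) ^ 2 \<le> 100000 * h * (h * card Ls) * (sqrt (h * card Ls) + h)"
  proof (rule cartesian_incidences[OF char p' _ cX cY])
    show "Ps \<subseteq> xx ` P \<times> yy ` P" by (auto simp: Ps_def)
    fix x y assume "(x, y) \<in> Ps"
    then obtain z where z: "z \<in> P" "x = xx z" "y = yy z" by (auto simp: Ps_def)
    have "{(s, c). (s, c) \<in> Ls \<and> y = s * x + c} \<subseteq> (\<lambda>l. (sl l, ic l)) ` {l \<in> L. dot z l = 0}"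
      using inc[OF z(1)] by (auto simp: Ls_def z L'_def)
    hence "card {(s, c). (s, c) \<in> Ls \<and> y = s * x + c} \<le> card {l \<in> L. dot z l = 0}" by (intro surj_card_le) auto
    thus "card {(s, c). (s, c) \<in> Ls \<and> y = s * x + c} \<le> h" using deg[of z] z(1) by simp
  qed
  also have "\<dots> \<le> 100000 * h * (h * card L) * (sqrt (h * card L) + h)"
  proof -
    have m: "h * card Ls \<le> h * card L" using cL by simp
    hence r: "real (h * card Ls) \<le> real (h * card L)" by (simp only: of_nat_le_iff)
    hence "sqrt (h * card Ls) \<le> sqrt (h * card L)" by (simp only: real_sqrt_le_iff)
    moreover have "100000 * h * (h * card Ls) \<le> 100000 * h * (h * card L)" using m by (rule mult_left_mono) simp
    hence "real (100000 * h * (h * card Ls)) \<le> real (100000 * h * (h * card L))" by (simp only: of_nat_le_iff)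
    ultimately show ?thesis by (intro mult_mono add_mono) auto
  qed
  finally have main: "real (card ?I) ^ 2 \<le> 100000 * h * (h * card L) * (sqrt (h * card L) + h)" .
  have "incidences (\<lambda>x l. dot x l = 0) P L' = card {(x, l). x \<in> P \<and> l \<in> L' \<and> dot x l = 0}"
    by (rule incidences_card) simp_all
  also have "\<dots> \<le> card ?I"
  proof (rule card_inj_on_le)
    show "inj_on (\<lambda>(x, l). ((xx x, yy x), (sl l, ic l))) {(x, l). x \<in> P \<and> l \<in> L' \<and> dot x l = 0}"
    proof (rule inj_onI)
      fix z z' assume z: "z \<in> {(x, l). x \<in> P \<and> l \<in> L' \<and> dot x l = 0}" "z' \<in> {(x, l). x \<in> P \<and> l \<in> L' \<and> dot x l = 0}"
        and e: "(\<lambda>(x, l). ((xx x, yy x), (sl l, ic l))) z = (\<lambda>(x, l). ((xx x, yy x), (sl l, ic l))) z'"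
      obtain x l x' l' where zz: "z = (x, l)" "z' = (x', l')" by (cases z; cases z')
      have "x = x'" using z e by (intro inj_onD[OF inj1]) (auto simp: zz)
      moreover have "l = l'" using z e by (intro inj_onD[OF inj2]) (auto simp: zz)
      ultimately show "z = z'" by (simp add: zz)
    qed
    show "(\<lambda>(x, l). ((xx x, yy x), (sl l, ic l))) ` {(x, l). x \<in> P \<and> l \<in> L' \<and> dot x l = 0} \<subseteq> ?I"
    proof (rule image_subsetI)
      fix z assume z: "z \<in> {(x, l). x \<in> P \<and> l \<in> L' \<and> dot x l = 0}"
      obtain x l where zz: "z = (x, l)" by (cases z)
      have xl: "x \<in> P" "l \<in> L'" "dot x l = 0" using z by (auto simp: zz)
      have "(xx x, yy x) \<in> Ps" "(sl l, ic l) \<in> Ls" unfolding Ps_def Ls_def using xl by blast+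
      moreover have "yy x = sl l * xx x + ic l" using inc[OF xl(1,2)] xl(3) by simp
      ultimately show "(\<lambda>(x, l). ((xx x, yy x), (sl l, ic l))) z \<in> ?I" unfolding zz split_conv by blast
    qed
  qed simp
  finally have "real (incidences (\<lambda>x l. dot x l = 0) P L') ^ 2 \<le> real (card ?I) ^ 2" by (intro power_mono) auto
  thus ?thesis using main unfolding L'_def by linarith
qed

text \<open>The sum of the squared degrees counts triples of a point and two lines through it; two different lines determine
  the point.\<close>
lemma incidences_square_le:
  assumes fin: "finite P" "finite L"
    and C4: "\<And>x x' l l'. x \<in> P \<Longrightarrow> x' \<in> P \<Longrightarrow> l \<in> L \<Longrightarrow> l' \<in> L \<Longrightarrow> inc x l \<Longrightarrow> inc x l' \<Longrightarrow> inc x' l \<Longrightarrow> inc x' l' \<Longrightarrow>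
      x = x' \<or> l = l'"
  shows "(incidences inc P L)\<^sup>2 \<le> card P * ((card L)\<^sup>2 + incidences inc P L)"
proof -
  let ?d = "\<lambda>x. card {l \<in> L. inc x l}"
  have "(\<Sum>x\<in>P. (?d x)\<^sup>2) = (\<Sum>x\<in>P. card ({l \<in> L. inc x l} \<times> {l \<in> L. inc x l}))"
    by (simp add: card_cartesian_product power2_eq_square)
  also have "\<dots> = card (SIGMA x:P. {l \<in> L. inc x l} \<times> {l \<in> L. inc x l})" using fin by (simp add: card_SigmaI)
  also have "\<dots> \<le> card ((L \<times> L) <+> (SIGMA x:P. {l \<in> L. inc x l}))"
  proof (rule card_inj_on_le)
    let ?f = "\<lambda>(x, (l, l')). if l = l' then Inr (x, l) else Inl (l, l')"
    show "inj_on ?f (SIGMA x:P. {l \<in> L. inc x l} \<times> {l \<in> L. inc x l})"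
    proof (rule inj_onI)
      fix u v assume u: "u \<in> (SIGMA x:P. {l \<in> L. inc x l} \<times> {l \<in> L. inc x l})"
        and v: "v \<in> (SIGMA x:P. {l \<in> L. inc x l} \<times> {l \<in> L. inc x l})" and e: "?f u = ?f v"
      obtain x l l' x' k k' where uv: "u = (x, (l, l'))" "v = (x', (k, k'))" by (cases u; cases v) auto
      show "u = v"
      proof (cases "l = l'")
        case True
        thus ?thesis using e by (auto simp: uv split: if_splits)
      next
        case False
        hence lk: "l = k" "l' = k'" using e by (auto simp: uv split: if_splits)
        have "x = x'" using C4[of x x' l l'] u v False by (simp add: uv lk)
        thus ?thesis by (simp add: uv lk)
      qed
    qed
    show "?f ` (SIGMA x:P. {l \<in> L. inc x l} \<times> {l \<in> L. inc x l}) \<subseteq> (L \<times> L) <+> (SIGMA x:P. {l \<in> L. inc x l})"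
      by (auto split: if_splits)
    show "finite ((L \<times> L) <+> (SIGMA x:P. {l \<in> L. inc x l}))" using fin by (intro finite_Plus finite_SigmaI) auto
  qed
  also have "\<dots> = (card L)\<^sup>2 + incidences inc P L"
    using fin by (simp add: card_Plus card_cartesian_product power2_eq_square incidences_def card_SigmaI)
  finally have s: "(\<Sum>x\<in>P. (?d x)\<^sup>2) \<le> (card L)\<^sup>2 + incidences inc P L" .
  have "real ((incidences inc P L)\<^sup>2) \<le> real (card P * (\<Sum>x\<in>P. (?d x)\<^sup>2))"
    using square_sum_le_card_mult_sum_squares[OF fin(1), of "\<lambda>x. real (?d x)"] by (simp add: incidences_def mult.commute)
  hence "(incidences inc P L)\<^sup>2 \<le> card P * (\<Sum>x\<in>P. (?d x)\<^sup>2)" by (simp only: of_nat_le_iff)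
  also have "\<dots> \<le> card P * ((card L)\<^sup>2 + incidences inc P L)" using s by (rule mult_left_mono) simp
  finally show ?thesis .
qed

text \<open>In an extremal configuration with very many incidences both average degrees are large; \<open>a\<close> is the
  number of points or the number of lines.\<close>
lemma rich_on_average:
  fixes n a b I :: real
  assumes n: "1 \<le> a" "a \<le> n" "1 \<le> b" and big: "2 ^ 390 * n ^ 12 * (a * b) ^ 5 < I ^ 15" and I: "0 \<le> I"
  shows "2 ^ 26 * a \<le> I"
proof -
  have "(2 ^ 26 * a) ^ 15 = 2 ^ 390 * (a ^ 10 * 1 * a ^ 5)" by (simp add: power_mult_distrib flip: power_mult power_add)
  also have "\<dots> \<le> 2 ^ 390 * (n ^ 12 * b ^ 5 * a ^ 5)"
  proof -
    have "a ^ 10 \<le> n ^ 10" using n by (intro power_mono) auto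
    also have "\<dots> \<le> n ^ 12" using n by (intro power_increasing) auto
    finally have "a ^ 10 * 1 \<le> n ^ 12 * b ^ 5" using n by (intro mult_mono one_le_power) auto
    hence "a ^ 10 * 1 * a ^ 5 \<le> n ^ 12 * b ^ 5 * a ^ 5" using n by (intro mult_right_mono) auto
    thus ?thesis by simp
  qed
  also have "\<dots> = 2 ^ 390 * n ^ 12 * (a * b) ^ 5" by (simp add: power_mult_distrib)
  also have "\<dots> < I ^ 15" by (rule big)
  finally show ?thesis using power_less_imp_less_base[of "2^26 * a" 15 I] I by simp
qed

text \<open>The number \<open>h * card L\<close> of points of three-space to which the grid leads, with \<open>h\<close>
  about \<open>512 I / a\<close>, has to be small compared to \<open>p\<^sup>2\<close>. The factor is
  \<open>13824 = 27 * 512\<close>, and the tenth power makes all exponents integers.\<close>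
lemma grid_is_small:
  fixes n a b I :: real
  assumes n: "1 \<le> a" "1 \<le> b" "b \<le> n" and big: "2 ^ 390 * n ^ 12 * (a * b) ^ 5 < I ^ 15" and I: "0 \<le> I"
    and pairs: "I\<^sup>2 \<le> 2 * a * b\<^sup>2"
  shows "(13824 * (I / a * b)) ^ 10 < n ^ 16"
proof -
  have "(2 ^ 390 * n ^ 12 * (a * b) ^ 5)\<^sup>2 < (I ^ 15)\<^sup>2" using big n by (intro power_strict_mono) auto
  also have "(I ^ 15)\<^sup>2 = (I\<^sup>2) ^ 15" by (simp flip: power_mult)
  also have "\<dots> \<le> (2 * a * b\<^sup>2) ^ 15" using pairs by (intro power_mono) auto
  also have "\<dots> = (2 ^ 15 * a ^ 5 * b ^ 20) * (a * b) ^ 10"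
    by (simp add: power_mult_distrib mult_ac flip: power_mult)
  also have "(2 ^ 390 * n ^ 12 * (a * b) ^ 5)\<^sup>2 = (2 ^ 780 * n ^ 24) * (a * b) ^ 10"
    by (simp add: power_mult_distrib flip: power_mult)
  finally have A: "2 ^ 780 * n ^ 24 < 2 ^ 15 * a ^ 5 * b ^ 20"
    using n by (subst (asm) mult_less_cancel_right_pos) auto
  have "(I * b) ^ 10 = (I\<^sup>2) ^ 5 * b ^ 10" by (simp add: power_mult_distrib flip: power_mult)
  also have "\<dots> \<le> (2 * a * b\<^sup>2) ^ 5 * b ^ 10" using pairs n by (intro mult_right_mono power_mono) auto
  also have "\<dots> = 2 ^ 5 * a ^ 5 * b ^ 20" by (simp add: power_mult_distrib flip: power_mult power_add)
  finally have B: "(I * b) ^ 10 \<le> 2 ^ 5 * a ^ 5 * b ^ 20" .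
  let ?X = "(13824 * (I / a * b)) ^ 10"
  have "?X * (a ^ 10 * 2 ^ 20) = 13824 ^ 10 * 2 ^ 20 * (I * b) ^ 10" using n
    by (simp add: power_mult_distrib power_divide)
  also have "\<dots> \<le> 13824 ^ 10 * 2 ^ 20 * (2 ^ 5 * a ^ 5 * b ^ 20)" using B by (rule mult_left_mono) simp
  also have "\<dots> \<le> 2 ^ 160 * (2 ^ 5 * a ^ 5 * b ^ 20)" using n by (intro mult_right_mono) auto
  also have "\<dots> = (2 ^ 165 * b ^ 20) * a ^ 5" by simp
  also have "?X * (a ^ 10 * 2 ^ 20) = (?X * a ^ 5 * 2 ^ 20) * a ^ 5" by (simp flip: power_add)
  finally have C: "?X * a ^ 5 * 2 ^ 20 \<le> 2 ^ 165 * b ^ 20" using n by (subst (asm) mult_le_cancel_right_pos) auto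
  show ?thesis
  proof (rule ccontr)
    assume "\<not> ?thesis"
    hence X: "n ^ 16 \<le> ?X" by simp
    have n1: "0 < n" using n by linarith
    have "2 ^ 780 * n ^ 40 = (2 ^ 780 * n ^ 24) * n ^ 16" by (simp flip: power_add)
    also have "\<dots> < (2 ^ 15 * a ^ 5 * b ^ 20) * n ^ 16" using A n1 by (intro mult_strict_right_mono) auto
    also have "\<dots> \<le> (2 ^ 15 * a ^ 5 * b ^ 20) * ?X" using X n by (intro mult_left_mono) auto
    also have "\<dots> = (?X * a ^ 5 * 2 ^ 20) * (b ^ 20 / 2 ^ 5)" by simp
    also have "\<dots> \<le> (2 ^ 165 * b ^ 20) * (b ^ 20 / 2 ^ 5)" using C n by (intro mult_right_mono) auto
    also have "\<dots> = 2 ^ 160 * b ^ 40" by (simp flip: power_add)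
    also have "\<dots> \<le> 2 ^ 160 * n ^ 40" using n by (intro mult_left_mono power_mono) auto
    finally show False using n1 by simp
  qed
qed


text \<open>The grid contains at least \<open>I\<^sup>4 / (256 a\<^sup>3 b\<^sup>2)\<close> points of degree about
  \<open>I / a\<close>. If the bound for the incidences of a grid held, then \<open>I ^ 15\<close> would be at
  most a constant times \<open>(a b) ^ 11\<close>; since \<open>a b \<le> n\<^sup>2\<close>, this
  contradicts the lower bound for \<open>I\<close>.\<close>
lemma grid_not_rich:
  fixes n a b I m J h :: real
  assumes n: "1 \<le> a" "a \<le> n" "1 \<le> b" "b \<le> n" and big: "2 ^ 390 * n ^ 12 * (a * b) ^ 5 < I ^ 15"
    and I: "0 < I" "I \<le> a * b" and m: "0 \<le> m" "(I / a)\<^sup>2 * (I / b)\<^sup>2 \<le> 256 * a * m"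
    and h: "0 \<le> h" "h \<le> 512 * (I / a)" and J: "m * (I / a / 8) \<le> J"
  shows "100000 * h * (h * b) * (sqrt (h * b) + h) < J\<^sup>2"
proof (rule ccontr)
  define d where "d = I / a"
  assume "\<not> ?thesis"
  hence J2: "J\<^sup>2 \<le> 100000 * h * (h * b) * (sqrt (h * b) + h)" by simp
  have d0: "0 < d" using n I by (simp add: d_def)
  have db: "d \<le> b" using n I by (simp add: d_def field_simps)
  have sh: "sqrt (h * b) \<le> 23 * sqrt (d * b)"
  proof -
    have "h * b \<le> 512 * d * b" using h n by (intro mult_right_mono) (auto simp: d_def)
    also have "\<dots> \<le> 23\<^sup>2 * (d * b)" using d0 n by (simp add: mult_right_mono)
    finally have "sqrt (h * b) \<le> sqrt (23\<^sup>2 * (d * b))" by simp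
    thus ?thesis by (simp add: real_sqrt_mult)
  qed
  have "d = sqrt (d * d)" using d0 by simp
  also have "\<dots> \<le> sqrt (d * b)" unfolding real_sqrt_le_iff using db d0 by (intro mult_left_mono) auto
  finally have sd: "d \<le> sqrt (d * b)" .
  have hd: "h \<le> 512 * d" and mJ: "m * (d / 8) \<le> J" using h J by (simp_all add: d_def)
  have s: "sqrt (h * b) + h \<le> 535 * sqrt (d * b)" using sh sd hd by linarith
  have "(m * (d / 8))\<^sup>2 \<le> J\<^sup>2" using mJ m d0 by (intro power_mono) auto
  also note J2
  also have "100000 * h * (h * b) * (sqrt (h * b) + h) \<le> 100000 * (512 * d) * (512 * d * b) * (535 * sqrt (d * b))"
    using s h(1) hd d0 n by (intro mult_mono) auto
  also have "\<dots> \<le> 2 ^ 44 * (d\<^sup>2 * (b * sqrt (d * b)))" using d0 n by (simp add: power2_eq_square)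
  finally have "m\<^sup>2 * d\<^sup>2 \<le> 2 ^ 50 * (b * sqrt (d * b)) * d\<^sup>2" by (simp add: power_mult_distrib power_divide mult_ac)
  hence "m\<^sup>2 \<le> 2 ^ 50 * (b * sqrt (d * b))" using d0 by (subst (asm) mult_le_cancel_right_pos) auto
  hence "(m\<^sup>2)\<^sup>2 \<le> (2 ^ 50 * (b * sqrt (d * b)))\<^sup>2" by (intro power_mono) auto
  also have "\<dots> = 2 ^ 100 * (b ^ 3 * d)" using d0 n by (simp add: power_mult_distrib power2_eq_square power3_eq_cube)
  finally have m4: "m ^ 4 \<le> 2 ^ 100 * (b ^ 3 * d)" by (simp flip: power_mult)
  have "I ^ 16 = ((I / a)\<^sup>2 * (I / b)\<^sup>2) ^ 4 * (a ^ 8 * b ^ 8)" using n by (simp add: power_divide power_mult_distrib flip: power_mult power_add)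
  also have "\<dots> \<le> (256 * a * m) ^ 4 * (a ^ 8 * b ^ 8)" using m(2) n by (intro mult_right_mono power_mono) auto
  also have "\<dots> = 2 ^ 32 * a ^ 12 * b ^ 8 * m ^ 4" by (simp add: power_mult_distrib flip: power_add)
  also have "\<dots> \<le> 2 ^ 32 * a ^ 12 * b ^ 8 * (2 ^ 100 * (b ^ 3 * d))" using m4 n by (intro mult_left_mono) auto
  also have "\<dots> = 2 ^ 132 * (a ^ 11 * b ^ 11) * I" using n by (simp add: d_def power_add[of a 11 1, simplified] flip: power_add)
  finally have "I ^ 15 * I \<le> 2 ^ 132 * (a * b) ^ 11 * I" by (simp add: power_mult_distrib flip: power_Suc2)
  hence "I ^ 15 \<le> 2 ^ 132 * (a * b) ^ 11" using I by (subst (asm) mult_le_cancel_right_pos) auto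
  also have "(a * b) ^ 11 = (a * b) ^ 6 * (a * b) ^ 5" by (simp flip: power_add)
  also have "\<dots> \<le> n ^ 12 * (a * b) ^ 5"
  proof -
    have "(a * b) ^ 6 \<le> (n * n) ^ 6" using n by (intro power_mono mult_mono) auto
    also have "\<dots> = n ^ 12" by (simp add: power_mult_distrib flip: power_add)
    finally show ?thesis using n by (intro mult_right_mono) auto
  qed
  finally have "I ^ 15 \<le> 2 ^ 132 * (n ^ 12 * (a * b) ^ 5)" by simp
  moreover have "0 < n ^ 12 * (a * b) ^ 5" using n by simp
  ultimately show False using big by simp
qed

text \<open>Among all subsets of the points and of the lines, a pair that maximises
  \<open>I\<^sup>3 / (card P * card L)\<close> inherits the excess of incidences and is regular enough to
  contain a rich grid, which cannot exist.\<close>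
theorem projective_incidences:
  fixes V :: "'a::{field,finite} vec3 set"
  assumes char: "\<And>n. 0 < n \<Longrightarrow> n < p \<Longrightarrow> of_nat n \<noteq> (0::'a)" and V: "projective V" and small: "card V ^ 4 \<le> p ^ 5"
  shows "real (incidences (\<lambda>x l. dot x l = 0) V V) ^ 15 \<le> 2 ^ 390 * real (card V) ^ 22"
proof (rule ccontr)
  let ?inc = "\<lambda>x l :: 'a vec3. dot x l = 0"
  let ?I = "\<lambda>P L. real (incidences ?inc P L)"
  define n where "n = real (card V)"
  assume "\<not> ?thesis"
  hence big0: "2 ^ 390 * n ^ 22 < ?I V V ^ 15" by (simp add: n_def)
  have fV: "finite V" by simp
  have ne: "V \<noteq> {}" using big0 by (auto simp: incidences_def)
  hence n1: "1 \<le> n" using fV by (simp add: n_def Suc_le_eq card_gt_0_iff)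
  have C4: "x = x' \<or> l = l'" if "x \<in> V" "x' \<in> V" "l \<in> V" "l' \<in> V" "?inc x l" "?inc x l'" "?inc x' l" "?inc x' l'" for x x' l l'
    using projective_C4_free[OF V that(1,2) V that(3,4)] that by blast
  define \<Phi> where "\<Phi> = (\<lambda>(P, L). ?I P L ^ 3 / (card P * card L))"
  let ?A = "(Pow V - {{}}) \<times> (Pow V - {{}})"
  have "\<exists>z\<in>?A. \<forall>w\<in>?A. \<Phi> w \<le> \<Phi> z" using ne by (intro finite_set_maximizer) auto
  then obtain P L where PL: "(P, L) \<in> ?A" and max: "\<And>w. w \<in> ?A \<Longrightarrow> \<Phi> w \<le> \<Phi> (P, L)" by (metis surj_pair)
  have sub: "P \<subseteq> V" "L \<subseteq> V" "P \<noteq> {}" "L \<noteq> {}" using PL by auto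
  have fin: "finite P" "finite L" by simp_all
  define a where "a = real (card P)"
  define b where "b = real (card L)"
  define I where "I = ?I P L"
  have ab: "1 \<le> a" "a \<le> n" "1 \<le> b" "b \<le> n"
    using sub fin fV by (auto simp: a_def b_def n_def Suc_le_eq card_gt_0_iff card_mono)
  have I0: "0 \<le> I" by (simp add: I_def)
  have ext: "?I P' L' ^ 3 * (card P * card L) \<le> ?I P L ^ 3 * (card P' * card L')" if "P' \<subseteq> P" "L' \<subseteq> L" for P' L'
  proof (cases "P' = {} \<or> L' = {}")
    case True
    hence "incidences ?inc P' L' = 0" by (auto simp: incidences_def)
    thus ?thesis by simp
  next
    case False
    hence "\<Phi> (P', L') \<le> \<Phi> (P, L)" using that sub by (intro max) auto
    moreover have "0 < real (card P' * card L')" "0 < real (card P * card L)" using False sub by (simp_all add: card_gt_0_iff)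
    ultimately show ?thesis by (simp add: \<Phi>_def field_simps)
  qed
  have "\<Phi> (V, V) \<le> \<Phi> (P, L)" using ne by (intro max) auto
  hence ext0: "?I V V ^ 3 * (a * b) \<le> I ^ 3 * n\<^sup>2"
    using ab n1 by (simp add: \<Phi>_def a_def b_def I_def n_def field_simps power2_eq_square)
  have big: "2 ^ 390 * n ^ 12 * (a * b) ^ 5 < I ^ 15"
  proof -
    have "(2 ^ 390 * n ^ 12 * (a * b) ^ 5) * n ^ 10 = (2 ^ 390 * n ^ 22) * (a * b) ^ 5" by (simp flip: power_add)
    also have "\<dots> < ?I V V ^ 15 * (a * b) ^ 5" using big0 ab by (intro mult_strict_right_mono) auto
    also have "\<dots> = (?I V V ^ 3 * (a * b)) ^ 5" by (simp only: power_mult_distrib flip: power_mult) simp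
    also have "\<dots> \<le> (I ^ 3 * n\<^sup>2) ^ 5" using ext0 ab by (intro power_mono) auto
    also have "\<dots> = I ^ 15 * n ^ 10" by (simp add: power_mult_distrib flip: power_mult)
    finally show ?thesis using n1 by (simp add: mult_less_cancel_right_pos)
  qed
  have Ia: "2 ^ 26 * a \<le> I" using rich_on_average[OF ab(1,2,3) big I0] .
  have "2 ^ 390 * n ^ 12 * (b * a) ^ 5 < I ^ 15" using big by (simp add: mult.commute)
  hence Ib: "2 ^ 26 * b \<le> I" using rich_on_average[OF ab(3,4,1) _ I0] by blast
  have Ipos: "0 < I" using Ia ab(1) by simp
  have pairs: "I\<^sup>2 \<le> 2 * a * b\<^sup>2"
  proof -
    have "(incidences ?inc P L)\<^sup>2 \<le> card P * ((card L)\<^sup>2 + incidences ?inc P L)"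
      using C4 sub by (intro incidences_square_le fin) blast
    hence "real ((incidences ?inc P L)\<^sup>2) \<le> real (card P * ((card L)\<^sup>2 + incidences ?inc P L))" by (simp only: of_nat_le_iff)
    hence "I * I \<le> a * b\<^sup>2 + a * I" by (simp add: I_def a_def b_def power2_eq_square algebra_simps)
    moreover have "2 * (a * I) \<le> I * I" using mult_right_mono[of "2 * a" I I] Ia ab(1) I0 by simp
    ultimately show ?thesis by (simp add: power2_eq_square)
  qed
  have IL: "I \<le> a * b"
  proof -
    have "incidences ?inc P L \<le> (\<Sum>x\<in>P. card L)" unfolding incidences_def by (intro sum_mono card_mono) auto
    hence "incidences ?inc P L \<le> card P * card L" by simp
    hence "real (incidences ?inc P L) \<le> real (card P * card L)" by (simp only: of_nat_le_iff)
    thus ?thesis by (simp add: I_def a_def b_def)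
  qed
  define \<delta> where "\<delta> = I / a"
  define \<epsilon> where "\<epsilon> = I / b"
  have \<delta>: "2 ^ 26 \<le> \<delta>" and \<epsilon>: "4 \<le> \<epsilon>" using Ia Ib ab by (simp_all add: \<delta>_def \<epsilon>_def field_simps)
  have \<delta>64: "64 \<le> \<delta>" using \<delta> by simp
  have "\<exists>q1 q2 L1 P'. q1 \<in> P \<and> q2 \<in> P \<and> L1 \<subseteq> L \<and> P' \<subseteq> P \<and> q1 \<noteq> q2 \<and>
    (\<forall>x\<in>P'. x \<noteq> q1 \<and> x \<noteq> q2 \<and>
      (\<exists>l1\<in>L1. \<exists>l2\<in>L1. l1 \<noteq> l2 \<and> ?inc x l1 \<and> ?inc q1 l1 \<and> ?inc x l2 \<and> ?inc q2 l2)) \<and>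
    (\<forall>x\<in>insert q1 (insert q2 P'). real (card {l \<in> L1. ?inc x l}) \<le> 512 * \<delta>) \<and>
    (\<forall>x\<in>P'. \<delta> / 4 \<le> real (card {l \<in> L1. ?inc x l})) \<and>
    \<delta> ^ 2 * \<epsilon> ^ 2 \<le> 256 * card P * real (card P')"
  proof (rule rich_grid[OF fin ext _ _ \<delta> _ \<epsilon>])
    show "\<delta> = real (incidences ?inc P L) / real (card P)" "\<epsilon> = real (incidences ?inc P L) / real (card L)"
      by (simp_all add: \<delta>_def \<epsilon>_def I_def a_def b_def)
    show "x = x' \<or> l = l'" if "x \<in> P" "x' \<in> P" "l \<in> L" "l' \<in> L" "?inc x l" "?inc x l'" "?inc x' l" "?inc x' l'" for x x' l l'
      by (rule C4[OF subsetD[OF sub(1) that(1)] subsetD[OF sub(1) that(2)]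
        subsetD[OF sub(2) that(3)] subsetD[OF sub(2) that(4)] that(5-8)])
  qed
  then obtain q1 q2 L1 P' where q: "q1 \<in> P" "q2 \<in> P" "L1 \<subseteq> L" "P' \<subseteq> P" "q1 \<noteq> q2"
    and grid0: "\<forall>x\<in>P'. x \<noteq> q1 \<and> x \<noteq> q2 \<and>
      (\<exists>l1\<in>L1. \<exists>l2\<in>L1. l1 \<noteq> l2 \<and> ?inc x l1 \<and> ?inc q1 l1 \<and> ?inc x l2 \<and> ?inc q2 l2)"
    and deg: "\<forall>x\<in>insert q1 (insert q2 P'). real (card {l \<in> L1. ?inc x l}) \<le> 512 * \<delta>"
    and rich: "\<forall>x\<in>P'. \<delta> / 4 \<le> real (card {l \<in> L1. ?inc x l})"
    and many: "\<delta> ^ 2 * \<epsilon> ^ 2 \<le> 256 * card P * real (card P')" by (elim exE conjE) (rule that)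
  note grid = bspec[OF grid0]
  define h where "h = nat \<lfloor>512 * \<delta>\<rfloor>"
  have hd: "real h \<le> 512 * \<delta>" using \<delta>64 unfolding h_def by linarith
  have L1: "real (card L1) \<le> b" using q(3) fin by (simp add: b_def card_mono)
  have hb: "real (27 * (h * card L1)) \<le> 13824 * (\<delta> * b)"
    using mult_mono[OF hd L1] \<delta> ab by simp
  have p: "27 * (h * card L1) < p\<^sup>2"
  proof -
    have "real (27 * (h * card L1)) ^ 10 \<le> (13824 * (\<delta> * b)) ^ 10" using hb by (intro power_mono) auto
    also have "\<dots> < n ^ 16" unfolding \<delta>_def using ab by (intro grid_is_small[OF _ _ _ big I0 pairs]) auto
    also have "\<dots> = real ((card V ^ 4) ^ 4)" by (simp add: n_def)
    also have "\<dots> \<le> real ((p ^ 5) ^ 4)" unfolding of_nat_le_iff using small by (rule power_mono) simp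
    also have "\<dots> = real (p\<^sup>2) ^ 10" by simp
    finally have "real (27 * (h * card L1)) < real (p\<^sup>2)" by (rule power_less_imp_less_base) simp
    thus ?thesis by (simp only: of_nat_less_iff)
  qed
  define L2 where "L2 = {l \<in> L1. dot q1 l \<noteq> 0}"
  define J where "J = ?I P' L2"
  have J2: "J ^ 2 \<le> 100000 * h * (h * card L1) * (sqrt (h * card L1) + h)" unfolding J_def L2_def
  proof (rule grid_incidences[OF char p V _ _ _ q(5) V _ grid])
    show "P' \<subseteq> V" "q1 \<in> V" "q2 \<in> V" "L1 \<subseteq> V" using q sub by blast+
    show "card {l \<in> L1. ?inc x l} \<le> h" if "x \<in> insert q1 (insert q2 P')" for x
      using bspec[OF deg that] unfolding h_def by (rule le_nat_floor)
  qed
  have Jl: "card P' * (\<delta> / 8) \<le> J"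
  proof -
    have "\<delta> / 8 \<le> card {l \<in> L2. ?inc x l}" if x: "x \<in> P'" for x
    proof -
      have "card {l \<in> L1. ?inc x l} \<le> card ({l \<in> L2. ?inc x l} \<union> {l \<in> L1. ?inc x l \<and> ?inc q1 l})"
        by (rule card_mono) (auto simp: L2_def)
      also have "\<dots> \<le> card {l \<in> L2. ?inc x l} + card {l \<in> L1. ?inc x l \<and> ?inc q1 l}" by (rule card_Un_le)
      also have "card {l \<in> L1. ?inc x l \<and> ?inc q1 l} \<le> Suc 0"
      proof (subst card_le_Suc0_iff_eq)
        show "\<forall>l\<in>{l \<in> L1. ?inc x l \<and> ?inc q1 l}. \<forall>l'\<in>{l \<in> L1. ?inc x l \<and> ?inc q1 l}. l = l'"
        proof (intro ballI)
          fix l l' assume l: "l \<in> {l \<in> L1. ?inc x l \<and> ?inc q1 l}" "l' \<in> {l \<in> L1. ?inc x l \<and> ?inc q1 l}"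
          have "x \<in> V" "q1 \<in> V" "l \<in> V" "l' \<in> V" using x l q sub by blast+
          moreover have "x \<noteq> q1" using grid[OF x] by blast
          ultimately show "l = l'" using C4[of x q1 l l'] l by simp
        qed
      qed simp
      finally have "real (card {l \<in> L1. ?inc x l}) \<le> real (card {l \<in> L2. ?inc x l}) + 1" by simp
      thus ?thesis using bspec[OF rich x] \<delta>64 by linarith
    qed
    hence "(\<Sum>x\<in>P'. \<delta> / 8) \<le> (\<Sum>x\<in>P'. real (card {l \<in> L2. ?inc x l}))" by (rule sum_mono)
    thus ?thesis by (simp add: J_def incidences_def)
  qed
  have hm: "real h * card L1 \<le> h * b" using L1 by (rule mult_left_mono) simp
  have "100000 * h * (h * card L1) * (sqrt (h * card L1) + h) \<le> 100000 * h * (h * b) * (sqrt (h * b) + h)"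
    using hm ab mult_left_mono[OF hm, of h] by (intro mult_mono add_mono) (auto simp: mult_ac)
  also have "\<dots> < J\<^sup>2" unfolding of_nat_mult of_nat_numeral
    by (rule grid_not_rich[OF ab big Ipos IL _ _ _ _ Jl[unfolded \<delta>_def]])
      (use many hd in \<open>simp_all add: a_def[symmetric] \<delta>_def \<epsilon>_def\<close>)
  finally show False using J2 by simp
qed

section \<open>Incidences by the second moment\<close>

fun scale :: "'a::comm_ring_1 \<Rightarrow> 'a vec3 \<Rightarrow> 'a vec3" where
  "scale c (x1, x2, x3) = (c * x1, c * x2, c * x3)"

lemma dot_scale: "dot (scale c x) l = c * dot x l"
  by (cases x; cases l) (simp add: algebra_simps)

lemma cross_scale: "cross x (scale c x) = zero3"
  by (cases x) (simp add: algebra_simps)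

text \<open>One coordinate is determined by the other two; which one depends on \<open>l\<close>.\<close>
lemma card_plane:
  fixes l :: "'a::{field,finite} vec3"
  assumes "l \<noteq> zero3" shows "card {v. dot v l = 0} = CARD('a)\<^sup>2"
proof -
  obtain l1 l2 l3 where l: "l = (l1, l2, l3)" by (cases l)
  have c: "card (g ` (UNIV :: ('a \<times> 'a) set)) = CARD('a)\<^sup>2" if "inj g" for g :: "'a \<times> 'a \<Rightarrow> 'a vec3"
    by (subst card_image[OF that]) (simp add: power2_eq_square)
  consider "l1 \<noteq> 0" | "l2 \<noteq> 0" | "l3 \<noteq> 0" using assms by (auto simp: l)
  thus ?thesis
  proof cases
    case 1
    have "{v. dot v l = 0} = (\<lambda>(x, y). (- (x * l2 + y * l3) / l1, x, y)) ` UNIV"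
    proof (intro equalityI subsetI)
      fix v assume v: "v \<in> {v. dot v l = 0}"
      obtain v1 v2 v3 where e: "v = (v1, v2, v3)" by (cases v)
      have "v1 * l1 = - (v2 * l2 + v3 * l3)" using v by (simp add: e l algebra_simps eq_neg_iff_add_eq_0)
      hence "v1 = - (v2 * l2 + v3 * l3) / l1" using 1 by (intro eq_divide_imp)
      thus "v \<in> (\<lambda>(x, y). (- (x * l2 + y * l3) / l1, x, y)) ` UNIV" by (force simp: e)
    qed (use 1 in \<open>auto simp: l field_simps\<close>)
    thus ?thesis by (simp only:) (rule c, auto intro: injI)
  next
    case 2
    have "{v. dot v l = 0} = (\<lambda>(x, y). (x, - (x * l1 + y * l3) / l2, y)) ` UNIV"
    proof (intro equalityI subsetI)
      fix v assume v: "v \<in> {v. dot v l = 0}"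
      obtain v1 v2 v3 where e: "v = (v1, v2, v3)" by (cases v)
      have "v2 * l2 = - (v1 * l1 + v3 * l3)" using v by (simp add: e l algebra_simps eq_neg_iff_add_eq_0)
      hence "v2 = - (v1 * l1 + v3 * l3) / l2" using 2 by (intro eq_divide_imp)
      thus "v \<in> (\<lambda>(x, y). (x, - (x * l1 + y * l3) / l2, y)) ` UNIV" by (force simp: e)
    qed (use 2 in \<open>auto simp: l field_simps\<close>)
    thus ?thesis by (simp only:) (rule c, auto intro: injI)
  next
    case 3
    have "{v. dot v l = 0} = (\<lambda>(x, y). (x, y, - (x * l1 + y * l2) / l3)) ` UNIV"
    proof (intro equalityI subsetI)
      fix v assume v: "v \<in> {v. dot v l = 0}"
      obtain v1 v2 v3 where e: "v = (v1, v2, v3)" by (cases v)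
      have "v3 * l3 = - (v1 * l1 + v2 * l2)" using v by (simp add: e l algebra_simps eq_neg_iff_add_eq_0)
      hence "v3 = - (v1 * l1 + v2 * l2) / l3" using 3 by (intro eq_divide_imp)
      thus "v \<in> (\<lambda>(x, y). (x, y, - (x * l1 + y * l2) / l3)) ` UNIV" by (force simp: e)
    qed (use 3 in \<open>auto simp: l field_simps\<close>)
    thus ?thesis by (simp only:) (rule c, auto intro: injI)
  qed
qed

lemma parallel_imp_scale:
  fixes v n :: "'a::field vec3"
  assumes "cross v n = zero3" "n \<noteq> zero3" shows "\<exists>c. v = scale c n"
proof -
  obtain v1 v2 v3 n1 n2 n3 where e: "v = (v1, v2, v3)" "n = (n1, n2, n3)" by (cases v; cases n)
  have c: "v2 * n3 = v3 * n2" "v3 * n1 = v1 * n3" "v1 * n2 = v2 * n1" using assms(1) by (simp_all add: e)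
  consider "n1 \<noteq> 0" | "n2 \<noteq> 0" | "n3 \<noteq> 0" using assms(2) by (auto simp: e)
  thus ?thesis
  proof cases
    case 1 thus ?thesis using c by (intro exI[of _ "v1 / n1"]) (simp add: e field_simps)
  next
    case 2 thus ?thesis using c by (intro exI[of _ "v2 / n2"]) (simp add: e field_simps)
  next
    case 3 thus ?thesis using c by (intro exI[of _ "v3 / n3"]) (simp add: e field_simps)
  qed
qed

lemma card_two_planes:
  fixes l l' :: "'a::{field,finite} vec3"
  assumes "cross l l' \<noteq> zero3" shows "card {v. dot v l = 0 \<and> dot v l' = 0} \<le> CARD('a)"
proof -
  have "{v. dot v l = 0 \<and> dot v l' = 0} \<subseteq> (\<lambda>c. scale c (cross l l')) ` UNIV"
    using parallel_imp_scale[OF cross_cross_orthogonal assms] by blast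
  hence "card {v. dot v l = 0 \<and> dot v l' = 0} \<le> card (UNIV :: 'a set)" by (intro surj_card_le) auto
  thus ?thesis .
qed

text \<open>Two distinct planes through the origin have \<open>q\<close> common vectors, so for a random vector
  \<open>v\<close> the events \<open>v \<cdot> l = 0\<close> are pairwise independent, of probability
  \<open>1/q\<close>.\<close>
lemma variance_of_incidences:
  fixes L :: "'a::{field,finite} vec3 set"
  assumes L: "projective L"
  shows "(\<Sum>v\<in>UNIV. (real (card {l \<in> L. dot v l = 0}) - card L / CARD('a))\<^sup>2)
    \<le> real (card L) * real (CARD('a)) * (real (CARD('a)) - 1)"
proof -
  let ?q = "real (CARD('a))"
  define b where "b = real (card L)"
  define N where "N = (\<lambda>v::'a vec3. real (card {l \<in> L. dot v l = 0}))"
  have q: "?q > 0" by simp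
  have Nsum: "N v = (\<Sum>l\<in>L. of_bool (dot v l = 0))" for v
    by (simp add: N_def sum.If_cases of_bool_def Int_def conj_commute)
  have one: "(\<Sum>v\<in>UNIV. of_bool (dot v l = 0)) = ?q\<^sup>2" if "l \<in> L" for l
  proof -
    have "l \<noteq> zero3" using L that unfolding projective_def by blast
    thus ?thesis using card_plane[of l] by (simp add: sum.If_cases of_bool_def Int_def)
  qed
  have two: "(\<Sum>v\<in>UNIV. of_bool (dot v l = 0) * of_bool (dot v l' = 0)) \<le> ?q + of_bool (l = l') * (?q\<^sup>2 - ?q)"
    if "l \<in> L" "l' \<in> L" for l l'
  proof (cases "l = l'")
    case True
    thus ?thesis using one[OF that(1)] by (simp flip: of_bool_conj)
  next
    case False
    hence "cross l l' \<noteq> zero3" using L that unfolding projective_def by blast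
    moreover have "(\<Sum>v\<in>UNIV. of_bool (dot v l = 0) * of_bool (dot v l' = 0)) = real (card {v. dot v l = 0 \<and> dot v l' = 0})"
      by (subst of_bool_conj[symmetric]) (simp add: sum.If_cases of_bool_def Int_def)
    ultimately show ?thesis using card_two_planes[of l l'] False by simp
  qed
  have s1: "(\<Sum>v\<in>UNIV. N v) = b * ?q\<^sup>2"
  proof -
    have "(\<Sum>v\<in>UNIV. N v) = (\<Sum>l\<in>L. ?q\<^sup>2)" unfolding Nsum by (subst sum.swap) (rule sum.cong[OF refl one])
    thus ?thesis by (simp add: b_def)
  qed
  have "(\<Sum>v\<in>UNIV. (N v)\<^sup>2) = (\<Sum>v\<in>UNIV. \<Sum>l\<in>L. \<Sum>l'\<in>L. of_bool (dot v l = 0) * of_bool (dot v l' = 0))"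
    unfolding Nsum power2_eq_square sum_product ..
  also have "\<dots> = (\<Sum>l\<in>L. \<Sum>v\<in>UNIV. \<Sum>l'\<in>L. of_bool (dot v l = 0) * of_bool (dot v l' = 0))" by (rule sum.swap)
  also have "\<dots> = (\<Sum>l\<in>L. \<Sum>l'\<in>L. \<Sum>v\<in>UNIV. of_bool (dot v l = 0) * of_bool (dot v l' = 0))"
    by (rule sum.cong[OF refl], rule sum.swap)
  also have "\<dots> \<le> (\<Sum>l\<in>L. \<Sum>l'\<in>L. ?q + of_bool (l = l') * (?q\<^sup>2 - ?q))" by (intro sum_mono two)
  also have "\<dots> = (\<Sum>l\<in>L. b * ?q + (?q\<^sup>2 - ?q))"
    by (intro sum.cong refl) (simp add: sum.distrib b_def flip: sum_distrib_right)
  also have "\<dots> = b * (b * ?q + (?q\<^sup>2 - ?q))" by (simp add: b_def)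
  finally have s2: "(\<Sum>v\<in>UNIV. (N v)\<^sup>2) \<le> b * (b * ?q + (?q\<^sup>2 - ?q))" .
  have "(\<Sum>v\<in>UNIV. (N v - b / ?q)\<^sup>2) = (\<Sum>v\<in>UNIV. (N v)\<^sup>2 - 2 * (b / ?q) * N v + (b / ?q)\<^sup>2)"
    by (intro sum.cong refl) (simp add: power2_diff)
  also have "\<dots> = (\<Sum>v\<in>UNIV. (N v)\<^sup>2) - 2 * (b / ?q) * (b * ?q\<^sup>2) + ?q ^ 3 * (b / ?q)\<^sup>2"
    unfolding sum.distrib sum_subtractf sum_distrib_left[symmetric] s1 by (simp add: power3_eq_cube)
  also have "\<dots> = (\<Sum>v\<in>UNIV. (N v)\<^sup>2) - b\<^sup>2 * ?q" using q by (simp add: field_simps power2_eq_square power3_eq_cube)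
  also have "\<dots> \<le> b * ?q * (?q - 1)" using s2 by (simp add: algebra_simps power2_eq_square)
  finally show ?thesis by (simp add: N_def b_def)
qed

text \<open>The number of lines through a vector does not change when the vector is multiplied by one of the
  \<open>q - 1\<close> nonzero scalars, so each projective point has this weight in the second moment over all
  vectors.\<close>
theorem incidences_by_second_moment:
  fixes V W :: "'a::{field,finite} vec3 set"
  assumes V: "projective V" and W: "projective W"
  shows "real (incidences (\<lambda>x l. dot x l = 0) V W)
    \<le> card V * card W / CARD('a) + sqrt (CARD('a) * card V * card W)"
proof -
  let ?q = "real (CARD('a))"
  let ?f = "\<lambda>v::'a vec3. real (card {l \<in> W. dot v l = 0}) - card W / ?q"
  have q: "?q > 1"
  proof -
    have "card {0, 1::'a} \<le> CARD('a)" by (rule card_mono) auto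
    thus ?thesis by simp
  qed
  have fs: "?f (scale c x) = ?f x" if "c \<noteq> 0" for c x using that by (simp add: dot_scale)
  have "(?q - 1) * (\<Sum>x\<in>V. (?f x)\<^sup>2) = (\<Sum>x\<in>V. \<Sum>c\<in>UNIV - {0}. (?f (scale c x))\<^sup>2)"
  proof -
    have "(\<Sum>x\<in>V. \<Sum>c\<in>UNIV - {0}. (?f (scale c x))\<^sup>2) = (\<Sum>x\<in>V. \<Sum>c\<in>UNIV - {0::'a}. (?f x)\<^sup>2)"
      by (intro sum.cong refl) (use fs in auto)
    thus ?thesis using q by (simp add: sum_distrib_left card_Diff_singleton of_nat_diff)
  qed
  also have "\<dots> = (\<Sum>(x, c)\<in>V \<times> (UNIV - {0}). (?f (scale c x))\<^sup>2)" by (rule sum.cartesian_product)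
  also have "\<dots> = (\<Sum>v\<in>(\<lambda>(x, c). scale c x) ` (V \<times> (UNIV - {0})). (?f v)\<^sup>2)"
  proof (subst sum.reindex)
    show "inj_on (\<lambda>(x, c). scale c x) (V \<times> (UNIV - {0}))"
    proof (rule inj_onI)
      fix u v assume u: "u \<in> V \<times> (UNIV - {0})" and v: "v \<in> V \<times> (UNIV - {0})"
        and e: "(\<lambda>(x, c). scale c x) u = (\<lambda>(x, c). scale c x) v"
      obtain x c y d where uv: "u = (x, c)" "v = (y, d)" by (cases u; cases v)
      have e': "scale c x = scale d y" using e by (simp add: uv)
      have x0: "x \<noteq> zero3" using u V unfolding projective_def uv by blast
      have cd: "c \<noteq> 0" "d \<noteq> 0" using u v by (simp_all add: uv)
      have "scale c x \<noteq> zero3" using x0 cd(1) by (cases x) auto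
      hence "cross x y = zero3"
        by (intro cross_trans[of x "scale c x" y]) (simp_all add: cross_scale e', metis cross_scale e')
      hence "x = y" using u v V unfolding projective_def uv by blast
      moreover have "c = d" using e' x0 by (cases x) (auto simp: \<open>x = y\<close>[symmetric])
      ultimately show "u = v" by (simp add: uv)
    qed
  qed (simp add: case_prod_unfold)
  also have "\<dots> \<le> (\<Sum>v\<in>UNIV. (?f v)\<^sup>2)" by (rule sum_mono2) auto
  also have "\<dots> \<le> card W * ?q * (?q - 1)" by (rule variance_of_incidences[OF W])
  finally have "(\<Sum>x\<in>V. (?f x)\<^sup>2) * (?q - 1) \<le> card W * ?q * (?q - 1)" by (simp only: mult.commute)
  hence var: "(\<Sum>x\<in>V. (?f x)\<^sup>2) \<le> card W * ?q" using q by (subst (asm) mult_le_cancel_right_pos) auto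
  have "(\<Sum>x\<in>V. ?f x)\<^sup>2 \<le> card V * (\<Sum>x\<in>V. (?f x)\<^sup>2)" by (rule square_sum_le_card_mult_sum_squares) simp
  also have "\<dots> \<le> card V * (card W * ?q)" using var by (rule mult_left_mono) simp
  finally have "(\<Sum>x\<in>V. ?f x) \<le> sqrt (card V * (card W * ?q))" by (rule real_le_rsqrt)
  moreover have "(\<Sum>x\<in>V. ?f x) = incidences (\<lambda>x l. dot x l = 0) V W - card V * card W / ?q"
    by (simp add: sum_subtractf incidences_def)
  ultimately show ?thesis by (simp add: mult_ac)
qed

section \<open>Right angles on the sphere\<close>

lemma dot_add: "dot (x + y) z = dot x z + dot y z" "dot z (x + y) = dot z x + dot z y"
  by (cases x; cases y; cases z; simp add: algebra_simps)+

lemma dot_diff: "dot (x - y) z = dot x z - dot y z" "dot z (x - y) = dot z x - dot z y"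
  by (cases x; cases y; cases z; simp add: algebra_simps)+

lemma dot_scale_right: "dot l (scale c x) = c * dot l x"
  by (simp add: dot_commute[of l] dot_scale)

lemma zero3_eq: "zero3 = 0"
  by (simp add: zero_prod_def)

lemma dot_zero: "dot 0 z = 0" "dot z 0 = 0"
  by (cases z; simp add: zero_prod_def)+

lemma scale_0: "scale 0 x = 0"
  by (cases x) (simp add: zero_prod_def)

lemma scale_1: "scale 1 x = x"
  by (cases x) simp

text \<open>For \<open>u = x + y - z\<close> the difference \<open>u \<cdot> u - t\<close> equals
  \<open>2 (x - z) \<cdot> (y - z)\<close>.\<close>
lemma parallelogram_on_sphere:
  fixes x y z :: "'a::field vec3"
  assumes two: "(2::'a) \<noteq> 0" and s: "dot x x = t" "dot y y = t" "dot z z = t" "dot u u = t" and u: "x + y = z + u"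
  shows "dot (x - z) (y - z) = 0"
proof -
  have "u = x + y - z" using u by (simp add: algebra_simps)
  hence "dot u u = (dot x x + dot y y + dot z z) + 2 * dot x y - 2 * dot x z - 2 * dot y z"
    by (simp add: dot_add dot_diff dot_commute[of y x] dot_commute[of z x] dot_commute[of z y])
  hence "2 * dot (x - z) (y - z) = 0"
    using s by (simp add: dot_diff dot_commute[of z y] algebra_simps)
  thus ?thesis using two by simp
qed

text \<open>A chord \<open>v\<close> at \<open>z\<close> satisfies \<open>v \<cdot> v = - 2 v \<cdot> z\<close>, and
  when \<open>v \<cdot> v\<close> is not zero this fixes the length of \<open>v\<close> in its direction.\<close>
lemma projective_chords:
  fixes z :: "'a::field vec3"
  assumes A: "A \<subseteq> {x. dot x x = t}" and z: "dot z z = t"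
  shows "projective ((\<lambda>x. x - z) ` {x \<in> A. dot (x - z) (x - z) \<noteq> 0})"
  unfolding projective_def
proof (intro conjI ballI impI)
  let ?V = "(\<lambda>x. x - z) ` {x \<in> A. dot (x - z) (x - z) \<noteq> 0}"
  show "zero3 \<notin> ?V" by (auto simp: zero3_eq dot_zero)
  have chord: "dot v v + 2 * dot v z = 0" if "v \<in> ?V" for v
  proof -
    obtain x where x: "x \<in> A" "v = x - z" using \<open>v \<in> ?V\<close> by blast
    have "dot x x = t" using x A by blast
    thus ?thesis using z by (simp add: x dot_diff dot_commute[of z x] algebra_simps)
  qed
  fix v w assume v: "v \<in> ?V" and w: "w \<in> ?V" and c: "cross v w = zero3"
  have vv: "dot v v \<noteq> 0" and ww: "dot w w \<noteq> 0" using v w by auto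
  have "w \<noteq> zero3" using ww by (auto simp: zero3_eq dot_zero)
  then obtain c where vw: "v = scale c w" using parallel_imp_scale[OF c] by blast
  have c0: "c \<noteq> 0" using vv by (auto simp: vw scale_0 dot_zero)
  have "c * (c * dot w w + 2 * dot w z) = 0" using chord[OF v] by (simp add: vw dot_scale dot_scale_right algebra_simps)
  hence "c * dot w w + 2 * dot w z = dot w w + 2 * dot w z" using c0 chord[OF w] by simp
  hence "c * dot w w = dot w w" by simp
  hence "c = 1" using ww by simp
  thus "v = w" by (simp add: vw scale_1)
qed

text \<open>Otherwise \<open>z\<close> and \<open>v\<close> are both orthogonal to the plane of \<open>v\<close> and
  \<open>w\<close>, hence parallel, but only one of them is isotropic.\<close>
lemma orthogonal_to_isotropic:
  fixes v w z :: "'a::field vec3"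
  assumes v: "v \<noteq> zero3" "dot v v = 0" and z: "dot z z \<noteq> 0" "dot z v = 0" and w: "dot w v = 0" "dot w z = 0"
  shows "\<exists>c. w = scale c v"
proof -
  have "cross w v = zero3"
  proof (rule ccontr)
    assume n: "cross w v \<noteq> zero3"
    have "cross z (cross w v) = zero3" "cross v (cross w v) = zero3"
      using z w v by (auto intro!: cross_cross_orthogonal simp: dot_commute)
    hence "cross z v = zero3" using n by (rule cross_trans)
    then obtain c where c: "z = scale c v" using parallel_imp_scale v by blast
    show False using z v by (simp add: c dot_scale dot_scale_right)
  qed
  thus ?thesis using parallel_imp_scale v by blast
qed

lemma dot_cross_cross: "dot (cross x y) (cross x y) = dot x x * dot y y - (dot x y)\<^sup>2"
  by (cases x; cases y) (simp add: algebra_simps power2_eq_square)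

text \<open>The plane orthogonal to an isotropic \<open>v\<close> contains \<open>v\<close> and meets the sphere in two
  lines of direction \<open>v\<close>: as \<open>y\<close> and \<open>z\<close> are orthogonal to
  \<open>v\<close>, their cross product is a multiple of \<open>v\<close>, so it is isotropic, and the identity of
  Lagrange gives \<open>(y \<cdot> z)\<^sup>2 = t\<^sup>2\<close>.\<close>
lemma isotropic_tangent_section:
  fixes v y z :: "'a::field vec3"
  assumes v: "v \<noteq> zero3" "dot v v = 0" and z: "dot z z = t" "t \<noteq> 0" "dot z v = 0" and y: "dot y y = t" "dot y v = 0"
  shows "\<exists>c. y = z + scale c v \<or> y = - z + scale c v"
proof -
  have "cross v (cross y z) = zero3" using y z by (intro cross_cross_orthogonal) (simp_all add: dot_commute)
  have "(dot y z)\<^sup>2 = t\<^sup>2"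
  proof (cases "cross y z = zero3")
    case True
    thus ?thesis using dot_cross_cross[of y z] y z by (simp add: power2_eq_square)
  next
    case False
    then obtain c where c: "v = scale c (cross y z)" using parallel_imp_scale[OF \<open>cross v (cross y z) = zero3\<close>] by blast
    have "c \<noteq> 0" using v(1) unfolding c by (auto simp: scale_0 zero3_eq)
    hence "dot (cross y z) (cross y z) = 0" using v(2) by (simp add: c dot_scale dot_scale_right)
    thus ?thesis using dot_cross_cross[of y z] y z by (simp add: power2_eq_square)
  qed
  hence "(dot y z - t) * (dot y z + t) = 0" by (simp add: algebra_simps power2_eq_square)
  then consider "dot y z = t" | "dot y z = - t" by (auto simp: eq_neg_iff_add_eq_0)
  thus ?thesis
  proof cases
    case 1
    have "\<exists>c. y - z = scale c v" by (rule orthogonal_to_isotropic[of v z]) (use assms 1 in \<open>simp_all add: dot_diff\<close>)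
    thus ?thesis by (metis add_diff_cancel_left' diff_add_cancel add.commute)
  next
    case 2
    have "\<exists>c. y + z = scale c v" by (rule orthogonal_to_isotropic[of v z]) (use assms 2 in \<open>simp_all add: dot_add\<close>)
    then obtain c where "y + z = scale c v" by blast
    hence "y = - z + scale c v" by (metis add.commute add_diff_cancel_right' diff_conv_add_uminus)
    thus ?thesis by blast
  qed
qed

lemma cross_cross_self: "cross z (cross z v) = scale (dot z v) z - scale (dot z z) v"
  by (cases z; cases v) (simp add: algebra_simps)

lemma triple_swap: "dot (cross z v) w = - dot (cross z w) v" "dot (cross z v) w = dot z (cross v w)"
  by (cases z; cases v; cases w; simp add: algebra_simps)+

text \<open>Both \<open>v\<close> and \<open>cross z v\<close> are orthogonal to \<open>z\<close> and to \<open>v\<close>,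
  hence parallel; on the plane orthogonal to \<open>z\<close> the square of \<open>cross z\<close> is
  multiplication by \<open>-t\<close>.\<close>
lemma isotropic_eigenvector:
  fixes v z :: "'a::field vec3"
  assumes v: "v \<noteq> zero3" "dot v v = 0" and z: "dot z z = t" "t \<noteq> 0" "dot z v = 0"
  shows "\<exists>r. cross z v = scale r v \<and> r\<^sup>2 = - t"
proof -
  have "cross (cross z v) v = zero3"
  proof -
    have "cross v (cross z v) = zero3" using v z by (intro cross_cross_orthogonal) (simp_all add: dot_commute)
    thus ?thesis by (cases v; cases "cross z v") (simp add: algebra_simps)
  qed
  then obtain r where r: "cross z v = scale r v" using parallel_imp_scale v by blast
  have lin: "cross z (scale r v) = scale r (cross z v)" by (cases z; cases v) (simp add: algebra_simps)
  have "scale r (scale r v) = scale (- t) v"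
    using cross_cross_self[of z v] z by (simp add: r lin) (cases v; simp add: scale_0 zero_prod_def)
  hence "r * r = - t" using v(1) by (cases v) (auto simp flip: mult.assoc mult_minus_left)
  thus ?thesis using r by (auto simp: power2_eq_square)
qed

lemma isotropic_same_eigenvalue:
  fixes v w z :: "'a::field vec3"
  assumes two: "(2::'a) \<noteq> 0" and v: "v \<noteq> zero3" "dot z v = 0" "cross z v = scale r v" 
    and w: "dot z w = 0" "cross z w = scale r w" and z: "dot z z \<noteq> 0"
  shows "\<exists>c. w = scale c v"
proof -
  have "dot (cross z v) w = - dot (cross z w) v" by (rule triple_swap)
  hence "r * dot v w = - (r * dot v w)" by (simp add: v w dot_scale dot_commute[of w v])
  hence "2 * (r * dot v w) = 0" by (simp add: eq_neg_iff_add_eq_0)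
  hence "r * dot v w = 0" using two by simp
  hence "dot (cross z v) w = 0" by (simp add: v dot_scale)
  hence d: "dot z (cross v w) = 0" using triple_swap(2)[of z v w] by simp
  have "cross z (cross v w) = zero3" using v w by (intro cross_cross_orthogonal)
  hence "cross (cross v w) z = zero3" by (cases z; cases "cross v w") (simp add: algebra_simps)
  moreover have "z \<noteq> zero3" using z by (auto simp: zero3_eq dot_zero)
  ultimately obtain c where c: "cross v w = scale c z" using parallel_imp_scale by blast
  have "c = 0" using d z by (simp add: c dot_scale_right)
  hence "cross v w = zero3" by (simp add: c scale_0 zero3_eq)
  hence "cross w v = zero3" by (cases v; cases w) (simp add: algebra_simps)
  thus ?thesis using parallel_imp_scale v by blast
qed

lemma isotropic_chord_tangent:
  fixes x z :: "'a::field vec3"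
  assumes two: "(2::'a) \<noteq> 0" and "dot x x = t" "dot z z = t" "dot (x - z) (x - z) = 0"
  shows "dot z (x - z) = 0"
proof -
  have "2 * dot z (x - z) = dot x x - dot z z - dot (x - z) (x - z)"
    by (simp add: dot_diff dot_commute[of z x] algebra_simps)
  hence "2 * dot z (x - z) = 0" unfolding assms by simp
  thus ?thesis using two by simp
qed

text \<open>Isotropic chords at \<open>z\<close> are orthogonal to \<open>z\<close>, and two of them are parallel if they
  are eigenvectors of \<open>cross z\<close> for the same of the two square roots of \<open>-t\<close>.\<close>
lemma few_isotropic_chords:
  fixes A :: "'a::{field,finite} vec3 set"
  assumes two: "(2::'a) \<noteq> 0" and A: "A \<subseteq> {x. dot x x = t}" "t \<noteq> 0" and z: "z \<in> A"
    and iso: "\<And>a s. s \<noteq> 0 \<Longrightarrow> dot s s = 0 \<Longrightarrow> card (A \<inter> range (\<lambda>c. a + scale c s)) \<le> k"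
  shows "card {x \<in> A. x \<noteq> z \<and> dot (x - z) (x - z) = 0} \<le> 2 * k"
proof -
  have zt: "dot z z = t" using z A by blast
  let ?X = "{x \<in> A. x \<noteq> z \<and> dot (x - z) (x - z) = 0}"
  let ?E = "\<lambda>r. {x \<in> ?X. cross z (x - z) = scale r (x - z)}"
  have perp: "dot z (x - z) = 0" if "x \<in> ?X" for x
    by (rule isotropic_chord_tangent[OF two _ zt]) (use that A in auto)
  have E: "card (?E r) \<le> k" for r
  proof (cases "?E r = {}")
    case False
    then obtain x where x: "x \<in> ?E r" by blast
    have x0: "x - z \<noteq> 0" using x by simp
    have "?E r \<subseteq> A \<inter> range (\<lambda>c. z + scale c (x - z))"
    proof
      fix y assume y: "y \<in> ?E r"
      have "\<exists>c. y - z = scale c (x - z)"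
        by (rule isotropic_same_eigenvalue[OF two, where r = r and z = z])
          (use x y x0 perp[of x] perp[of y] zt A in \<open>auto simp: zero3_eq\<close>)
      then obtain c where "y - z = scale c (x - z)" by blast
      hence "y = z + scale c (x - z)" by (simp add: algebra_simps)
      thus "y \<in> A \<inter> range (\<lambda>c. z + scale c (x - z))" using y by blast
    qed
    hence "card (?E r) \<le> card (A \<inter> range (\<lambda>c. z + scale c (x - z)))" by (intro card_mono) auto
    also have "\<dots> \<le> k" using x x0 by (intro iso) auto
    finally show ?thesis .
  next
    case True
    show ?thesis by (simp only: True card.empty le0)
  qed
  have ev: "\<exists>r. x \<in> ?E r \<and> r\<^sup>2 = - t" if x: "x \<in> ?X" for x
  proof -
    have "\<exists>r. cross z (x - z) = scale r (x - z) \<and> r\<^sup>2 = - t"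
      by (rule isotropic_eigenvector) (use x perp[OF x] zt A in \<open>auto simp: zero3_eq\<close>)
    thus ?thesis using x by blast
  qed
  show ?thesis
  proof (cases "?X = {}")
    case False
    then obtain r where r: "r\<^sup>2 = - t" using ev by blast
    have "?X \<subseteq> ?E r \<union> ?E (- r)"
    proof
      fix x assume "x \<in> ?X"
      then obtain s where s: "x \<in> ?E s" "s\<^sup>2 = - t" using ev by blast
      hence "s = r \<or> s = - r" using r by (simp flip: power2_eq_iff)
      thus "x \<in> ?E r \<union> ?E (- r)" using s by blast
    qed
    hence "card ?X \<le> card (?E r \<union> ?E (- r))" by (intro card_mono) auto
    also have "\<dots> \<le> card (?E r) + card (?E (- r))" by (rule card_Un_le)
    also have "\<dots> \<le> k + k" by (intro add_mono E)
    finally show ?thesis by simp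
  next
    case True
    show ?thesis by (simp only: True card.empty le0)
  qed
qed

lemma few_orthogonal_to_isotropic_chord:
  fixes A :: "'a::{field,finite} vec3 set"
  assumes two: "(2::'a) \<noteq> 0" and A: "A \<subseteq> {x. dot x x = t}" "t \<noteq> 0" and z: "z \<in> A"
    and iso: "\<And>a s. s \<noteq> 0 \<Longrightarrow> dot s s = 0 \<Longrightarrow> card (A \<inter> range (\<lambda>c. a + scale c s)) \<le> k"
    and x: "x \<in> A" "x \<noteq> z" "dot (x - z) (x - z) = 0"
  shows "card {y \<in> A. dot (x - z) (y - z) = 0} \<le> 2 * k"
proof -
  have zt: "dot z z = t" "dot x x = t" using z x A by auto
  define v where "v = x - z"
  have v: "v \<noteq> 0" "dot v v = 0" using x by (simp_all add: v_def)
  have zv: "dot z v = 0" unfolding v_def by (rule isotropic_chord_tangent[OF two zt(2,1) x(3)])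
  let ?l = "\<lambda>a. A \<inter> range (\<lambda>c. a + scale c v)"
  have "{y \<in> A. dot v (y - z) = 0} \<subseteq> ?l z \<union> ?l (- z)"
  proof
    fix y assume y: "y \<in> {y \<in> A. dot v (y - z) = 0}"
    have yA: "y \<in> A" "dot v (y - z) = 0" using y by simp_all
    have "dot y y = t" using yA(1) A(1) by blast
    moreover have "dot y v = 0" using yA(2) zv by (simp add: dot_diff dot_commute[of v])
    ultimately have "\<exists>c. y = z + scale c v \<or> y = - z + scale c v"
      using v by (intro isotropic_tangent_section[OF _ v(2) zt(1) A(2) zv]) (simp_all add: zero3_eq)
    thus "y \<in> ?l z \<union> ?l (- z)" using y by blast
  qed
  hence "card {y \<in> A. dot v (y - z) = 0} \<le> card (?l z \<union> ?l (- z))" by (intro card_mono) auto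
  also have "\<dots> \<le> card (?l z) + card (?l (- z))" by (rule card_Un_le)
  also have "\<dots> \<le> k + k" using v by (intro add_mono iso)
  finally show ?thesis by (simp add: v_def)
qed

lemma right_angles_at_vertex:
  fixes A :: "'a::{field,finite} vec3 set"
  assumes two: "(2::'a) \<noteq> 0" and A: "A \<subseteq> {x. dot x x = t}" "t \<noteq> 0" and z: "z \<in> A"
    and iso: "\<And>a s. s \<noteq> 0 \<Longrightarrow> dot s s = 0 \<Longrightarrow> card (A \<inter> range (\<lambda>c. a + scale c s)) \<le> k"
    and V: "V = (\<lambda>x. x - z) ` {x \<in> A. dot (x - z) (x - z) \<noteq> 0}"
  shows "card {(x, y). x \<in> A \<and> y \<in> A \<and> dot (x - z) (y - z) = 0}
    \<le> 2 * card A + 8 * k\<^sup>2 + incidences (\<lambda>x l. dot x l = 0) V V"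
proof -
  let ?X = "{x \<in> A. x \<noteq> z \<and> dot (x - z) (x - z) = 0}"
  let ?S = "SIGMA x:?X. {y \<in> A. dot (x - z) (y - z) = 0}"
  let ?N = "{(x, y). x \<in> V \<and> y \<in> V \<and> dot x y = 0}"
  let ?f = "\<lambda>w. (fst w + z, snd w + z)"
  have S: "card ?S \<le> 4 * k\<^sup>2"
  proof -
    have "card ?S = (\<Sum>x\<in>?X. card {y \<in> A. dot (x - z) (y - z) = 0})" by (simp add: card_SigmaI)
    also have "\<dots> \<le> (\<Sum>x\<in>?X. 2 * k)"
      by (intro sum_mono few_orthogonal_to_isotropic_chord[OF two A z iso]) auto
    also have "\<dots> = card ?X * (2 * k)" by simp
    also have "\<dots> \<le> (2 * k) * (2 * k)"
      by (intro mult_right_mono few_isotropic_chords[OF two A z iso]) auto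
    finally show ?thesis by (simp add: power2_eq_square)
  qed
  have "{(x, y). x \<in> A \<and> y \<in> A \<and> dot (x - z) (y - z) = 0}
    \<subseteq> ({z} \<times> A \<union> A \<times> {z}) \<union> (?S \<union> prod.swap ` ?S) \<union> ?f ` ?N"
  proof
    fix w assume "w \<in> {(x, y). x \<in> A \<and> y \<in> A \<and> dot (x - z) (y - z) = 0}"
    then obtain x y where w: "w = (x, y)" and xy: "x \<in> A" "y \<in> A" "dot (x - z) (y - z) = 0" by blast
    have yx: "dot (y - z) (x - z) = 0" using xy(3) by (simp add: dot_commute)
    consider "x = z \<or> y = z" | "x \<in> ?X" | "y \<in> ?X" | "dot (x - z) (x - z) \<noteq> 0" "dot (y - z) (y - z) \<noteq> 0"
      using xy by blast
    thus "w \<in> ({z} \<times> A \<union> A \<times> {z}) \<union> (?S \<union> prod.swap ` ?S) \<union> ?f ` ?N"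
    proof cases
      case 1 thus ?thesis using xy unfolding w by blast
    next
      case 2 thus ?thesis using xy unfolding w by blast
    next
      case 3
      hence "(y, x) \<in> ?S" using xy(1) yx by blast
      hence "prod.swap (y, x) \<in> prod.swap ` ?S" by (rule imageI)
      thus ?thesis unfolding w by simp
    next
      case 4
      hence "x - z \<in> V" "y - z \<in> V" using xy unfolding V by blast+
      hence "(x - z, y - z) \<in> ?N" using xy by blast
      hence "?f (x - z, y - z) \<in> ?f ` ?N" by (rule imageI)
      thus ?thesis unfolding w by simp
    qed
  qed
  hence "card {(x, y). x \<in> A \<and> y \<in> A \<and> dot (x - z) (y - z) = 0}
    \<le> card (({z} \<times> A \<union> A \<times> {z}) \<union> (?S \<union> prod.swap ` ?S) \<union> ?f ` ?N)" by (intro card_mono) auto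
  also have "\<dots> \<le> (card ({z} \<times> A) + card (A \<times> {z})) + (card ?S + card (prod.swap ` ?S)) + card (?f ` ?N)"
    by (intro order_trans[OF card_Un_le] add_mono card_Un_le order_refl)
  also have "\<dots> \<le> (card A + card A) + (4 * k\<^sup>2 + 4 * k\<^sup>2) + card ?N"
    using S card_image_le[of ?S prod.swap] by (intro add_mono card_image_le) auto
  also have "card ?N = incidences (\<lambda>x l. dot x l = 0) V V" by (rule incidences_card[symmetric]) simp_all
  finally show ?thesis by simp
qed

text \<open>The fourth point \<open>u\<close> is determined by the others, so the energy is at most the number of right
  angles.\<close>
theorem energy_on_sphere:
  fixes A :: "'a::{field,finite} vec3 set" and B :: real
  assumes two: "(2::'a) \<noteq> 0" and A: "A \<subseteq> {x. dot x x = t}" "t \<noteq> 0"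
    and iso: "\<And>a s. s \<noteq> 0 \<Longrightarrow> dot s s = 0 \<Longrightarrow> card (A \<inter> range (\<lambda>c. a + scale c s)) \<le> k"
    and B: "\<And>V :: 'a vec3 set. projective V \<Longrightarrow> card V \<le> card A \<Longrightarrow> real (incidences (\<lambda>x l. dot x l = 0) V V) \<le> B"
  shows "real (card {(x, y, z, u). x \<in> A \<and> y \<in> A \<and> z \<in> A \<and> u \<in> A \<and> x + y = z + u})
    \<le> real (card A) * (2 * real (card A) + 8 * (real k)\<^sup>2 + B)"
proof -
  let ?R = "\<lambda>z. {(x, y). x \<in> A \<and> y \<in> A \<and> dot (x - z) (y - z) = 0}"
  have R: "real (card (?R z)) \<le> 2 * real (card A) + 8 * (real k)\<^sup>2 + B" if z: "z \<in> A" for z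
  proof -
    define V where "V = (\<lambda>x. x - z) ` {x \<in> A. dot (x - z) (x - z) \<noteq> 0}"
    have "card V \<le> card {x \<in> A. dot (x - z) (x - z) \<noteq> 0}" unfolding V_def by (rule card_image_le) simp
    also have "\<dots> \<le> card A" by (rule card_mono) auto
    finally have c: "card V \<le> card A" .
    have "dot z z = t" using z A by blast
    hence "projective V" unfolding V_def by (rule projective_chords[OF A(1)])
    hence b: "real (incidences (\<lambda>x l. dot x l = 0) V V) \<le> B" using c by (rule B)
    have "card (?R z) \<le> 2 * card A + 8 * k\<^sup>2 + incidences (\<lambda>x l. dot x l = 0) V V"
      by (rule right_angles_at_vertex[OF two A z iso V_def])
    hence "real (card (?R z)) \<le> real (2 * card A + 8 * k\<^sup>2 + incidences (\<lambda>x l. dot x l = 0) V V)" by (simp only: of_nat_le_iff)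
    thus ?thesis using b by simp
  qed
  have "card {(x, y, z, u). x \<in> A \<and> y \<in> A \<and> z \<in> A \<and> u \<in> A \<and> x + y = z + u} \<le> card (SIGMA z:A. ?R z)"
  proof (rule card_inj_on_le)
    let ?E = "{(x, y, z, u). x \<in> A \<and> y \<in> A \<and> z \<in> A \<and> u \<in> A \<and> x + y = z + u}"
    let ?g = "\<lambda>w. (fst (snd (snd w)), fst w, fst (snd w))"
    have E: "\<exists>x y z u. w = (x, y, z, u) \<and> x \<in> A \<and> y \<in> A \<and> z \<in> A \<and> u \<in> A \<and> x + y = z + u" if "w \<in> ?E" for w
      using that by blast
    show "inj_on ?g ?E"
    proof (rule inj_onI)
      fix w w' assume w: "w \<in> ?E" "w' \<in> ?E" and e: "?g w = ?g w'"
      obtain x y z u where 1: "w = (x, y, z, u)" "x + y = z + u" using E[OF w(1)] by blast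
      obtain x' y' z' u' where 2: "w' = (x', y', z', u')" "x' + y' = z' + u'" using E[OF w(2)] by blast
      have e': "x = x'" "y = y'" "z = z'" using e unfolding 1 2 by simp_all
      hence "z + u = z + u'" using 1(2) 2(2) by simp
      hence "u = u'" by simp
      thus "w = w'" using e' unfolding 1 2 by simp
    qed
    show "?g ` ?E \<subseteq> (SIGMA z:A. ?R z)"
    proof (rule image_subsetI)
      fix w assume w: "w \<in> ?E"
      obtain x y z u where e: "w = (x, y, z, u)" and m: "x \<in> A" "y \<in> A" "z \<in> A" "u \<in> A" and s: "x + y = z + u"
        using E[OF w] by blast
      have "dot (x - z) (y - z) = 0" by (rule parallelogram_on_sphere[OF two _ _ _ _ s]) (use m A in blast)+
      thus "?g w \<in> (SIGMA z:A. ?R z)" using m unfolding e by simp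
    qed
  qed simp
  hence "real (card {(x, y, z, u). x \<in> A \<and> y \<in> A \<and> z \<in> A \<and> u \<in> A \<and> x + y = z + u}) \<le> real (card (SIGMA z:A. ?R z))"
    by (simp only: of_nat_le_iff)
  also have "card (SIGMA z:A. ?R z) = (\<Sum>z\<in>A. card (?R z))" by (rule card_SigmaI) simp_all
  also have "real \<dots> = (\<Sum>z\<in>A. real (card (?R z)))" by (rule of_nat_sum)
  also have "\<dots> \<le> (\<Sum>z\<in>A. 2 * real (card A) + 8 * (real k)\<^sup>2 + B)" by (intro sum_mono R)
  also have "\<dots> = real (card A) * (2 * real (card A) + 8 * (real k)\<^sup>2 + B)" by simp
  finally show ?thesis .
qed

section \<open>The energy bounds over a field of prime order\<close>

lemma sphere_energy_second_moment_bound: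
  fixes A :: "'a::{field,finite} vec3 set"
  assumes two: "(2::'a) \<noteq> 0" and A: "A \<subseteq> {x. dot x x = t}" "t \<noteq> 0"
    and iso: "\<And>a s. s \<noteq> 0 \<Longrightarrow> dot s s = 0 \<Longrightarrow> card (A \<inter> range (\<lambda>c. a + scale c s)) \<le> k"
    and n: "n = real (card A)" and q: "q = real (CARD('a))"
  shows "real (card {(x, y, z, u). x \<in> A \<and> y \<in> A \<and> z \<in> A \<and> u \<in> A \<and> x + y = z + u})
    \<le> 8 * (n * (real k)\<^sup>2 + n ^ 3 / q + n\<^sup>2 * sqrt q)"
proof -
  have q1: "q \<ge> 1" unfolding q by (simp add: Suc_le_eq)
  have n0: "n \<ge> 0" by (simp add: n)
  have "real (card {(x, y, z, u). x \<in> A \<and> y \<in> A \<and> z \<in> A \<and> u \<in> A \<and> x + y = z + u})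
    \<le> n * (2 * n + 8 * (real k)\<^sup>2 + (n * n / q + sqrt q * n))" unfolding n
  proof (rule energy_on_sphere[OF two A iso])
    fix V :: "'a vec3 set" assume V: "projective V" and c: "card V \<le> card A"
    have c': "real (card V) \<le> n" using c by (simp add: n)
    have "real (incidences (\<lambda>x l. dot x l = 0) V V) \<le> card V * card V / q + sqrt (q * card V * card V)"
      using incidences_by_second_moment[OF V V] by (simp add: q)
    also have "sqrt (q * card V * card V) = sqrt q * card V" by (simp add: real_sqrt_mult)
    also have "card V * card V / q + sqrt q * card V \<le> n * n / q + sqrt q * n"
      unfolding of_nat_mult using c' q1 n0 by (intro add_mono divide_right_mono mult_mono mult_left_mono) auto
    finally show "real (incidences (\<lambda>x l. dot x l = 0) V V) \<le> real (card A) * real (card A) / q + sqrt q * real (card A)"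
      by (simp add: n)
  qed
  also have "\<dots> = 8 * (n * (real k)\<^sup>2) + n ^ 3 / q + (2 * n\<^sup>2 * 1 + n\<^sup>2 * sqrt q)"
    by (simp add: algebra_simps power2_eq_square power3_eq_cube)
  also have "\<dots> \<le> 8 * (n * (real k)\<^sup>2) + 8 * (n ^ 3 / q) + (2 * n\<^sup>2 * sqrt q + 6 * n\<^sup>2 * sqrt q)"
  proof -
    have "2 * n\<^sup>2 * 1 \<le> 2 * n\<^sup>2 * sqrt q" using q1 by (intro mult_left_mono) auto
    moreover have "0 \<le> n\<^sup>2 * sqrt q" "0 \<le> n ^ 3 / q" using q1 n0 by auto
    ultimately show ?thesis by linarith
  qed
  also have "\<dots> = 8 * (n * (real k)\<^sup>2 + n ^ 3 / q + n\<^sup>2 * sqrt q)" by (simp add: algebra_simps)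
  finally show ?thesis .
qed

lemma sphere_energy_incidence_bound:
  fixes A :: "'a::{field,finite} vec3 set"
  assumes char: "\<And>n. 0 < n \<Longrightarrow> n < p \<Longrightarrow> of_nat n \<noteq> (0::'a)" and p: "2 < p"
    and A: "A \<subseteq> {x. dot x x = t}" "t \<noteq> 0"
    and iso: "\<And>a s. s \<noteq> 0 \<Longrightarrow> dot s s = 0 \<Longrightarrow> card (A \<inter> range (\<lambda>c. a + scale c s)) \<le> k"
    and n: "n = real (card A)" and small: "card A ^ 4 \<le> p ^ 5"
  shows "real (card {(x, y, z, u). x \<in> A \<and> y \<in> A \<and> z \<in> A \<and> u \<in> A \<and> x + y = z + u})
    \<le> 2 ^ 27 * (n * (real k)\<^sup>2 + n powr (37 / 15))"
proof (cases "A = {}")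
  case True
  thus ?thesis by (simp add: n)
next
  case False
  hence n1: "n \<ge> 1" by (simp add: n Suc_le_eq card_gt_0_iff)
  have two: "(2::'a) \<noteq> 0" using char[of 2] p by simp
  have "real (card {(x, y, z, u). x \<in> A \<and> y \<in> A \<and> z \<in> A \<and> u \<in> A \<and> x + y = z + u})
    \<le> n * (2 * n + 8 * (real k)\<^sup>2 + 2 ^ 26 * n powr (22 / 15))" unfolding n
  proof (rule energy_on_sphere[OF two A iso])
    fix V :: "'a vec3 set" assume V: "projective V" and c: "card V \<le> card A"
    have "card V ^ 4 \<le> card A ^ 4" using c by (rule power_mono) simp
    hence le: "card V ^ 4 \<le> p ^ 5" using small by linarith
    have "real (incidences (\<lambda>x l. dot x l = 0) V V) ^ 15 \<le> 2 ^ 390 * real (card V) ^ 22"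
      by (rule projective_incidences[OF char V]) (use le in simp_all)
    also have "\<dots> \<le> 2 ^ 390 * n ^ 22" using c by (intro mult_left_mono power_mono) (auto simp: n)
    also have "\<dots> = (2 ^ 26 * n powr (22 / 15)) ^ 15"
    proof -
      have "(n powr (22 / 15)) ^ 15 = n powr 22" using n1 by (simp add: powr_power)
      thus ?thesis using n1 by (simp add: power_mult_distrib flip: power_mult)
    qed
    finally have "real (incidences (\<lambda>x l. dot x l = 0) V V) \<le> 2 ^ 26 * n powr (22 / 15)"
      by (subst (asm) power_mono_iff) (use n1 in simp_all)
    thus "real (incidences (\<lambda>x l. dot x l = 0) V V) \<le> 2 ^ 26 * real (card A) powr (22 / 15)" by (simp add: n)
  qed
  also have "\<dots> = 8 * (n * (real k)\<^sup>2) + 2 * n\<^sup>2 + 2 ^ 26 * (n powr 1 * n powr (22 / 15))"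
    using n1 by (simp add: algebra_simps power2_eq_square)
  also have "n powr 1 * n powr (22 / 15) = n powr (37 / 15)" by (subst powr_add[symmetric]) simp
  also have "n\<^sup>2 \<le> n powr (37 / 15)"
  proof -
    have "n\<^sup>2 = n powr 2" using n1 by simp
    also have "\<dots> \<le> n powr (37 / 15)" using n1 by (intro powr_mono) auto
    finally show ?thesis .
  qed
  finally have "real (card {(x, y, z, u). x \<in> A \<and> y \<in> A \<and> z \<in> A \<and> u \<in> A \<and> x + y = z + u})
    \<le> 8 * (n * (real k)\<^sup>2) + 2 * n powr (37 / 15) + 2 ^ 26 * n powr (37 / 15)" by simp
  moreover have "0 \<le> n * (real k)\<^sup>2" "0 \<le> n powr (37 / 15)" using n1 by auto
  ultimately show ?thesis by (simp add: algebra_simps)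
qed

text \<open>The first term needs \<open>n ^ 8 \<le> p ^ 15\<close> and the second one
  \<open>p ^ 15 \<le> n ^ 14\<close>.\<close>
lemma second_moment_bound_large_sets:
  fixes n p :: real
  assumes p: "1 \<le> p" and large: "p ^ 5 < n ^ 4" "0 \<le> n" and small: "n < p powr (15 / 11)"
  shows "n ^ 3 / p + n\<^sup>2 * sqrt p \<le> 2 * n powr (37 / 15)"
proof -
  have n1: "1 \<le> n"
  proof (rule ccontr)
    assume "\<not> 1 \<le> n"
    hence "n ^ 4 \<le> 1 ^ 4" using large by (intro power_mono) auto
    moreover have "1 \<le> p ^ 5" using p by (rule one_le_power)
    ultimately show False using large by simp
  qed
  have "n powr (8 / 15) \<le> (p powr (15 / 11)) powr (8 / 15)" using small n1 by (intro powr_mono2) auto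
  also have "\<dots> \<le> p powr 1" unfolding powr_powr using p by (intro powr_mono) auto
  finally have 1: "n powr (8 / 15) \<le> p" using p by simp
  have "n ^ 3 = n powr (37 / 15) * n powr (8 / 15)" using n1 by (simp flip: powr_add)
  also have "\<dots> \<le> n powr (37 / 15) * p" using 1 by (intro mult_left_mono) auto
  finally have A: "n ^ 3 / p \<le> n powr (37 / 15)" using p by (simp add: field_simps)
  have p5: "p ^ 5 = p powr 5" and n4: "n ^ 4 = n powr 4" using p n1 by simp_all
  have "p = (p ^ 5) powr (1 / 5)" unfolding p5 powr_powr using p by simp
  also have "\<dots> \<le> (n ^ 4) powr (1 / 5)" using large p by (intro powr_mono2) auto
  also have "\<dots> = n powr (4 / 5)" unfolding n4 powr_powr by simp
  finally have "sqrt p \<le> sqrt (n powr (4 / 5))" by simp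
  also have "\<dots> = n powr (2 / 5)" using n1 by (subst powr_half_sqrt[symmetric]) (simp_all add: powr_powr)
  also have "\<dots> \<le> n powr (7 / 15)" using n1 by (intro powr_mono) auto
  finally have "n\<^sup>2 * sqrt p \<le> n powr 2 * n powr (7 / 15)" using n1 p by (intro mult_mono) auto
  also have "\<dots> = n powr (37 / 15)" by (simp flip: powr_add)
  finally show ?thesis using A by simp
qed

theorem sphere_energy_bounds:
  fixes A :: "'a::{field,finite} vec3 set"
  assumes char: "\<And>n. 0 < n \<Longrightarrow> n < CARD('a) \<Longrightarrow> of_nat n \<noteq> (0::'a)" and p: "p = CARD('a)" "2 < p"
    and A: "A \<subseteq> {x. dot x x = t}" "t \<noteq> 0"
    and iso: "\<And>a s. s \<noteq> 0 \<Longrightarrow> dot s s = 0 \<Longrightarrow> card (A \<inter> range (\<lambda>c. a + scale c s)) \<le> k"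
    and E: "E = real (card {(x, y, z, u). x \<in> A \<and> y \<in> A \<and> z \<in> A \<and> u \<in> A \<and> x + y = z + u})"
    and n: "n = real (card A)"
  shows "E \<le> 2 ^ 27 * (n * (real k)\<^sup>2 + n ^ 3 / p + n\<^sup>2 * sqrt p)"
    and "n < p powr (15 / 11) \<Longrightarrow> E \<le> 2 ^ 27 * (n * (real k)\<^sup>2 + n powr (37 / 15))"
proof -
  have two: "(2::'a) \<noteq> 0" using char[of 2] p by simp
  have n0: "0 \<le> n" by (simp add: n)
  have sm: "E \<le> 8 * (n * (real k)\<^sup>2 + n ^ 3 / p + n\<^sup>2 * sqrt p)"
    unfolding E using p(1) by (intro sphere_energy_second_moment_bound[OF two A iso n]) simp_all
  also have "\<dots> \<le> 2 ^ 27 * (n * (real k)\<^sup>2 + n ^ 3 / p + n\<^sup>2 * sqrt p)" using n0 by (intro mult_right_mono) auto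
  finally show "E \<le> 2 ^ 27 * (n * (real k)\<^sup>2 + n ^ 3 / p + n\<^sup>2 * sqrt p)" .
  assume small: "n < p powr (15 / 11)"
  show "E \<le> 2 ^ 27 * (n * (real k)\<^sup>2 + n powr (37 / 15))"
  proof (cases "card A ^ 4 \<le> p ^ 5")
    case True
    thus ?thesis unfolding E by (intro sphere_energy_incidence_bound[OF char _ A iso n]) (use p in simp_all)
  next
    case False
    hence "real (p ^ 5) < real (card A ^ 4)" by (simp only: of_nat_less_iff not_le)
    hence "n ^ 3 / p + n\<^sup>2 * sqrt p \<le> 2 * n powr (37 / 15)"
      using small p by (intro second_moment_bound_large_sets) (simp_all add: n)
    hence "E \<le> 8 * (n * (real k)\<^sup>2) + 16 * n powr (37 / 15)" using sm by simp
    moreover have "0 \<le> n * (real k)\<^sup>2" "0 \<le> n powr (37 / 15)" using n0 by auto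
    ultimately have "E \<le> 134217728 * (n * (real k)\<^sup>2) + 134217728 * n powr (37 / 15)" by linarith
    thus ?thesis by (simp add: distrib_left)
  qed
qed


section \<open>From residues modulo a prime to a type of residues\<close>

context
  fixes F :: "int ring" and R :: "'a::prime_card mod_ring \<Rightarrow> int"
  assumes F: "F = residue_ring (int CARD('a))" and R: "R = to_int_mod_ring"
begin

definition "R3 = (\<lambda>(x1, x2, x3). (R x1, R x2, R x3))"

lemma residue_carrier: "carrier F = range R"
  unfolding R range_to_int_mod_ring by (auto simp: F residue_ring_def)

lemma residue_zero: "\<zero>\<^bsub>F\<^esub> = R 0"
  by (simp add: F R residue_ring_def)

lemma residue_add: "R x \<oplus>\<^bsub>F\<^esub> R y = R (x + y)"
  by (simp add: F R residue_ring_def to_int_mod_ring_add)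

lemma residue_mult: "R x \<otimes>\<^bsub>F\<^esub> R y = R (x * y)"
  by (simp add: F R residue_ring_def to_int_mod_ring_mult)

lemma residue_square: "R x [^]\<^bsub>F\<^esub> (2::nat) = R (x * x)"
proof -
  have "\<one>\<^bsub>F\<^esub> = R 1" by (simp add: F R residue_ring_def)
  thus ?thesis by (simp add: numeral_2_eq_2 nat_pow_def residue_mult)
qed

lemma inj_R: "R x = R y \<longleftrightarrow> x = y"
  by (simp add: R)

lemma inj_R3: "inj R3"
  by (rule injI) (auto simp: R3_def inj_R)

lemma R3_add: "add3 F (R3 x) (R3 y) = R3 (x + y)"
  by (cases x; cases y) (simp add: R3_def residue_add)

lemma R3_scale: "scale3 F (R c) (R3 x) = R3 (scale c x)"
  by (cases x) (simp add: R3_def residue_mult)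

lemma R3_dot: "dot3 F (R3 x) (R3 y) = R (dot x y)"
  by (cases x; cases y) (simp add: R3_def residue_mult residue_add)

lemma space3_range: "space3 F = range R3"
proof (intro equalityI subsetI)
  fix v assume "v \<in> space3 F"
  then obtain x y z where "v = (R x, R y, R z)" by (auto simp: space3_def residue_carrier)
  hence "v = R3 (x, y, z)" by (simp add: R3_def)
  thus "v \<in> range R3" by blast
qed (auto simp: space3_def residue_carrier R3_def)

lemma R3_sphere: "R3 x \<in> sphere2 F (R t) \<longleftrightarrow> dot x x = t"
proof -
  obtain x1 x2 x3 where x: "x = (x1, x2, x3)" by (cases x)
  have "R3 x \<in> space3 F" by (simp add: space3_range)
  thus ?thesis by (simp add: sphere2_def x R3_def residue_square residue_add inj_R)
qed

lemma isotropic_line_R3: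
  assumes "s \<noteq> 0" "dot s s = 0" shows "isotropic_line F (R3 ` range (\<lambda>c. a + scale c s))"
proof -
  have "isotropic F (R3 s)"
  proof -
    have "(\<zero>\<^bsub>F\<^esub>, \<zero>\<^bsub>F\<^esub>, \<zero>\<^bsub>F\<^esub>) = R3 0" by (simp add: R3_def residue_zero zero_prod_def)
    thus ?thesis using assms inj_R3 by (simp add: isotropic_def space3_range R3_dot residue_zero inj_eq)
  qed
  moreover have "R3 ` range (\<lambda>c. a + scale c s) = affine_line F (R3 a) (R3 s)"
  proof -
    have "affine_line F (R3 a) (R3 s) = range (\<lambda>c. add3 F (R3 a) (scale3 F (R c) (R3 s)))"
      unfolding affine_line_def residue_carrier by blast
    thus ?thesis unfolding R3_scale R3_add by (simp only: image_image)
  qed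
  ultimately show ?thesis unfolding isotropic_line_def space3_range by blast
qed

lemma residue_sphere_energy_bounds:
  assumes odd: "odd CARD('a)" and t: "t \<in> carrier F" "t \<noteq> \<zero>\<^bsub>F\<^esub>" and A: "A \<subseteq> sphere2 F t"
    and iso: "\<And>L. isotropic_line F L \<Longrightarrow> card (A \<inter> L) \<le> k"
    and n: "n = real (card A)" and p: "p = CARD('a)"
  shows "real (additive_energy F A) \<le> 2 ^ 27 * (n * real k ^ 2 + n ^ 3 / p + n ^ 2 * sqrt p)"
    and "n < p powr (15 / 11) \<Longrightarrow> real (additive_energy F A) \<le> 2 ^ 27 * (n * real k ^ 2 + n powr (37 / 15))"
proof -
  obtain t' where t': "t = R t'" using t(1) unfolding residue_carrier by blast
  define B where "B = R3 -` A"
  have "A \<subseteq> range R3" using A unfolding sphere2_def space3_range by blast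
  hence AB: "A = R3 ` B" unfolding B_def by (simp add: image_vimage_eq Int_absorb2)
  have cAB: "card A = card B" unfolding AB by (rule card_image) (rule inj_on_subset[OF inj_R3], simp)
  have sphere: "B \<subseteq> {x. dot x x = t'}"
  proof
    fix x assume "x \<in> B"
    hence "R3 x \<in> sphere2 F (R t')" using A unfolding B_def t' by blast
    thus "x \<in> {x. dot x x = t'}" by (simp add: R3_sphere)
  qed
  have t0: "t' \<noteq> 0" using t(2) unfolding t' residue_zero by blast
  have lines: "card (B \<inter> range (\<lambda>c. a + scale c s)) \<le> k" if "s \<noteq> 0" "dot s s = 0" for a s
  proof -
    have "card (B \<inter> range (\<lambda>c. a + scale c s)) = card (R3 ` (B \<inter> range (\<lambda>c. a + scale c s)))"
      by (rule card_image[symmetric]) (rule inj_on_subset[OF inj_R3], simp)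
    also have "R3 ` (B \<inter> range (\<lambda>c. a + scale c s)) = A \<inter> R3 ` range (\<lambda>c. a + scale c s)"
      unfolding AB by (rule image_Int[OF inj_R3])
    also have "card \<dots> \<le> k" by (rule iso[OF isotropic_line_R3[OF that]])
    finally show ?thesis .
  qed
  have energy: "additive_energy F A = card {(x, y, z, u). x \<in> B \<and> y \<in> B \<and> z \<in> B \<and> u \<in> B \<and> x + y = z + u}" (is "_ = card ?E")
  proof -
    let ?g = "\<lambda>w. (R3 (fst w), R3 (fst (snd w)), R3 (fst (snd (snd w))), R3 (snd (snd (snd w))))"
    have "{(x, y, z, u). x \<in> A \<and> y \<in> A \<and> z \<in> A \<and> u \<in> A \<and> add3 F x y = add3 F z u} = ?g ` ?E"
    proof (intro equalityI subsetI)
      fix w assume "w \<in> {(x, y, z, u). x \<in> A \<and> y \<in> A \<and> z \<in> A \<and> u \<in> A \<and> add3 F x y = add3 F z u}"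
      then obtain x y z u where w: "w = (x, y, z, u)" and m: "x \<in> A" "y \<in> A" "z \<in> A" "u \<in> A" and e: "add3 F x y = add3 F z u"
        by blast
      obtain x' y' z' u' where m': "x' \<in> B" "y' \<in> B" "z' \<in> B" "u' \<in> B" and im: "x = R3 x'" "y = R3 y'" "z = R3 z'" "u = R3 u'"
        using m unfolding AB by blast
      have "x' + y' = z' + u'" using e inj_R3 unfolding im R3_add by (simp add: inj_eq)
      hence "(x', y', z', u') \<in> ?E" using m' by blast
      hence "?g (x', y', z', u') \<in> ?g ` ?E" by (rule imageI)
      thus "w \<in> ?g ` ?E" unfolding w im by simp
    next
      fix w assume "w \<in> ?g ` ?E"
      then obtain v where v: "v \<in> ?E" "w = ?g v" by blast
      then obtain x y z u where e: "v = (x, y, z, u)" and m: "x \<in> B" "y \<in> B" "z \<in> B" "u \<in> B" and s: "x + y = z + u" by blast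
      have "w = (R3 x, R3 y, R3 z, R3 u)" unfolding v(2) e by simp
      moreover have "add3 F (R3 x) (R3 y) = add3 F (R3 z) (R3 u)" unfolding R3_add s ..
      moreover have "R3 x \<in> A" "R3 y \<in> A" "R3 z \<in> A" "R3 u \<in> A" using m unfolding AB by blast+
      ultimately show "w \<in> {(x, y, z, u). x \<in> A \<and> y \<in> A \<and> z \<in> A \<and> u \<in> A \<and> add3 F x y = add3 F z u}" by blast
    qed
    moreover have "inj_on ?g ?E"
    proof (rule inj_onI)
      fix v w assume "?g v = ?g w"
      hence "fst v = fst w" "fst (snd v) = fst (snd w)" "fst (snd (snd v)) = fst (snd (snd w))" "snd (snd (snd v)) = snd (snd (snd w))"
        using inj_R3 by (simp_all add: inj_eq)
      thus "v = w" by (simp add: prod_eq_iff)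
    qed
    ultimately show ?thesis unfolding additive_energy_def by (simp only: card_image)
  qed
  have char: "of_nat m \<noteq> (0::'a mod_ring)" if "0 < m" "m < CARD('a mod_ring)" for m
  proof
    assume "of_nat m = (0::'a mod_ring)"
    hence "CARD('a) dvd m" by (rule of_nat_0_mod_ring_dvd)
    thus False using that by (auto dest: dvd_imp_le)
  qed
  have p': "p = CARD('a mod_ring)" by (simp add: p)
  have p2: "2 < p"
  proof -
    have "p \<noteq> 2" using odd unfolding p by auto
    moreover have "1 < p" unfolding p by (rule nontriv)
    ultimately show ?thesis by simp
  qed
  note bounds = sphere_energy_bounds[OF char p' p2 sphere t0 lines arg_cong[OF energy, of real] n[unfolded cAB]]
  show "real (additive_energy F A) \<le> 2 ^ 27 * (n * real k ^ 2 + n ^ 3 / p + n ^ 2 * sqrt p)"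
    by (rule bounds(1))
  show "real (additive_energy F A) \<le> 2 ^ 27 * (n * real k ^ 2 + n powr (37 / 15))" if "n < p powr (15 / 11)"
    using that by (rule bounds(2)[rotated -1])
qed

end

text \<open>The constant is explicit here so that a single prime can be chosen that refutes the bounds if any prime does.\<close>
definition energy_bounds_modulo :: "nat \<Rightarrow> bool" where
  "energy_bounds_modulo p \<longleftrightarrow>
     (\<forall>(F::int ring) (t::int) (A::(int \<times> int \<times> int) set) (k0::nat).
        F = residue_ring (int p) \<longrightarrow>
        t \<in> carrier F \<longrightarrow> t \<noteq> \<zero>\<^bsub>F\<^esub> \<longrightarrow> A \<subseteq> sphere2 F t \<longrightarrow>
        (\<forall>L. isotropic_line F L \<longrightarrow> card (A \<inter> L) \<le> k0) \<longrightarrow>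
        (real (card A) < real p powr (15 / 11) \<longrightarrow>
           real (additive_energy F A)
             \<le> 2 ^ 27 * (real (card A) * real k0 ^ 2 + real (card A) powr (37 / 15))) \<and>
        real (additive_energy F A)
          \<le> 2 ^ 27 * (real (card A) * real k0 ^ 2 + real (card A) ^ 3 / real p
                 + real (card A) ^ 2 * sqrt (real p)))"

definition test_prime :: nat where
  "test_prime = (SOME p. prime p \<and> odd p \<and> ((\<exists>q. prime q \<and> odd q \<and> \<not> energy_bounds_modulo q) \<longrightarrow> \<not> energy_bounds_modulo p))"

lemma test_prime:
  "prime test_prime" "odd test_prime"
  "energy_bounds_modulo test_prime \<Longrightarrow> prime q \<Longrightarrow> odd q \<Longrightarrow> energy_bounds_modulo q"
proof -
  let ?P = "\<lambda>p. prime p \<and> odd p \<and> ((\<exists>q. prime q \<and> odd q \<and> \<not> energy_bounds_modulo q) \<longrightarrow> \<not> energy_bounds_modulo p)"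
  have "\<exists>p. ?P p"
  proof (cases "\<exists>q. prime q \<and> odd q \<and> \<not> energy_bounds_modulo q")
    case True thus ?thesis by blast
  next
    case False
    have "prime (3::nat) \<and> odd (3::nat)" by simp
    thus ?thesis using False by blast
  qed
  hence "?P test_prime" unfolding test_prime_def by (rule someI_ex)
  thus "prime test_prime" "odd test_prime"
    "energy_bounds_modulo test_prime \<Longrightarrow> prime q \<Longrightarrow> odd q \<Longrightarrow> energy_bounds_modulo q" by blast+
qed

typedef test_index = "{..<test_prime}"
  using prime_gt_0_nat[OF test_prime(1)] by blast

lemma card_test_index: "CARD(test_index) = test_prime"
  using type_definition.card[OF type_definition_test_index] by simp

text \<open>The residues modulo \<open>test_prime\<close> thereby are a type of class \<open>field\<close>.\<close>
instance test_index :: prime_card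
  by standard (simp add: card_test_index test_prime)

theorem theorem18:
  "\<exists>C::real. C > 0 \<and>
     (\<forall>(p::nat) (F::int ring) (t::int) (A::(int \<times> int \<times> int) set) (k0::nat).
        prime p \<longrightarrow> odd p \<longrightarrow> F = residue_ring (int p) \<longrightarrow>
        t \<in> carrier F \<longrightarrow> t \<noteq> \<zero>\<^bsub>F\<^esub> \<longrightarrow> A \<subseteq> sphere2 F t \<longrightarrow>
        (\<forall>L. isotropic_line F L \<longrightarrow> card (A \<inter> L) \<le> k0) \<longrightarrow>
        (real (card A) < real p powr (15 / 11) \<longrightarrow>
           real (additive_energy F A)
             \<le> C * (real (card A) * real k0 ^ 2 + real (card A) powr (37 / 15))) \<and>
        real (additive_energy F A)
          \<le> C * (real (card A) * real k0 ^ 2 + real (card A) ^ 3 / real p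
                 + real (card A) ^ 2 * sqrt (real p)))"
proof -
  have "energy_bounds_modulo CARD(test_index)"
    unfolding energy_bounds_modulo_def
  proof (intro allI impI conjI)
    fix F :: "int ring" and t A k0
    assume F: "F = residue_ring (int CARD(test_index))" and t: "t \<in> carrier F" "t \<noteq> \<zero>\<^bsub>F\<^esub>" and A: "A \<subseteq> sphere2 F t"
      and iso: "\<forall>L. isotropic_line F L \<longrightarrow> card (A \<inter> L) \<le> k0"
    have odd: "odd CARD(test_index)" by (simp add: card_test_index test_prime)
    note bounds = residue_sphere_energy_bounds[OF F refl odd t A iso[rule_format] refl refl]
    show "real (additive_energy F A) \<le> 2 ^ 27 * (real (card A) * real k0 ^ 2 + real (card A) ^ 3 / real CARD(test_index)
        + real (card A) ^ 2 * sqrt (real CARD(test_index)))"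
      by (rule bounds(1))
    assume "real (card A) < real CARD(test_index) powr (15 / 11)"
    thus "real (additive_energy F A) \<le> 2 ^ 27 * (real (card A) * real k0 ^ 2 + real (card A) powr (37 / 15))"
      by (intro bounds(2))
  qed
  hence all: "energy_bounds_modulo p" if "prime p" "odd p" for p
    using test_prime(3) that unfolding card_test_index by blast
  show ?thesis
    by (rule exI[of _ "2 ^ 27"]) (use all in \<open>simp only: energy_bounds_modulo_def zero_less_power zero_less_numeral simp_thms, blast\<close>)
qed

end
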